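(* Let $K$ be a Euclidean imaginary quadratic field or a rational quaternion field, with Euclidean minimum $\mathcal{M}(K)$, and let $\mathcal{O}$ be a maximal order of $K$. Let $q:K_{\mathbb{R}}^D\to\mathbb{R}^+$ be $q(\mathbf{v})=\sum_{i=1}^Dv_iv_i^*$. Let $\Lambda$ be a lattice of dimension $d$ over $\mathcal{O}$ with a basis $B=\{\mathbf{b}_1,\dots,\mathbf{b}_d\}$ that is Minkowski reduced with respect to the norm $\sqrt{q}$, and let $\lambda_1,\dots,\lambda_d$ be the successive minima of $\Lambda$ with respect to $\sqrt{q}$. Then for all $1\le k\le d$, $q(\mathbf{b}_k)\le\delta_k^2\lambda_k^2$, where $$\delta_k=1\ (1\le k\le g),\qquad \delta_k^2=\max\Big\{1,\ \mathcal{M}(K)\sum_{i=1}^{k-1}\delta_i^2+\frac{1}{\mathrm{nrd}_{K/\mathbb{Q}}(l)}\Big\}\ (k>g),$$ $l$ is an element of $\mathcal{O}$ of smallest reduced norm among those that are neither zero nor units, and $g=\max\{2,\lfloor\mathcal{M}(K)^{-1}\rfloor\}$, except when $K=\left(\frac{-2,-5}{\mathbb{Q}}\right)$, in which case $g=1$.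
   Context: A rational quaternion field is a (definite) quaternion division algebra over $\mathbb{Q}$; $K_{\mathbb{R}}=K\otimes_{\mathbb{Q}}\mathbb{R}$ (i.e. $\mathbb{C}$ or $\mathbb{H}$), $*$ is complex conjugation resp. quaternion conjugation, and $\mathrm{nrd}_{K/\mathbb{Q}}$ is the reduced norm ($\mathrm{nrd}(x)=xx^*$). The Euclidean minimum is $\mathcal{M}(K)=\sup_{x\in K_{\mathbb{R}}}\min_{y\in\mathcal{O}}\mathrm{nrd}_{K/\mathbb{Q}}(x-y)$, and $K$ is Euclidean when $\mathcal{M}(K)<1$. A (left) lattice of dimension $d$ over $\mathcal{O}$ is $\Lambda=\bigoplus_{i=1}^d\mathcal{O}\mathbf{b}_i$ with $\mathbf{b}_i\in K^D$ linearly independent over $K$ (left scalars). A set of vectors is extendable to a basis of $\Lambda$ if it is contained in some basis of a lattice equal (as a set) to $\Lambda$. A basis is Minkowski reduced with respect to a norm $N$ if for each $k$, $\mathbf{b}_k$ is a shortest nonzero vector of $\Lambda$ such that $\{\mathbf{b}_1,\dots,\mathbf{b}_k\}$ is extendable to a basis of $\Lambda$. The $i$-th successive minimum $\lambda_i$ is the least real number such that $\Lambda$ contains $i$ vectors, linearly independent over $K$, of norm at most $\lambda_i$.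
   Formalization: The rational quaternion field K, like the imaginary quadratic field, is assumed Euclidean (M(K)<1); for every non-Euclidean definite rational quaternion field the stated bound fails at k=2. *)

theory Defs
  imports "HOL-Analysis.Analysis"
begin

section \<open>Real division algebras with a positive involution\<close>

text \<open>
  The class abstracts what the complex numbers with complex conjugation and Hamilton's quaternions
  with quaternion conjugation have in common; \<open>re\<close> is the real part. Both are made
  instances below.
\<close>

class star_div_algebra = real_div_algebra +
  fixes star :: "'a \<Rightarrow> 'a"
    and re :: "'a \<Rightarrow> real"
  assumes star_add: "star (x + y) = star x + star y"
    and star_scaleR: "star (r *\<^sub>R x) = r *\<^sub>R star x"
    and star_mult: "star (x * y) = star y * star x"
    and star_star: "star (star x) = x"
    and add_star: "x + star x = (2 * re x) *\<^sub>R 1"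
    and re_mult_star_pos: "x \<noteq> 0 \<Longrightarrow> re (x * star x) > 0"

definition nrd :: "'a::star_div_algebra \<Rightarrow> real" where
  "nrd x = re (x * star x)"

lemma of_real_nrd: "of_real (nrd x) = x * star (x::'a::star_div_algebra)"
proof -
  let ?y = "x * star x"
  have "star ?y = ?y" by (simp add: star_mult star_star)
  then have "2 *\<^sub>R ?y = (2 * re ?y) *\<^sub>R 1"
    using add_star[of ?y] by (simp add: scaleR_2)
  then have "(1/2) *\<^sub>R (2 *\<^sub>R ?y) = (1/2) *\<^sub>R ((2 * re ?y) *\<^sub>R (1::'a))" by simp
  then show ?thesis by (simp add: nrd_def of_real_def)
qed

subsection \<open>The complex numbers\<close>

instantiation complex :: star_div_algebra
begin

definition star_complex :: "complex \<Rightarrow> complex" where "star_complex = cnj"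
definition re_complex :: "complex \<Rightarrow> real" where "re_complex = Re"

instance
proof
  fix x y :: complex and r :: real
  show "star (x + y) = star x + star y" "star (r *\<^sub>R x) = r *\<^sub>R star x"
    "star (x * y) = star y * star x" "star (star x) = x" "x + star x = (2 * re x) *\<^sub>R 1"
    by (simp_all add: star_complex_def re_complex_def complex_eq_iff algebra_simps)
  show "re (x * star x) > 0" if "x \<noteq> 0"
    using that by (simp add: star_complex_def re_complex_def complex_eq_iff
        flip: power2_eq_square) (metis sum_power2_gt_zero_iff)
qed

end

subsection \<open>Hamilton's quaternions\<close>

datatype quat = Quat (Q0: real) (Q1: real) (Q2: real) (Q3: real)

lemma quat_eq_iff: "x = y \<longleftrightarrow> Q0 x = Q0 y \<and> Q1 x = Q1 y \<and> Q2 x = Q2 y \<and> Q3 x = Q3 y"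
  by (cases x; cases y) simp

instantiation quat :: star_div_algebra
begin

definition "0 = Quat 0 0 0 0"
definition "1 = Quat 1 0 0 0"
definition "x + y = Quat (Q0 x + Q0 y) (Q1 x + Q1 y) (Q2 x + Q2 y) (Q3 x + Q3 y)"
definition "- x = Quat (- Q0 x) (- Q1 x) (- Q2 x) (- Q3 x)"
definition "x - y = Quat (Q0 x - Q0 y) (Q1 x - Q1 y) (Q2 x - Q2 y) (Q3 x - Q3 y)"
definition "x * y = Quat
  (Q0 x * Q0 y - Q1 x * Q1 y - Q2 x * Q2 y - Q3 x * Q3 y)
  (Q0 x * Q1 y + Q1 x * Q0 y + Q2 x * Q3 y - Q3 x * Q2 y)
  (Q0 x * Q2 y - Q1 x * Q3 y + Q2 x * Q0 y + Q3 x * Q1 y)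
  (Q0 x * Q3 y + Q1 x * Q2 y - Q2 x * Q1 y + Q3 x * Q0 y)"
definition "r *\<^sub>R x = Quat (r * Q0 x) (r * Q1 x) (r * Q2 x) (r * Q3 x)"
definition "star x = Quat (Q0 x) (- Q1 x) (- Q2 x) (- Q3 x)"
definition "re x = Q0 x"
definition "inverse x = inverse ((Q0 x)\<^sup>2 + (Q1 x)\<^sup>2 + (Q2 x)\<^sup>2 + (Q3 x)\<^sup>2) *\<^sub>R star (x::quat)"
definition "x div y = x * inverse (y::quat)"

lemmas quat_defs = zero_quat_def one_quat_def plus_quat_def uminus_quat_def minus_quat_def
  times_quat_def scaleR_quat_def star_quat_def re_quat_def

lemma quat_sum_squares_pos:
  "x \<noteq> 0 \<Longrightarrow> (Q0 x)\<^sup>2 + (Q1 x)\<^sup>2 + (Q2 x)\<^sup>2 + (Q3 x)\<^sup>2 > 0"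
  unfolding quat_eq_iff zero_quat_def quat.sel
  by (smt (verit) zero_less_power2 zero_le_power2)

lemma quat_mult_star:
  "x * star x = Quat ((Q0 x)\<^sup>2 + (Q1 x)\<^sup>2 + (Q2 x)\<^sup>2 + (Q3 x)\<^sup>2) 0 0 0"
  "star x * x = Quat ((Q0 x)\<^sup>2 + (Q1 x)\<^sup>2 + (Q2 x)\<^sup>2 + (Q3 x)\<^sup>2) 0 0 0"
  by (simp_all add: quat_defs power2_eq_square)

instance
proof
  fix x y z :: quat and r s :: real
  show "x + y + z = x + (y + z)" "x + y = y + x" "0 + x = x" "- x + x = 0" "x - y = x + - y"
    "x * y * z = x * (y * z)" "1 * x = x" "x * 1 = x"
    "(x + y) * z = x * z + y * z" "x * (y + z) = x * y + x * z" "(0::quat) \<noteq> 1"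
    "r *\<^sub>R (x + y) = r *\<^sub>R x + r *\<^sub>R y" "(r + s) *\<^sub>R x = r *\<^sub>R x + s *\<^sub>R x"
    "r *\<^sub>R s *\<^sub>R x = (r * s) *\<^sub>R x" "1 *\<^sub>R x = x"
    "r *\<^sub>R x * y = r *\<^sub>R (x * y)" "x * r *\<^sub>R y = r *\<^sub>R (x * y)"
    "star (x + y) = star x + star y" "star (r *\<^sub>R x) = r *\<^sub>R star x"
    "star (x * y) = star y * star x" "star (star x) = x" "x + star x = (2 * re x) *\<^sub>R 1"
    by (simp_all add: quat_defs algebra_simps)
  show "x div y = x * inverse y" by (rule divide_quat_def)
  show "inverse (0::quat) = 0" by (simp add: inverse_quat_def quat_defs)
  assume "x \<noteq> 0"
  note pos = quat_sum_squares_pos[OF this]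
  show "re (x * star x) > 0" using pos by (simp add: quat_mult_star re_quat_def)
  have scale: "a * (r *\<^sub>R b) = r *\<^sub>R (a * b)" "(r *\<^sub>R a) * b = r *\<^sub>R (a * b)" for a b :: quat and r
    by (simp_all add: quat_defs algebra_simps)
  show "inverse x * x = 1" "x * inverse x = 1"
    using pos by (simp_all add: inverse_quat_def scale quat_mult_star)
      (simp_all add: scaleR_quat_def one_quat_def)
qed

end


section \<open>Imaginary quadratic fields and definite rational quaternion algebras\<close>

definition imaginary_quadratic_field :: "'a::star_div_algebra set \<Rightarrow> bool" where
  "imaginary_quadratic_field K \<longleftrightarrow>
    (\<exists>(a::rat) s. a < 0 \<and> s * s = of_real (of_rat a) \<and>
       K = {of_real x + of_real y * s | x y. x \<in> \<rat> \<and> y \<in> \<rat>})"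

definition is_quaternion_algebra :: "'a::star_div_algebra set \<Rightarrow> rat \<Rightarrow> rat \<Rightarrow> bool" where
  "is_quaternion_algebra K a b \<longleftrightarrow>
    (\<exists>i j. i * i = of_real (of_rat a) \<and> j * j = of_real (of_rat b) \<and> i * j = - (j * i) \<and>
       K = {of_real x + of_real y * i + of_real z * j + of_real w * (i * j) | x y z w.
              x \<in> \<rat> \<and> y \<in> \<rat> \<and> z \<in> \<rat> \<and> w \<in> \<rat>})"

definition rational_quaternion_field :: "'a::star_div_algebra set \<Rightarrow> bool" where
  "rational_quaternion_field K \<longleftrightarrow> (\<exists>a b. a < 0 \<and> b < 0 \<and> is_quaternion_algebra K a b)"


section \<open>Orders and the Euclidean minimum\<close>

definition is_order :: "'a::star_div_algebra set \<Rightarrow> 'a set \<Rightarrow> bool" where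
  "is_order K \<O> \<longleftrightarrow>
     \<O> \<subseteq> K \<and> 1 \<in> \<O> \<and> (\<forall>x\<in>\<O>. \<forall>y\<in>\<O>. x - y \<in> \<O> \<and> x * y \<in> \<O>) \<and>
     (\<exists>S. finite S \<and> \<O> = {\<Sum>s\<in>S. of_int (c s) * s | c. True}) \<and>
     (\<forall>x\<in>K. \<exists>n::nat. n > 0 \<and> of_nat n * x \<in> \<O>)"

definition is_maximal_order :: "'a::star_div_algebra set \<Rightarrow> 'a set \<Rightarrow> bool" where
  "is_maximal_order K \<O> \<longleftrightarrow> is_order K \<O> \<and> (\<forall>\<O>'. is_order K \<O>' \<and> \<O> \<subseteq> \<O>' \<longrightarrow> \<O>' = \<O>)"

definition order_units :: "'a::star_div_algebra set \<Rightarrow> 'a set" where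
  "order_units \<O> = {x \<in> \<O>. \<exists>y\<in>\<O>. x * y = 1 \<and> y * x = 1}"

text \<open>
  For the two kinds of \<open>K\<close> considered, a \<open>\<rat>\<close>-basis of \<open>K\<close> is linearly
  independent over \<open>\<real>\<close>, so the real span of \<open>K\<close> is
  \<open>K \<otimes>\<^sub>\<rat> \<real>\<close>. The inner infimum is attained because \<open>\<O>\<close> is
  discrete.
\<close>

definition euclidean_minimum :: "'a::star_div_algebra set \<Rightarrow> 'a set \<Rightarrow> real" where
  "euclidean_minimum K \<O> = (SUP x\<in>span K. INF y\<in>\<O>. nrd (x - y))"


section \<open>Lattices over an order\<close>

text \<open>
  Vectors of \<open>K\<^sup>D\<close> are those elements of \<open>'a ^ 'D\<close> all of whose entries lie in
  \<open>K\<close>; \<open>c *s v\<close> multiplies each entry by \<open>c\<close> from the left. Families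
  of \<open>n\<close> vectors are functions on \<open>nat\<close>, used on \<open>{1..n}\<close> only.
\<close>

definition q :: "'a::star_div_algebra ^ 'D \<Rightarrow> real" where
  "q v = (\<Sum>i\<in>UNIV. nrd (v $ i))"

definition lin_indep :: "'a::star_div_algebra set \<Rightarrow> nat \<Rightarrow> (nat \<Rightarrow> 'a ^ 'D) \<Rightarrow> bool" where
  "lin_indep K n v \<longleftrightarrow>
    (\<forall>c. (\<forall>i\<in>{1..n}. c i \<in> K) \<and> (\<Sum>i\<in>{1..n}. c i *s v i) = 0 \<longrightarrow> (\<forall>i\<in>{1..n}. c i = 0))"

definition is_lattice_basis ::
    "'a::star_div_algebra set \<Rightarrow> 'a set \<Rightarrow> nat \<Rightarrow> (nat \<Rightarrow> 'a ^ 'D) \<Rightarrow> ('a ^ 'D) set \<Rightarrow> bool" where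
  "is_lattice_basis K \<O> d b \<Lambda> \<longleftrightarrow>
     (\<forall>i\<in>{1..d}. \<forall>j. b i $ j \<in> K) \<and> lin_indep K d b \<and>
     \<Lambda> = {\<Sum>i\<in>{1..d}. c i *s b i | c. \<forall>i\<in>{1..d}. c i \<in> \<O>}"

definition extendable ::
    "'a::star_div_algebra set \<Rightarrow> 'a set \<Rightarrow> ('a ^ 'D) set \<Rightarrow> ('a ^ 'D) set \<Rightarrow> bool" where
  "extendable K \<O> \<Lambda> S \<longleftrightarrow> (\<exists>d b. is_lattice_basis K \<O> d b \<Lambda> \<and> S \<subseteq> b ` {1..d})"

text \<open>
  The competitors for \<open>b k\<close> have to be different from \<open>b 1, \<dots>, b (k - 1)\<close>:
  otherwise \<open>b 1\<close> itself would compete with \<open>b 2\<close>, since extendability is a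
  property of sets.
\<close>

definition minkowski_reduced ::
    "('a ^ 'D \<Rightarrow> real) \<Rightarrow> 'a::star_div_algebra set \<Rightarrow> 'a set \<Rightarrow> nat \<Rightarrow> (nat \<Rightarrow> 'a ^ 'D) \<Rightarrow>
      ('a ^ 'D) set \<Rightarrow> bool" where
  "minkowski_reduced N K \<O> d b \<Lambda> \<longleftrightarrow>
     is_lattice_basis K \<O> d b \<Lambda> \<and>
     (\<forall>k\<in>{1..d}. is_arg_min N
        (\<lambda>v. v \<in> \<Lambda> \<and> v \<noteq> 0 \<and> v \<notin> b ` {1..<k} \<and> extendable K \<O> \<Lambda> (insert v (b ` {1..<k})))
        (b k))"

definition successive_minimum ::
    "('a ^ 'D \<Rightarrow> real) \<Rightarrow> 'a::star_div_algebra set \<Rightarrow> ('a ^ 'D) set \<Rightarrow> nat \<Rightarrow> real" where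
  "successive_minimum N K \<Lambda> i =
     (LEAST r. \<exists>v. (\<forall>j\<in>{1..i}. v j \<in> \<Lambda> \<and> N (v j) \<le> r) \<and> lin_indep K i v)"


section \<open>The constants of the bound\<close>

definition g_const :: "'a::star_div_algebra set \<Rightarrow> 'a set \<Rightarrow> nat" where
  "g_const K \<O> =
     (if is_quaternion_algebra K (-2) (-5) then 1
      else max 2 (nat \<lfloor>inverse (euclidean_minimum K \<O>)\<rfloor>))"

text \<open>\<open>M\<close> is the Euclidean minimum, \<open>n\<close> the reduced norm of \<open>l\<close>.\<close>

fun delta :: "real \<Rightarrow> real \<Rightarrow> nat \<Rightarrow> nat \<Rightarrow> real" where
  "delta M n g k =
     (if k \<le> g then 1 else sqrt (max 1 (M * (\<Sum>i\<in>{1..<k}. (delta M n g i)\<^sup>2) + 1 / n)))"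

declare delta.simps [simp del]

end

theory Submission
  imports Defs
begin

text \<open>
  Let \<open>v\<close> be a lattice vector of norm at most the \<open>k\<close>-th successive minimum outside the
  \<open>K\<close>-span of \<open>b 1, \<dots>, b (k - 1)\<close>. By Euclidean division \<open>v\<close> is
  \<open>a *s w\<close> plus a combination of these vectors, where all translates of \<open>w\<close> by
  combinations of them extend them to a basis. If \<open>a\<close> is a unit, then \<open>q (b k) \<le> q v\<close>;
  otherwise reducing \<open>inverse a *s v\<close> against \<open>b 1, \<dots>, b (k - 1)\<close> one vector at a time
  costs at most \<open>M * q (b j)\<close> each, which is the recursion for \<open>delta\<close>. For
  \<open>k \<le> 1 / M\<close> the bound is \<open>1\<close>, since \<open>1 / nrd l \<le> M\<close>.

  What remains is \<open>k = 2\<close>. Here a unit hemisphere covering property of hyperbolic space suffices.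
  For an imaginary quadratic field with ring of integers \<open>\<int> + \<int> u\<close> it is checked by averaging
  over the vertices of the triangle \<open>0, 1, u\<close>: the relevant quantity is less than \<open>1\<close>
  because \<open>M < 1\<close>, and its denominator divides \<open>nrd a\<close>. For a quaternion algebra it
  follows from \<open>M \<le> 2/3\<close>. The latter is obtained without classifying maximal orders:
  \<open>M < 1\<close> forces a unit other than \<open>1\<close> and \<open>- 1\<close>, which makes the order a free
  module of rank two over \<open>\<int>[u]\<close>, and the deep holes of this module leave, apart from
  the algebra \<open>(-2, -5)\<close>, only orders with \<open>M \<le> 2/3\<close>.
\<close>

section \<open>Algebras with positive involution\<close>

text \<open>The second basis vector is the obstacle: plain reduction bounds \<open>q (b 2)\<close>
  only by \<open>M + 1 / nrd l\<close> times the squared minimum, and this factor may exceed 1. The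
  missing information is \<open>q (b 1) \<le> q (b 2)\<close>. On the line
  \<open>w + z *s b 1\<close> the form is \<open>nrd (\<gamma> + z) * q (b 1) + W\<close>, so
  \<open>\<gamma>\<close> together with the squared height \<open>W / q (b 1)\<close> is a point of
  hyperbolic upper half space, and the inequality puts it on or above every unit hemisphere with
  centre in \<open>\<O>\<close>. The covering property compares the power of this point with respect
  to a unit hemisphere and to a smaller one, of radius \<open>1 / sqrt (nrd a)\<close>; this gives
  \<open>q (b 2) \<le> q v\<close>. The threshold 2/3 is \<open>1 - 1/3\<close>, the slack for
  \<open>nrd a \<ge> 3\<close>. Norm 2 leaves only 1/2 and is treated separately. Over the
  Eisenstein integers an order is described by the norm \<open>\<beta>\<close> of a generator
  orthogonal to them. For \<open>\<beta> \<le> 1\<close> the covering radius is small enough, for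
  \<open>\<beta> \<ge> 8/3\<close> deep holes contradict \<open>M < 1\<close>. The algebra
  \<open>(-2, -5)\<close> has \<open>\<beta> = 5/3\<close>, where the upper bound for
  \<open>M\<close> is 8/9 and neither argument decides.\<close>

lemma of_real_commute: "x * of_real r = of_real r * (x::'a::real_algebra_1)"
  by (simp add: of_real_def)

lemma star_of_real [simp]: "star (of_real r :: 'a::star_div_algebra) = of_real r"
proof -
  have "star (1::'a) = 1"
    by (metis mult.left_neutral mult.right_neutral star_mult star_star)
  then show ?thesis by (simp add: of_real_def star_scaleR)
qed

lemma star_simps [simp]:
  fixes x :: "'a::star_div_algebra"
  shows "star (star x) = x" "star 0 = (0::'a)" "star 1 = (1::'a)" "star (- x) = - star x"
  using star_of_real[of 0, where 'a='a] star_of_real[of 1, where 'a='a]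
    star_scaleR[of "-1" x] by (simp_all add: star_star)

lemma star_conv: "star x = of_real (2 * re x) - (x::'a::star_div_algebra)"
  using add_star[of x] by (simp add: of_real_def algebra_simps)

lemma re_eqI: "x + star x = of_real (2 * r) \<Longrightarrow> re (x::'a::star_div_algebra) = r"
  using add_star[of x] by (simp add: of_real_def)

lemma re_add: "re (x + y) = re x + re (y::'a::star_div_algebra)"
  by (rule re_eqI) (simp add: star_conv[of x] star_conv[of y] star_add algebra_simps)

lemma re_of_real [simp]: "re (of_real r :: 'a::star_div_algebra) = r"
  by (rule re_eqI) (simp add: algebra_simps flip: of_real_add)

lemma re_of_real_mult [simp]: "re (of_real r * x) = r * re (x::'a::star_div_algebra)"
proof (rule re_eqI)
  have "of_real r * x + star (of_real r * x) = of_real r * (x + star x)"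
    by (simp add: star_mult of_real_commute[of "star x"] distrib_left)
  also have "\<dots> = of_real r * of_real (2 * re x)"
    by (simp add: star_conv[of x])
  finally show "of_real r * x + star (of_real r * x) = of_real (2 * (r * re x))"
    by (simp add: ac_simps)
qed

lemma re_star [simp]: "re (star x) = re (x::'a::star_div_algebra)"
proof (rule re_eqI)
  have "star x + x = of_real (2 * re x)" by (simp add: star_conv[of x])
  then show "star x + star (star x) = of_real (2 * re x)" by simp
qed

lemma re_simps [simp]:
  fixes x :: "'a::star_div_algebra"
  shows "re (0::'a) = 0" "re (1::'a) = 1" "re (- x) = - re x"
  using re_of_real[of 0, where 'a='a] re_of_real[of 1, where 'a='a] re_of_real_mult[of "-1" x]
  by (simp_all del: re_of_real re_of_real_mult)

lemma re_diff: "re (x - y) = re x - re (y::'a::star_div_algebra)"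
  using re_add[of x "-y"] by simp

text \<open>\<open>star x\<close> is a real number minus \<open>x\<close>, hence commutes with
  \<open>x\<close>.\<close>

lemma star_mult_self: "star x * x = of_real (nrd (x::'a::star_div_algebra))"
proof -
  have "star x * x = of_real (2 * re x) * x - x * x"
    by (simp only: star_conv[of x] left_diff_distrib)
  also have "\<dots> = x * star x"
    by (simp only: star_conv[of x] right_diff_distrib of_real_commute[of x])
  finally show ?thesis by (simp add: of_real_nrd)
qed

lemma nrd_mult: "nrd (x * y) = nrd x * nrd (y::'a::star_div_algebra)"
proof -
  have "of_real (nrd (x * y)) = x * (y * star y) * star x"
    by (simp add: of_real_nrd star_mult mult.assoc)
  also have "\<dots> = of_real (nrd y) * (x * star x)"
    by (simp only: of_real_nrd[symmetric] of_real_commute[of x] mult.assoc)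
  also have "\<dots> = of_real (nrd x * nrd y)"
    by (simp add: of_real_nrd[symmetric] mult.commute[of "nrd x"])
  finally show ?thesis by (simp only: of_real_eq_iff)
qed

lemma nrd_simps [simp]:
  fixes x :: "'a::star_div_algebra"
  shows "nrd (0::'a) = 0" "nrd (1::'a) = 1" "nrd (- x) = nrd x" "nrd (of_real r :: 'a) = r\<^sup>2"
  by (simp_all add: nrd_def power2_eq_square)

lemma nrd_pos: "x \<noteq> 0 \<Longrightarrow> nrd (x::'a::star_div_algebra) > 0"
  by (simp add: nrd_def re_mult_star_pos)

lemma nrd_nonneg [simp]: "nrd (x::'a::star_div_algebra) \<ge> 0"
  by (cases "x = 0") (auto dest: nrd_pos)

lemma nrd_eq_0_iff [simp]: "nrd (x::'a::star_div_algebra) = 0 \<longleftrightarrow> x = 0"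
  using nrd_pos[of x] by (cases "x = 0") auto

lemma nrd_pos_iff [simp]: "nrd (x::'a::star_div_algebra) > 0 \<longleftrightarrow> x \<noteq> 0"
  using nrd_pos[of x] by (cases "x = 0") auto

lemma nrd_star [simp]: "nrd (star x) = nrd (x::'a::star_div_algebra)"
  by (simp add: nrd_def star_mult_self)

lemma nrd_of_real_mult: "nrd (of_real r * x) = r\<^sup>2 * nrd (x::'a::star_div_algebra)"
  by (simp add: nrd_mult)

lemma nrd_power: "nrd (x ^ n) = nrd (x::'a::star_div_algebra) ^ n"
  by (induction n) (simp_all add: nrd_mult)

lemma nrd_inverse: "nrd (inverse x) = inverse (nrd (x::'a::star_div_algebra))"
proof (cases "x = 0")
  case False
  then have "nrd (inverse x) * nrd x = 1" by (simp flip: nrd_mult)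
  then show ?thesis by (metis inverse_unique mult.commute)
qed simp

lemma inverse_conv_star: "inverse x = of_real (inverse (nrd x)) * star (x::'a::star_div_algebra)"
proof (cases "x = 0")
  case False
  have "x * (of_real (inverse (nrd x)) * star x) = of_real (inverse (nrd x)) * (x * star x)"
    by (simp only: of_real_commute[of x] mult.assoc[symmetric])
  also have "\<dots> = of_real (inverse (nrd x) * nrd x)"
    by (simp only: of_real_nrd of_real_mult)
  also have "\<dots> = 1" using False by simp
  finally show ?thesis by (rule inverse_unique)
qed simp

lemma nrd_add: "nrd (x + y) = nrd x + nrd y + 2 * re (x * star (y::'a::star_div_algebra))"
proof -
  have "re (y * star x) = re (x * star y)"
    using re_star[of "x * star y"] by (simp add: star_mult)
  then show ?thesis by (simp add: nrd_def star_add distrib_left distrib_right re_add)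
qed

lemma nrd_diff: "nrd (x - y) = nrd x + nrd y - 2 * re (x * star (y::'a::star_div_algebra))"
  using nrd_add[of x "- y"] by simp

lemma nrd_diff_commute: "nrd (x - y) = nrd (y - (x::'a::star_div_algebra))"
  using nrd_simps(3)[of "x - y"] by simp

lemma nrd_parallelogram: "nrd (x + y) + nrd (x - y) = 2 * nrd x + 2 * nrd (y::'a::star_div_algebra)"
  by (simp add: nrd_add nrd_diff)

lemma nrd_add_le: "nrd (x + y) \<le> 2 * nrd x + 2 * nrd (y::'a::star_div_algebra)"
  using nrd_parallelogram[of x y] nrd_nonneg[of "x - y"] by linarith

text \<open>Cross terms of \<open>nrd (x + y)\<close> and \<open>nrd (star x + star y)\<close>,
  which agree. The trace property of \<open>re\<close> follows.\<close>

lemma re_mult_star_eq: "re (star x * y) = re (x * star (y::'a::star_div_algebra))"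
  using nrd_add[of x y] nrd_add[of "star x" "star y"] nrd_star[of "x + y"]
  by (simp add: star_add)

lemma re_mult_commute: "re (x * y) = re (y * (x::'a::star_div_algebra))"
proof -
  have "re (x * y) = re (star x * star y)" using re_mult_star_eq[of x "star y"] by simp
  then show ?thesis by (metis re_star star_mult)
qed

lemma inverse_mult_star: "nrd x = 1 \<Longrightarrow> inverse x = star (x::'a::star_div_algebra)"
  by (simp add: inverse_conv_star)

section \<open>Orders and the Euclidean minimum\<close>

lemma ex_arg_min_Ints:
  fixes f :: "'b \<Rightarrow> real"
  assumes "P x0" and "\<And>x. P x \<Longrightarrow> f x \<in> \<int> \<and> f x \<ge> 0"
  obtains x where "P x" and "\<And>y. P y \<Longrightarrow> f x \<le> f y"
proof -
  obtain x where x: "P x" "\<And>y. P y \<Longrightarrow> nat \<lfloor>f x\<rfloor> \<le> nat \<lfloor>f y\<rfloor>"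
    using ex_has_least_nat[of P x0 "\<lambda>x. nat \<lfloor>f x\<rfloor>"] assms(1) by blast
  have "f x \<le> f y" if "P y" for y
  proof -
    obtain m n :: int where "f x = of_int m" "f y = of_int n"
      using conjunct1[OF assms(2)[OF x(1)]] conjunct1[OF assms(2)[OF \<open>P y\<close>]] by (metis Ints_cases)
    moreover have "0 \<le> f y" using assms(2)[OF that] by blast
    ultimately show ?thesis using x(2)[OF that] by simp
  qed
  with x(1) that show ?thesis by blast
qed

lemma Ints_nonneg_less_one: "x \<in> \<int> \<Longrightarrow> 0 \<le> x \<Longrightarrow> x < 1 \<Longrightarrow> x = (0::real)"
  by (auto elim!: Ints_cases)

lemma Ints_less_imp_le: "x \<in> \<int> \<Longrightarrow> y \<in> \<int> \<Longrightarrow> x < y \<Longrightarrow> x \<le> y - (1::real)"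
  by (auto elim!: Ints_cases)

lemma common_denominator:
  assumes "finite A" and "A \<subseteq> (\<rat> :: real set)"
  obtains N :: nat where "N > 0" and "\<And>r. r \<in> A \<Longrightarrow> real N * r \<in> \<int>"
proof -
  have "\<exists>N::nat. N > 0 \<and> (\<forall>r\<in>A. real N * r \<in> \<int>)"
    using assms
  proof (induction A rule: finite_induct)
    case (insert a A)
    then obtain N :: nat where N: "N > 0" "\<forall>r\<in>A. real N * r \<in> \<int>" by auto
    from insert.prems have "a \<in> \<rat>" by simp
    then obtain i :: int and n :: int where n: "n > 0" "a = of_int i / of_int n"
      by (metis Rats_cases' )
    have "real (N * nat n) * r \<in> \<int>" if "r \<in> insert a A" for r
    proof (cases "r = a")
      case True
      have "real (N * nat n) * a = of_int (int N * i)" using n by simp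
      with True show ?thesis by (metis Ints_of_int)
    next
      case False
      with that N have "real N * r \<in> \<int>" by blast
      then have "of_int n * (real N * r) \<in> \<int>" by (rule Ints_mult[OF Ints_of_int])
      then show ?thesis using n by (simp add: ac_simps)
    qed
    moreover have "N * nat n > 0" using N n by simp
    ultimately show ?case by blast
  qed (auto intro: exI[of _ 1])
  with that show ?thesis by blast
qed

text \<open>A reduced denominator \<open>b\<close> of \<open>r\<close> would satisfy
  \<open>b ^ n dvd N\<close> for every \<open>n\<close>. Reduced norms of order elements meet the
  hypothesis because their powers are again such norms; this takes the place of integral
  closure.\<close>

lemma Ints_if_powers_bounded_denominator:
  fixes r :: real
  assumes "r \<in> \<rat>" "r \<ge> 0" and "N > 0" and powers: "\<And>n. real N * r ^ n \<in> \<int>"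
  shows "r \<in> \<int>"
proof -
  obtain p b :: nat where b: "b \<noteq> 0" "\<bar>r\<bar> = real p / real b" "coprime p b"
    using Rats_abs_nat_div_natE[OF assms(1)] by metis
  then have r: "r = real p / real b" using assms by simp
  have dvd: "b ^ n dvd N" for n
  proof -
    obtain z where z: "real N * r ^ n = of_int z" using powers[of n] by (auto elim: Ints_cases)
    then have "real N * real p ^ n = of_int z * real b ^ n"
      using b(1) by (simp add: r field_simps)
    then have "of_int (int N * int p ^ n) = (of_int (z * int b ^ n) :: real)" by simp
    then have "int N * int p ^ n = z * int b ^ n" by (simp only: of_int_eq_iff)
    then have "int b ^ n dvd int N * int p ^ n" by simp
    then have "b ^ n dvd N * p ^ n" by (metis int_dvd_int_iff of_nat_mult of_nat_power)
    moreover have "coprime (b ^ n) (p ^ n)" using b(3) by (simp add: coprime_commute)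
    ultimately show ?thesis by (simp add: coprime_dvd_mult_left_iff)
  qed
  have "b = 1"
  proof (rule ccontr)
    assume "b \<noteq> 1"
    with b have "b \<ge> 2" by simp
    then have "N < b ^ N" by (meson less_exp order_less_le_trans power_mono zero_le_numeral)
    with dvd[of N] \<open>N > 0\<close> show False by (meson dvd_imp_le leD)
  qed
  with r show ?thesis by simp
qed

lemma star_sum: "star (sum f A) = (\<Sum>x\<in>A. star (f x :: 'a::star_div_algebra))"
  by (induction A rule: infinite_finite_induct) (simp_all add: star_add)

lemma re_sum: "re (sum f A) = (\<Sum>x\<in>A. re (f x :: 'a::star_div_algebra))"
  by (induction A rule: infinite_finite_induct) (simp_all add: re_add)

section \<open>The common setting of both kinds of fields; integrality of norm and trace\<close>

locale rational_order =
  fixes K \<O> :: "'a::star_div_algebra set"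
  assumes order: "is_order K \<O>"
    and K_add: "x \<in> K \<Longrightarrow> y \<in> K \<Longrightarrow> x + y \<in> K"
    and K_scale: "r \<in> \<rat> \<Longrightarrow> x \<in> K \<Longrightarrow> of_real r * x \<in> K"
    and nrd_K: "x \<in> K \<Longrightarrow> nrd x \<in> \<rat>"
begin

lemma
  shows O_K: "x \<in> \<O> \<Longrightarrow> x \<in> K" and O_1 [simp]: "1 \<in> \<O>"
    and O_diff: "x \<in> \<O> \<Longrightarrow> y \<in> \<O> \<Longrightarrow> x - y \<in> \<O>"
    and O_mult: "x \<in> \<O> \<Longrightarrow> y \<in> \<O> \<Longrightarrow> x * y \<in> \<O>"
  using order unfolding is_order_def by blast+

lemma O_0 [simp]: "0 \<in> \<O>"
  using O_diff[OF O_1 O_1] by simp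

lemma O_minus: "x \<in> \<O> \<Longrightarrow> - x \<in> \<O>"
  using O_diff[of 0 x] by simp

lemma O_add: "x \<in> \<O> \<Longrightarrow> y \<in> \<O> \<Longrightarrow> x + y \<in> \<O>"
  using O_diff[of x "- y"] O_minus[of y] by simp

lemma O_sum: "(\<And>i. i \<in> A \<Longrightarrow> f i \<in> \<O>) \<Longrightarrow> sum f A \<in> \<O>"
  by (induction A rule: infinite_finite_induct) (simp_all add: O_add)

lemma O_of_nat [simp]: "of_nat n \<in> \<O>"
  by (induction n) (simp_all add: O_add)

lemma O_of_int [simp]: "of_int n \<in> \<O>"
  by (cases n) (simp_all add: O_add O_minus O_diff)

lemma O_of_real: "r \<in> \<int> \<Longrightarrow> of_real r \<in> \<O>"
  by (auto elim!: Ints_cases)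

lemma K_of_real: "r \<in> \<rat> \<Longrightarrow> of_real r \<in> K"
  using K_scale[of r 1] O_K[of 1] by simp

lemma K_0 [simp]: "0 \<in> K" and K_1 [simp]: "1 \<in> K"
  by (simp_all add: O_K)

lemma K_minus: "x \<in> K \<Longrightarrow> - x \<in> K"
  using K_scale[of "-1" x] by simp

lemma K_diff: "x \<in> K \<Longrightarrow> y \<in> K \<Longrightarrow> x - y \<in> K"
  using K_add[of x "- y"] K_minus[of y] by simp

lemma K_sum: "(\<And>i. i \<in> A \<Longrightarrow> f i \<in> K) \<Longrightarrow> sum f A \<in> K"
  by (induction A rule: infinite_finite_induct) (simp_all add: K_add)

lemma denominator:
  assumes "x \<in> K"
  obtains n :: nat where "n > 0" "of_nat n * x \<in> \<O>"
  using assms order unfolding is_order_def by blast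

text \<open>Inherited from \<open>\<O>\<close> by clearing denominators, integers being
  central.\<close>

lemma K_mult:
  assumes "x \<in> K" "y \<in> K"
  shows "x * y \<in> K"
proof -
  obtain m n :: nat where mn: "m > 0" "of_nat m * x \<in> \<O>" "n > 0" "of_nat n * y \<in> \<O>"
    using denominator[OF assms(1)] denominator[OF assms(2)] by metis
  have "(of_nat m * x) * (of_nat n * y) = of_nat m * (x * of_real (real n)) * y"
    by (simp add: mult.assoc)
  also have "\<dots> = of_real (real (m * n)) * (x * y)"
    by (simp only: of_real_commute[of x] mult.assoc) (simp add: mult.assoc)
  finally have "of_real (real (m * n)) * (x * y) \<in> K" using O_K[OF O_mult[OF mn(2) mn(4)]] by simp
  then have "of_real (inverse (real (m * n))) * (of_real (real (m * n)) * (x * y)) \<in> K"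
    by (rule K_scale[rotated]) simp
  then have "of_real (inverse (real (m * n)) * real (m * n)) * (x * y) \<in> K"
    by (simp only: of_real_mult mult.assoc)
  moreover have "inverse (real (m * n)) * real (m * n) = 1"
    using mn by (intro left_inverse) simp
  ultimately show ?thesis by (simp only: of_real_1 mult_1_left)
qed

lemma re_K: "x \<in> K \<Longrightarrow> re x \<in> \<rat>"
proof -
  assume "x \<in> K"
  then have "nrd (x + 1) - nrd x - 1 \<in> \<rat>" by (intro Rats_diff nrd_K K_add) auto
  then have "(nrd (x + 1) - nrd x - 1) / 2 \<in> \<rat>" by (intro Rats_divide) auto
  then show ?thesis by (simp add: nrd_add)
qed

lemma K_star: "x \<in> K \<Longrightarrow> star x \<in> K"
  unfolding star_conv by (intro K_diff K_of_real Rats_mult re_K) auto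

lemma K_inverse: "x \<in> K \<Longrightarrow> inverse x \<in> K"
  unfolding inverse_conv_star by (intro K_scale K_star Rats_inverse nrd_K)

text \<open>On integral combinations of finitely many generators \<open>nrd\<close> is a quadratic
  form whose coefficients, the entries of the Gram matrix, are rational and finite in
  number.\<close>

lemma nrd_bounded_denominator:
  obtains N :: nat where "N > 0" and "\<And>x. x \<in> \<O> \<Longrightarrow> real N * nrd x \<in> \<int>"
proof -
  obtain S where S: "finite S" "\<O> = {\<Sum>s\<in>S. of_int (c s) * s | c. True}"
    using order unfolding is_order_def by blast
  have SO: "s \<in> K" if "s \<in> S" for s
  proof -
    have "(\<Sum>t\<in>S. of_int (if t = s then 1 else 0) * t) = s"
      using S(1) that by (subst sum.mono_neutral_cong_right[where S = "{s}" and h = "\<lambda>t. t"]) auto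
    then have "s \<in> \<O>" unfolding S(2) by (intro CollectI exI[of _ "\<lambda>t. if t = s then 1 else 0"]) simp
    then show ?thesis by (rule O_K)
  qed
  let ?A = "(\<lambda>(s, t). re (s * star t)) ` (S \<times> S)"
  have "?A \<subseteq> \<rat>" using SO by (auto intro!: re_K K_mult K_star)
  then obtain N :: nat where N: "N > 0" "\<And>r. r \<in> ?A \<Longrightarrow> real N * r \<in> \<int>"
    using common_denominator[of ?A] S(1) by blast
  have "real N * nrd x \<in> \<int>" if xO: "x \<in> \<O>" for x
  proof -
    obtain c where c: "x = (\<Sum>s\<in>S. of_int (c s) * s)" using xO unfolding S(2) by blast
    have "re (of_int i * s * (star s' * of_int j)) = of_int i * of_int j * re (s * star s')"
      for i j :: int and s s' :: 'a
    proof -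
      have "of_int i * s * (star s' * of_int j) = of_real (of_int i * of_int j) * (s * star s')"
        using of_real_commute[of "star s'" "of_int j"] of_real_commute[of s "of_int j"]
        by (simp add: mult.assoc) (metis mult.assoc)
      then show ?thesis by (simp only: re_of_real_mult)
    qed
    moreover have "star (of_int i :: 'a) = of_int i" for i
      using star_of_real[of "of_int i"] by simp
    ultimately have "nrd x = (\<Sum>s\<in>S. \<Sum>t\<in>S. of_int (c s) * of_int (c t) * re (s * star t))"
      unfolding nrd_def c star_sum sum_product re_sum by (simp add: star_mult)
    then have "real N * nrd x = (\<Sum>s\<in>S. \<Sum>t\<in>S. of_int (c s) * of_int (c t) * (real N * re (s * star t)))"
      by (simp only: sum_distrib_left mult.left_commute[of "real N"])
    also have "\<dots> \<in> \<int>"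
      using N(2) by (intro Ints_sum Ints_mult[OF Ints_mult[OF Ints_of_int Ints_of_int]]) blast
    finally show ?thesis .
  qed
  with N(1) that show ?thesis by blast
qed

lemma O_power: "x \<in> \<O> \<Longrightarrow> x ^ n \<in> \<O>"
  by (induction n) (simp_all add: O_mult)

lemma nrd_O: "x \<in> \<O> \<Longrightarrow> nrd x \<in> \<int>"
proof -
  assume x: "x \<in> \<O>"
  obtain N :: nat where N: "N > 0" "\<And>x. x \<in> \<O> \<Longrightarrow> real N * nrd x \<in> \<int>"
    using nrd_bounded_denominator by blast
  show ?thesis
    by (rule Ints_if_powers_bounded_denominator[of _ N])
      (use N(1) N(2)[OF O_power[OF x]] x in \<open>auto simp: nrd_power intro: nrd_K O_K\<close>)
qed

lemma nrd_O_ge_1: "x \<in> \<O> \<Longrightarrow> x \<noteq> 0 \<Longrightarrow> nrd x \<ge> 1"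
  using Ints_nonneg_less_one[OF nrd_O, of x] by force

text \<open>The trace is the polarisation of \<open>nrd\<close> at \<open>1\<close>.\<close>

lemma trace_O: "x \<in> \<O> \<Longrightarrow> 2 * re x \<in> \<int>"
proof -
  assume "x \<in> \<O>"
  then have "nrd (x + 1) - nrd x - 1 \<in> \<int>" by (intro Ints_diff nrd_O O_add) auto
  then show ?thesis by (simp add: nrd_add)
qed

lemma O_star: "x \<in> \<O> \<Longrightarrow> star x \<in> \<O>"
  unfolding star_conv by (intro O_diff O_of_real trace_O)

lemma order_units_iff: "x \<in> order_units \<O> \<longleftrightarrow> x \<in> \<O> \<and> nrd x = 1"
proof
  assume "x \<in> order_units \<O>"
  then obtain y where y: "x \<in> \<O>" "y \<in> \<O>" "x * y = 1" by (auto simp: order_units_def)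
  then have "nrd x * nrd y = 1" by (simp flip: nrd_mult)
  moreover from y have "nrd x \<ge> 1" "nrd y \<ge> 1" by (auto intro!: nrd_O_ge_1)
  ultimately have "nrd x = 1"
    by (smt (verit) mult_le_cancel_left1 )
  with y show "x \<in> \<O> \<and> nrd x = 1" by simp
next
  assume x: "x \<in> \<O> \<and> nrd x = 1"
  then have "x * star x = 1" "star x * x = 1" by (simp_all add: star_mult_self flip: of_real_nrd)
  with x show "x \<in> order_units \<O>" using O_star by (auto simp: order_units_def)
qed

text \<open>After scaling by a denominator of \<open>x\<close> all competing norms are integers, so
  the infimum is attained. The argument rests on \<open>x\<close> lying in \<open>K\<close> itself,
  not merely in its real span.\<close>

lemma nearest_in_order:
  assumes "x \<in> K"
  obtains y where "y \<in> \<O>" "\<And>z. z \<in> \<O> \<Longrightarrow> nrd (x - y) \<le> nrd (x - z)"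
proof -
  obtain n :: nat where n: "n > 0" "of_nat n * x \<in> \<O>" using denominator[OF assms] .
  have eq: "nrd (of_nat n * (x - y)) = (real n)\<^sup>2 * nrd (x - y)" for y
    using nrd_of_real_mult[of "real n" "x - y"] by simp
  have "nrd (of_nat n * (x - y)) \<in> \<int> \<and> nrd (of_nat n * (x - y)) \<ge> 0" if "y \<in> \<O>" for y
    using that n by (auto simp: right_diff_distrib intro!: nrd_O O_diff O_mult)
  then obtain y where "y \<in> \<O>" "\<And>z. z \<in> \<O> \<Longrightarrow> nrd (of_nat n * (x - y)) \<le> nrd (of_nat n * (x - z))"
    using ex_arg_min_Ints[of "\<lambda>y. y \<in> \<O>" 0 "\<lambda>y. nrd (of_nat n * (x - y))"] by auto
  with that n(1) show ?thesis unfolding eq by simp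
qed

text \<open>A real \<open>SUP\<close> is meaningful only over a bounded set. Rounding the
  coordinates with respect to generators of \<open>\<O>\<close> leaves a point of a cube, on which
  \<open>nrd\<close> is bounded.\<close>

lemma bdd_above_covering: "bdd_above ((\<lambda>x. INF y\<in>\<O>. nrd (x - y)) ` span K)"
proof -
  obtain S where S: "finite S" "\<O> = {\<Sum>s\<in>S. of_int (c s) * s | c. True}"
    using order unfolding is_order_def by blast
  have OS: "\<O> \<subseteq> span S"
  proof
    fix x assume "x \<in> \<O>"
    then obtain c where "x = (\<Sum>s\<in>S. of_int (c s) * s)" unfolding S(2) by blast
    also have "\<dots> = (\<Sum>s\<in>S. of_int (c s) *\<^sub>R s)" by (simp add: scaleR_conv_of_real)
    also have "\<dots> \<in> span S" by (intro span_sum span_scale span_base)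
    finally show "x \<in> span S" .
  qed
  have "K \<subseteq> span S"
  proof
    fix x assume "x \<in> K"
    then obtain n :: nat where n: "n > 0" "of_nat n * x \<in> \<O>" using denominator by blast
    then have "real n *\<^sub>R x \<in> span S" using OS by (auto simp: scaleR_conv_of_real)
    then have "inverse (real n) *\<^sub>R real n *\<^sub>R x \<in> span S" by (rule span_scale)
    with n(1) show "x \<in> span S" by simp
  qed
  then have KS: "span K \<subseteq> span S" by (simp add: span_minimal subspace_span)
  \<comment> \<open>One generator at a time, by
    \<open>nrd (x + y) \<le> 2 * nrd x + 2 * nrd y\<close>; the generators may be linearly
    dependent.\<close>
  have "\<exists>C. \<forall>f. (\<forall>s\<in>T. \<bar>f s\<bar> \<le> 1) \<longrightarrow> nrd (\<Sum>s\<in>T. f s *\<^sub>R s) \<le> C" if "finite T" for T :: "'a set"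
    using that
  proof (induction T rule: finite_induct)
    case (insert t T)
    then obtain C where C: "\<And>f. (\<forall>s\<in>T. \<bar>f s\<bar> \<le> 1) \<Longrightarrow> nrd (\<Sum>s\<in>T. f s *\<^sub>R s) \<le> C" by blast
    have "nrd (\<Sum>s\<in>insert t T. f s *\<^sub>R s) \<le> 2 * nrd t + 2 * C"
      if f: "\<forall>s\<in>insert t T. \<bar>f s\<bar> \<le> 1" for f
    proof -
      have "(f t)\<^sup>2 \<le> 1" using f by (simp add: abs_square_le_1)
      then have "nrd (f t *\<^sub>R t) \<le> nrd t"
        by (simp add: scaleR_conv_of_real nrd_mult mult_left_le_one_le)
      moreover have "nrd (\<Sum>s\<in>T. f s *\<^sub>R s) \<le> C" using f by (intro C) auto
      ultimately show ?thesis
        using insert.hyps nrd_add_le[of "f t *\<^sub>R t" "\<Sum>s\<in>T. f s *\<^sub>R s"] by simp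
    qed
    then show ?case by blast
  qed (auto intro: exI[of _ 0])
  from this[OF S(1)] obtain C where C: "\<And>f. (\<forall>s\<in>S. \<bar>f s\<bar> \<le> 1) \<Longrightarrow> nrd (\<Sum>s\<in>S. f s *\<^sub>R s) \<le> C"
    by blast
  have "(INF y\<in>\<O>. nrd (x - y)) \<le> C" if "x \<in> span K" for x
  proof -
    from that KS obtain r where r: "x = (\<Sum>s\<in>S. r s *\<^sub>R s)" using span_finite[OF S(1)] by auto
    let ?y = "\<Sum>s\<in>S. of_int \<lfloor>r s\<rfloor> * s"
    have "(INF y\<in>\<O>. nrd (x - y)) \<le> nrd (x - ?y)"
      by (rule cINF_lower) (auto simp: S(2) intro!: bdd_belowI[where m = 0])
    also have "x - ?y = (\<Sum>s\<in>S. frac (r s) *\<^sub>R s)"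
      by (simp add: r frac_def sum_subtractf scaleR_diff_left) (simp add: scaleR_conv_of_real)
    also have "nrd \<dots> \<le> C"
      by (rule C) (auto simp: frac_ge_0 less_imp_le[OF frac_lt_1])
    finally show ?thesis .
  qed
  then show ?thesis by (intro bdd_aboveI[where M = C]) auto
qed

lemma euclidean_minimum_ge:
  assumes "x \<in> span K" and "\<And>y. y \<in> \<O> \<Longrightarrow> C \<le> nrd (x - y)"
  shows "C \<le> euclidean_minimum K \<O>"
proof -
  have "C \<le> (INF y\<in>\<O>. nrd (x - y))" using assms(2) O_0 by (intro cINF_greatest) blast+
  also have "\<dots> \<le> euclidean_minimum K \<O>" unfolding euclidean_minimum_def
    by (rule cSUP_upper[OF assms(1) bdd_above_covering])
  finally show ?thesis .
qed

lemma euclidean_minimum_le: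
  assumes "\<And>x. x \<in> span K \<Longrightarrow> \<exists>y\<in>\<O>. nrd (x - y) \<le> C"
  shows "euclidean_minimum K \<O> \<le> C"
  unfolding euclidean_minimum_def
proof (rule cSUP_least)
  fix x assume "x \<in> span K"
  with assms obtain y where "y \<in> \<O>" "nrd (x - y) \<le> C" by blast
  moreover from \<open>y \<in> \<O>\<close> have "(INF y\<in>\<O>. nrd (x - y)) \<le> nrd (x - y)"
    by (intro cINF_lower bdd_belowI[where m = 0]) auto
  ultimately show "(INF y\<in>\<O>. nrd (x - y)) \<le> C" by simp
qed (use span_zero in blast)

lemma euclidean_approx:
  assumes "x \<in> K"
  obtains y where "y \<in> \<O>" "nrd (x - y) \<le> euclidean_minimum K \<O>"
proof -
  obtain y where y: "y \<in> \<O>" "\<And>z. z \<in> \<O> \<Longrightarrow> nrd (x - y) \<le> nrd (x - z)"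
    using nearest_in_order[OF assms] by blast
  have "nrd (x - y) \<le> euclidean_minimum K \<O>"
    by (rule euclidean_minimum_ge[OF span_base[OF assms] y(2)])
  with y(1) that show ?thesis by blast
qed

end

section \<open>Reduced lattice bases\<close>

lemma q_nonneg [simp]: "q v \<ge> 0"
  by (simp add: q_def sum_nonneg)

lemma q_eq_0_iff [simp]: "q v = 0 \<longleftrightarrow> v = 0"
  by (simp add: q_def sum_nonneg_eq_0_iff vec_eq_iff)

lemma q_smult: "q (a *s v) = nrd a * q v"
  by (simp add: q_def nrd_mult sum_distrib_left)

lemma q_add_smult:
  fixes x b :: "'a::star_div_algebra ^ 'D"
  shows "q (x + z *s b) = q x + nrd z * q b + 2 * re ((\<Sum>i\<in>UNIV. x $ i * star (b $ i)) * star z)"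
proof -
  have "nrd (x $ i + z * b $ i) = nrd (x $ i) + nrd z * nrd (b $ i) + 2 * re (x $ i * star (b $ i) * star z)" for i
    by (simp add: nrd_add nrd_mult star_mult mult.assoc)
  then show ?thesis
    by (simp add: q_def sum.distrib sum_distrib_left sum_distrib_right re_sum)
qed

lemma smult_sum_right: "a *s (\<Sum>j\<in>J. f j) = (\<Sum>j\<in>J. a *s (f j :: 'a::semiring_1 ^ 'n))"
  by (induction J rule: infinite_finite_induct) (simp_all add: vector_add_ldistrib)

lemma smult_diff_left: "(a - b) *s v = a *s v - b *s (v :: 'a::ring_1 ^ 'n)"
  by (simp add: vec_eq_iff left_diff_distrib)

context rational_order
begin

abbreviation K_vector :: "'a ^ 'D \<Rightarrow> bool" where
  "K_vector v \<equiv> \<forall>j. v $ j \<in> K"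

lemma K_vector_add: "K_vector v \<Longrightarrow> K_vector w \<Longrightarrow> K_vector (v + w)"
  by (simp add: K_add)

lemma K_vector_smult: "a \<in> K \<Longrightarrow> K_vector v \<Longrightarrow> K_vector (a *s v)"
  by (simp add: K_mult)

lemma K_vector_sum: "(\<And>i. i \<in> A \<Longrightarrow> K_vector (f i)) \<Longrightarrow> K_vector (sum f A)"
  by (simp add: K_sum)

text \<open>Completing the square: \<open>W\<close> is the value of \<open>q\<close> on the
  component of \<open>x\<close> orthogonal to \<open>b\<close>.\<close>

lemma q_line:
  fixes x b :: "'a ^ 'D"
  assumes "K_vector x" "K_vector b"
  obtains \<gamma> W where "\<gamma> \<in> K" "W \<ge> 0" "\<And>z. q (x + z *s b) = nrd (\<gamma> + z) * q b + W"
proof (cases "b = 0")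
  case True
  have "q (x + z *s b) = nrd (0 + z) * q b + q x" for z using True by simp
  then show thesis using that[of 0 "q x"] by simp
next
  case False
  define h where "h = (\<Sum>i\<in>UNIV. x $ i * star (b $ i))"
  have q: "q b > 0" using False by (metis q_eq_0_iff q_nonneg order_le_less)
  \<comment> \<open>The coefficient of the orthogonal projection of \<open>x\<close> to
    \<open>b\<close>; it stays in \<open>K\<close> because \<open>q b\<close> is rational.\<close>
  define \<gamma> where "\<gamma> = of_real (inverse (q b)) * h"
  have "q b \<in> \<rat>" using assms unfolding q_def by (intro Rats_sum nrd_K) auto
  then have "\<gamma> \<in> K" unfolding \<gamma>_def h_def
    using assms by (intro K_scale K_sum K_mult K_star Rats_inverse) auto
  have eq: "q (x + z *s b) = nrd (\<gamma> + z) * q b + (q x - nrd \<gamma> * q b)" for z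
  proof -
    have "re (h * star z) = re (\<gamma> * star z) * q b"
    proof -
      have "inverse (q b) * q b = 1" using False by simp
      then have "re (h * star z) = (inverse (q b) * q b) * re (h * star z)" by (simp only: mult_1_left)
      also have "\<dots> = re (\<gamma> * star z) * q b"
        unfolding \<gamma>_def mult.assoc re_of_real_mult by (simp only: ac_simps)
      finally show ?thesis .
    qed
    then show ?thesis unfolding q_add_smult h_def[symmetric]
      by (simp add: nrd_add algebra_simps)
  qed
  have "q x - nrd \<gamma> * q b \<ge> 0" using eq[of "- \<gamma>"] q_nonneg[of "x + - \<gamma> *s b"] by simp
  with eq \<open>\<gamma> \<in> K\<close> that show thesis by blast
qed

text \<open>Only the component along \<open>b\<close> changes. However large \<open>z\<close> is,
  that component can be brought down to at most \<open>M * q b\<close>, while the orthogonal rest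
  never exceeds \<open>q x\<close>.\<close>

lemma reduce_one:
  fixes x b :: "'a ^ 'D"
  assumes "K_vector x" "K_vector b" "z \<in> K"
  obtains y where "y \<in> \<O>" "q (x + (z + y) *s b) \<le> q x + euclidean_minimum K \<O> * q b"
proof -
  obtain \<gamma> W where \<gamma>: "\<gamma> \<in> K" "W \<ge> 0" "\<And>z. q (x + z *s b) = nrd (\<gamma> + z) * q b + W"
    using q_line[OF assms(1,2)] by blast
  obtain y where y: "y \<in> \<O>" "nrd (\<gamma> + z - y) \<le> euclidean_minimum K \<O>"
    using euclidean_approx[OF K_add[OF \<gamma>(1) assms(3)]] by blast
  have "W \<le> q x" using \<gamma>(3)[of 0] by simp
  moreover have "nrd (\<gamma> + z - y) * q b \<le> euclidean_minimum K \<O> * q b"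
    using y by (intro mult_right_mono) auto
  moreover have "q (x + (z + (- y)) *s b) = nrd (\<gamma> + z - y) * q b + W"
    unfolding \<gamma>(3) by (simp add: algebra_simps)
  ultimately have "q (x + (z + (- y)) *s b) \<le> q x + euclidean_minimum K \<O> * q b" by linarith
  then show thesis using that O_minus y(1) by blast
qed

text \<open>The \<open>b j\<close> need not be orthogonal, so a later step may spoil components
  reduced earlier. This is harmless: each step bounds the increase of \<open>q\<close> on the whole
  vector.\<close>

lemma reduce_family:
  fixes x :: "'a ^ 'D"
  assumes "finite J" "K_vector x" "\<And>j. j \<in> J \<Longrightarrow> K_vector (b j)" "\<And>j. j \<in> J \<Longrightarrow> z j \<in> K"
  shows "\<exists>y. (\<forall>j\<in>J. y j \<in> \<O>) \<and>
    q (x + (\<Sum>j\<in>J. (z j + y j) *s b j)) \<le> q x + euclidean_minimum K \<O> * (\<Sum>j\<in>J. q (b j))"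
  using assms
proof (induction J rule: finite_induct)
  case (insert t J)
  then obtain y where y: "\<forall>j\<in>J. y j \<in> \<O>"
    "q (x + (\<Sum>j\<in>J. (z j + y j) *s b j)) \<le> q x + euclidean_minimum K \<O> * (\<Sum>j\<in>J. q (b j))"
    by auto
  let ?x = "x + (\<Sum>j\<in>J. (z j + y j) *s b j)"
  have "K_vector ?x"
    using insert.prems y(1) by (intro K_vector_add K_vector_sum K_vector_smult K_add) (auto intro: O_K)
  then obtain y' where y': "y' \<in> \<O>" "q (?x + (z t + y') *s b t) \<le> q ?x + euclidean_minimum K \<O> * q (b t)"
    using reduce_one[of ?x "b t" "z t"] insert.prems by auto
  have "(\<Sum>j\<in>J. (z j + (y(t := y')) j) *s b j) = (\<Sum>j\<in>J. (z j + y j) *s b j)"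
    using insert.hyps by (intro sum.cong) auto
  then have "x + (\<Sum>j\<in>insert t J. (z j + (y(t := y')) j) *s b j) = ?x + (z t + y') *s b t"
    using insert.hyps by (simp add: algebra_simps)
  then have "q (x + (\<Sum>j\<in>insert t J. (z j + (y(t := y')) j) *s b j))
      \<le> q x + euclidean_minimum K \<O> * (\<Sum>j\<in>insert t J. q (b j))"
    using y'(2) y(2) insert.hyps by (simp add: algebra_simps)
  then show ?case using y(1) y'(1) by (intro exI[of _ "y(t := y')"]) auto
qed simp

section \<open>Linear algebra over \<open>K\<close> with left coefficients\<close>

lemma ex_linear_relation:
  assumes "finite J" "finite I" "card J < card I" "\<And>i j. A i j \<in> K"
  shows "\<exists>c. (\<forall>i\<in>I. c i \<in> K) \<and> (\<exists>i\<in>I. c i \<noteq> 0) \<and> (\<forall>j\<in>J. (\<Sum>i\<in>I. c i * A i j) = 0)"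
  using assms
proof (induction J arbitrary: I A rule: finite_induct)
  case empty
  then have "I \<noteq> {}" by auto
  then show ?case by (intro exI[of _ "\<lambda>_. 1"]) auto
next
  case (insert t J)
  show ?case
  proof (cases "\<forall>i\<in>I. A i t = 0")
    case True
    have "card J < card I" using insert.prems insert.hyps by simp
    with insert.IH[of I A] insert.prems obtain c where
      "\<forall>i\<in>I. c i \<in> K" "\<exists>i\<in>I. c i \<noteq> 0" "\<forall>j\<in>J. (\<Sum>i\<in>I. c i * A i j) = 0" by blast
    with True show ?thesis by (intro exI[of _ c]) auto
  next
    case False
    then obtain p where p: "p \<in> I" "A p t \<noteq> 0" by blast
    \<comment> \<open>Elimination with pivot \<open>p\<close>. Relations have their coefficients on
      the left, so each row is corrected by a left multiple of the pivot row, and the quotient is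
      formed on the right.\<close>
    define f where "f i = A i t * inverse (A p t)" for i
    have fK: "f i \<in> K" for i unfolding f_def by (intro K_mult K_inverse insert.prems)
    have "card J < card (I - {p})" using insert.prems insert.hyps p by simp
    moreover have "A i j - f i * A p j \<in> K" for i j by (intro K_diff K_mult fK insert.prems)
    ultimately obtain c where c: "\<forall>i\<in>I - {p}. c i \<in> K" "\<exists>i\<in>I - {p}. c i \<noteq> 0"
      "\<forall>j\<in>J. (\<Sum>i\<in>I - {p}. c i * (A i j - f i * A p j)) = 0"
      using insert.IH[of "I - {p}" "\<lambda>i j. A i j - f i * A p j"] insert.prems by blast
    define e where "e = c(p := - (\<Sum>i\<in>I - {p}. c i * f i))"
    have e: "(\<Sum>i\<in>I. e i * A i j) = (\<Sum>i\<in>I - {p}. c i * (A i j - f i * A p j))" for j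
    proof -
      have "(\<Sum>i\<in>I. e i * A i j) = e p * A p j + (\<Sum>i\<in>I - {p}. e i * A i j)"
        using p insert.prems by (simp add: sum.remove)
      also have "(\<Sum>i\<in>I - {p}. e i * A i j) = (\<Sum>i\<in>I - {p}. c i * A i j)"
        by (intro sum.cong) (auto simp: e_def)
      also have "e p * A p j = - (\<Sum>i\<in>I - {p}. c i * f i * A p j)"
        by (simp add: e_def sum_distrib_right)
      finally show ?thesis by (simp add: right_diff_distrib sum_subtractf mult.assoc)
    qed
    have "\<forall>i\<in>I. e i \<in> K"
      using c(1) unfolding e_def by (auto intro!: K_minus K_sum K_mult fK)
    moreover have "\<exists>i\<in>I. e i \<noteq> 0" using c(2) by (auto simp: e_def)
    moreover have "(\<Sum>i\<in>I. e i * A i t) = 0"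
      unfolding e by (rule sum.neutral) (simp add: f_def p mult.assoc)
    moreover have "\<forall>j\<in>J. (\<Sum>i\<in>I. e i * A i j) = 0" unfolding e using c(3) .
    ultimately show ?thesis by (intro exI[of _ e]) auto
  qed
qed

text \<open>Written in \<open>k - 1\<close> vectors, \<open>k\<close> coefficient rows satisfy a
  nontrivial left relation. This supplies, among vectors realising the \<open>k\<close>-th minimum,
  one outside the span of the earlier reduced vectors.\<close>

lemma lin_indep_not_all_in_span:
  fixes v b :: "nat \<Rightarrow> 'a ^ 'D"
  assumes "lin_indep K k v" "k \<ge> 1"
  shows "\<exists>i\<in>{1..k}. \<nexists>c. (\<forall>j\<in>{1..<k}. c j \<in> K) \<and> v i = (\<Sum>j\<in>{1..<k}. c j *s b j)"
proof (rule ccontr)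
  assume "\<not> ?thesis"
  then obtain A where A: "\<And>i. i \<in> {1..k} \<Longrightarrow> (\<forall>j\<in>{1..<k}. A i j \<in> K) \<and> v i = (\<Sum>j\<in>{1..<k}. A i j *s b j)"
    by metis
  define B where "B i j = (if i \<in> {1..k} \<and> j \<in> {1..<k} then A i j else 0)" for i j
  have BK: "B i j \<in> K" for i j using A by (auto simp: B_def)
  have "card {1..<k} < card {1..k}" using assms(2) by simp
  then obtain c where c: "\<forall>i\<in>{1..k}. c i \<in> K" "\<exists>i\<in>{1..k}. c i \<noteq> 0"
    "\<forall>j\<in>{1..<k}. (\<Sum>i\<in>{1..k}. c i * B i j) = 0"
    using ex_linear_relation[of "{1..<k}" "{1..k}" B] BK by auto
  have v: "v i = (\<Sum>j\<in>{1..<k}. B i j *s b j)" if i: "i \<in> {1..k}" for i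
  proof -
    have "v i = (\<Sum>j\<in>{1..<k}. A i j *s b j)" using A[OF i] by blast
    also have "\<dots> = (\<Sum>j\<in>{1..<k}. B i j *s b j)" using i by (intro sum.cong) (auto simp: B_def)
    finally show ?thesis .
  qed
  have "(\<Sum>i\<in>{1..k}. c i *s v i) = (\<Sum>i\<in>{1..k}. \<Sum>j\<in>{1..<k}. (c i * B i j) *s b j)"
    using v by (intro sum.cong) (simp_all add: smult_sum_right vector_smult_assoc)
  also have "\<dots> = (\<Sum>j\<in>{1..<k}. (\<Sum>i\<in>{1..k}. c i * B i j) *s b j)"
    by (subst sum.swap) (simp add: vec_eq_iff sum_distrib_right)
  also have "\<dots> = 0" using c(3) by (intro sum.neutral) auto
  finally have "\<forall>i\<in>{1..k}. c i = 0" using assms(1) c(1) unfolding lin_indep_def by blast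
  with c(2) show False by blast
qed

section \<open>Lattice bases, shears and competitors of reduced vectors\<close>

lemma lattice_basisD:
  assumes "is_lattice_basis K \<O> d b \<Lambda>"
  shows "i \<in> {1..d} \<Longrightarrow> K_vector (b i)" "lin_indep K d b"
    "v \<in> \<Lambda> \<longleftrightarrow> (\<exists>c. (\<forall>i\<in>{1..d}. c i \<in> \<O>) \<and> v = (\<Sum>i\<in>{1..d}. c i *s b i))"
  using assms unfolding is_lattice_basis_def by blast+

lemma lin_indep_inj:
  assumes "lin_indep K d b" "i \<in> {1..d}" "j \<in> {1..d}" "b i = b j"
  shows "i = j"
proof (rule ccontr)
  assume ij: "i \<noteq> j"
  let ?c = "\<lambda>l. if l = i then 1 else if l = j then - 1 else (0::'a)"
  have "(\<Sum>l\<in>{1..d}. ?c l *s b l) = (\<Sum>l\<in>{i, j}. ?c l *s b l)"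
    using assms by (intro sum.mono_neutral_right) auto
  also have "\<dots> = 0" using ij assms(4) by (simp add: vec_eq_iff)
  finally have "(\<Sum>l\<in>{1..d}. ?c l *s b l) = 0" .
  moreover have "\<forall>l\<in>{1..d}. ?c l \<in> K" by (auto intro: K_minus)
  ultimately have "\<forall>l\<in>{1..d}. ?c l = 0" using assms(1)[unfolded lin_indep_def, rule_format, of ?c] by blast
  with assms(2) show False by force
qed

lemma lin_indep_nonzero:
  assumes "lin_indep K d b" "i \<in> {1..d}"
  shows "b i \<noteq> 0"
proof
  assume b: "b i = 0"
  let ?c = "\<lambda>l. if l = i then 1 else (0::'a)"
  have "(\<Sum>l\<in>{1..d}. ?c l *s b l) = 0" using b by (intro sum.neutral) auto
  moreover have "\<forall>l\<in>{1..d}. ?c l \<in> K" by auto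
  ultimately have "\<forall>l\<in>{1..d}. ?c l = 0" using assms(1)[unfolded lin_indep_def, rule_format, of ?c] by blast
  with assms(2) show False by force
qed

lemma lattice_basis_mem:
  assumes "is_lattice_basis K \<O> d b \<Lambda>" "i \<in> {1..d}"
  shows "b i \<in> \<Lambda>"
proof -
  have "(\<Sum>l\<in>{1..d}. (if l = i then 1 else 0) *s b l) = (\<Sum>l\<in>{i}. (if l = i then 1 else 0) *s b l)"
    using assms(2) by (intro sum.mono_neutral_right) auto
  then show ?thesis
    unfolding lattice_basisD(3)[OF assms(1)]
    by (intro exI[of _ "\<lambda>l. if l = i then 1 else 0"]) auto
qed

lemma lattice_K_vector:
  assumes "is_lattice_basis K \<O> d b \<Lambda>" "v \<in> \<Lambda>"
  shows "K_vector v"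
proof -
  obtain c where c: "\<forall>i\<in>{1..d}. c i \<in> \<O>" "v = (\<Sum>i\<in>{1..d}. c i *s b i)"
    using assms(2) lattice_basisD(3)[OF assms(1)] by blast
  show ?thesis unfolding c(2)
    using c(1) by (intro K_vector_sum K_vector_smult lattice_basisD(1)[OF assms(1)] O_K) auto
qed

text \<open>The \<open>j\<close>-th coefficient changes by \<open>c i * y j\<close>, with
  \<open>c i\<close> on the left; hence the descent over bases below is by division on the
  left.\<close>

lemma sum_smult_shear:
  fixes b :: "nat \<Rightarrow> 'a ^ 'D"
  assumes "finite I" "i \<in> I"
  shows "(\<Sum>j\<in>I. c j *s (b(i := b i + (\<Sum>j\<in>I - {i}. y j *s b j))) j)
       = (\<Sum>j\<in>I. (if j = i then c i else c j + c i * y j) *s b j)"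
proof -
  have "(\<Sum>j\<in>I. c j *s (b(i := b i + (\<Sum>j\<in>I - {i}. y j *s b j))) j)
      = c i *s (b i + (\<Sum>j\<in>I - {i}. y j *s b j)) + (\<Sum>j\<in>I - {i}. c j *s b j)"
    using assms by (simp add: sum.remove)
  also have "\<dots> = c i *s b i + (\<Sum>j\<in>I - {i}. (c j + c i * y j) *s b j)"
    by (simp add: vector_add_ldistrib vector_sadd_rdistrib smult_sum_right vector_smult_assoc sum.distrib algebra_simps)
  also have "\<dots> = (\<Sum>j\<in>I. (if j = i then c i else c j + c i * y j) *s b j)"
    using assms by (simp add: sum.remove)
  finally show ?thesis .
qed

text \<open>A shear with coefficients in \<open>\<O>\<close> is undone by the opposite shear, so
  neither the lattice nor independence is affected.\<close>

lemma lattice_basis_shear: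
  assumes basis: "is_lattice_basis K \<O> d b \<Lambda>" and i: "i \<in> {1..d}"
    and y: "\<And>j. j \<in> {1..d} - {i} \<Longrightarrow> y j \<in> \<O>"
  shows "is_lattice_basis K \<O> d (b(i := b i + (\<Sum>j\<in>{1..d} - {i}. y j *s b j))) \<Lambda>"
    (is "is_lattice_basis K \<O> d ?b \<Lambda>")
proof -
  note B = lattice_basisD[OF basis]
  have sum_b: "(\<Sum>j\<in>{1..d}. c j *s ?b j) = (\<Sum>j\<in>{1..d}. (if j = i then c i else c j + c i * y j) *s b j)" for c
    using i by (intro sum_smult_shear) auto
  have "K_vector (?b j)" if j: "j \<in> {1..d}" for j
  proof (cases "j = i")
    case True
    have "K_vector (b i + (\<Sum>j\<in>{1..d} - {i}. y j *s b j))"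
      using i y by (intro K_vector_add K_vector_sum K_vector_smult B(1) O_K) auto
    with True show ?thesis by simp
  qed (use B(1)[OF j] in auto)
  moreover have "lin_indep K d ?b"
    unfolding lin_indep_def
  proof (intro allI impI, elim conjE)
    fix c assume c: "\<forall>j\<in>{1..d}. c j \<in> K" "(\<Sum>j\<in>{1..d}. c j *s ?b j) = 0"
    let ?e = "\<lambda>j. if j = i then c i else c j + c i * y j"
    have "\<forall>j\<in>{1..d}. ?e j \<in> K" using c(1) i O_K[OF y] by (auto intro!: K_add K_mult)
    moreover have "(\<Sum>j\<in>{1..d}. ?e j *s b j) = 0" using c(2) unfolding sum_b .
    ultimately have e: "\<forall>j\<in>{1..d}. ?e j = 0" using B(2)[unfolded lin_indep_def, rule_format, of ?e] by blast
    then have "c i = 0" using i by force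
    with e show "\<forall>j\<in>{1..d}. c j = 0" by (metis add.right_neutral mult_zero_left)
  qed
  moreover have "\<Lambda> = {\<Sum>j\<in>{1..d}. c j *s ?b j | c. \<forall>j\<in>{1..d}. c j \<in> \<O>}"
  proof (intro set_eqI iffI)
    fix v assume "v \<in> \<Lambda>"
    then obtain c where c: "\<forall>j\<in>{1..d}. c j \<in> \<O>" "v = (\<Sum>j\<in>{1..d}. c j *s b j)" using B(3) by blast
    let ?e = "\<lambda>j. if j = i then c i else c j - c i * y j"
    have "\<forall>j\<in>{1..d}. ?e j \<in> \<O>" using c(1) i y by (auto intro!: O_diff O_mult)
    moreover have "v = (\<Sum>j\<in>{1..d}. ?e j *s ?b j)"
      unfolding sum_b c(2) by (intro sum.cong) auto
    ultimately show "v \<in> {\<Sum>j\<in>{1..d}. c j *s ?b j | c. \<forall>j\<in>{1..d}. c j \<in> \<O>}"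
      by (intro CollectI exI[of _ ?e]) blast
  next
    fix v assume "v \<in> {\<Sum>j\<in>{1..d}. c j *s ?b j | c. \<forall>j\<in>{1..d}. c j \<in> \<O>}"
    then obtain c where c: "\<forall>j\<in>{1..d}. c j \<in> \<O>" "v = (\<Sum>j\<in>{1..d}. c j *s ?b j)" by blast
    let ?e = "\<lambda>j. if j = i then c i else c j + c i * y j"
    have "\<forall>j\<in>{1..d}. ?e j \<in> \<O>" using c(1) i y by (auto intro!: O_add O_mult)
    then show "v \<in> \<Lambda>" unfolding B(3) c(2) sum_b by (intro exI[of _ ?e] conjI refl)
  qed
  ultimately show ?thesis unfolding is_lattice_basis_def by blast
qed

text \<open>
  A Euclidean descent over all bases extending the first \<open>k - 1\<close> vectors: where the
  smallest nonzero tail coefficient of \<open>v\<close> is minimal, it divides the others on the left.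
\<close>

lemma ex_adapted_basis:
  assumes basis: "is_lattice_basis K \<O> d b \<Lambda>"
    and eucl: "euclidean_minimum K \<O> < 1"
    and k: "k \<in> {1..d}" and v: "v \<in> \<Lambda>"
    and nspan: "\<nexists>c. (\<forall>j\<in>{1..<k}. c j \<in> K) \<and> v = (\<Sum>j\<in>{1..<k}. c j *s b j)"
  obtains b' i a c where "is_lattice_basis K \<O> d b' \<Lambda>" "\<And>j. j \<in> {1..<k} \<Longrightarrow> b' j = b j"
    "i \<in> {k..d}" "a \<in> \<O>" "a \<noteq> 0" "\<And>j. j \<in> {1..<k} \<Longrightarrow> c j \<in> \<O>"
    "v = (\<Sum>j\<in>{1..<k}. c j *s b j) + a *s b' i"
proof -
  \<comment> \<open>A state of the descent: a basis, the coefficients of \<open>v\<close> in it, and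
    a tail index with nonzero coefficient. Its size \<open>f\<close> is the norm of that
    coefficient.\<close>
  define P where "P = (\<lambda>(b', c, i). is_lattice_basis K \<O> d b' \<Lambda> \<and> (\<forall>j\<in>{1..<k}. b' j = b j) \<and>
    (\<forall>j\<in>{1..d}. c j \<in> \<O>) \<and> v = (\<Sum>j\<in>{1..d}. c j *s b' j) \<and> i \<in> {k..d} \<and> c i \<noteq> 0)"
  define f where "f = (\<lambda>(b' :: nat \<Rightarrow> 'a ^ 'b, c :: nat \<Rightarrow> 'a, i :: nat). nrd (c i))"
  obtain c0 where c0: "\<forall>j\<in>{1..d}. c0 j \<in> \<O>" "v = (\<Sum>j\<in>{1..d}. c0 j *s b j)"
    using v lattice_basisD(3)[OF basis] by blast
  have split: "(\<Sum>j\<in>{1..d}. h j) = (\<Sum>j\<in>{1..<k}. h j) + (\<Sum>j\<in>{k..d}. h j)" for h :: "nat \<Rightarrow> 'a ^ 'b"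
  proof -
    have "{1..d} = {1..<k} \<union> {k..d}" "{1..<k} \<inter> {k..d} = {}" using k by auto
    then show ?thesis by (metis finite_atLeastAtMost finite_atLeastLessThan sum.union_disjoint)
  qed
  have "\<exists>i\<in>{k..d}. c0 i \<noteq> 0"
  proof (rule ccontr)
    assume "\<not> ?thesis"
    then have "v = (\<Sum>j\<in>{1..<k}. c0 j *s b j)" unfolding c0(2) split by simp
    moreover have "\<forall>j\<in>{1..<k}. c0 j \<in> K" using c0(1) k by (auto intro: O_K)
    ultimately show False using nspan by blast
  qed
  then obtain i0 where "P (b, c0, i0)" using basis c0 unfolding P_def by auto
  moreover have "f p \<in> \<int> \<and> f p \<ge> 0" if "P p" for p
    using that k unfolding P_def f_def by (auto simp: nrd_O split: prod.splits)
  ultimately obtain p where p: "P p" "\<And>p'. P p' \<Longrightarrow> f p \<le> f p'"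
    using ex_arg_min_Ints[of P _ f] by blast
  obtain b' c i where pe: "p = (b', c, i)" by (cases p) auto
  have basis': "is_lattice_basis K \<O> d b' \<Lambda>" and bb: "\<And>j. j \<in> {1..<k} \<Longrightarrow> b' j = b j"
    and c: "\<And>j. j \<in> {1..d} \<Longrightarrow> c j \<in> \<O>" and ve: "v = (\<Sum>j\<in>{1..d}. c j *s b' j)"
    and i: "i \<in> {k..d}" and ci: "c i \<noteq> 0"
    using p(1) unfolding P_def pe by auto
  have i1: "i \<in> {1..d}" using i k by auto
  \<comment> \<open>Left division of the tail coefficients by \<open>c i\<close>. The remainders
    become coefficients after the shear of \<open>b' i\<close> by \<open>y\<close>, so by minimality
    they vanish.\<close>
  have "\<exists>y. y \<in> \<O> \<and> (j \<in> {1..<k} \<longrightarrow> y = 0) \<and> (j \<in> {k..d} \<longrightarrow> nrd (c j - c i * y) < nrd (c i))" for j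
  proof (cases "j \<in> {k..d}")
    case True
    then have "c j \<in> \<O>" using k c by auto
    then obtain y where y: "y \<in> \<O>" "nrd (inverse (c i) * c j - y) \<le> euclidean_minimum K \<O>"
      using euclidean_approx[OF K_mult[OF K_inverse[OF O_K[OF c[OF i1]]] O_K]] by blast
    have "c j - c i * y = c i * (inverse (c i) * c j - y)"
      using ci by (simp add: right_diff_distrib mult.assoc[symmetric])
    then have "nrd (c j - c i * y) = nrd (c i) * nrd (inverse (c i) * c j - y)"
      by (simp only: nrd_mult)
    also have "\<dots> < nrd (c i) * 1" using ci y(2) eucl by (intro mult_strict_left_mono) auto
    finally show ?thesis using y(1) True by auto
  qed (auto intro: exI[of _ 0])
  then obtain y where y: "\<And>j. y j \<in> \<O>" "\<And>j. j \<in> {1..<k} \<Longrightarrow> y j = 0"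
    "\<And>j. j \<in> {k..d} \<Longrightarrow> nrd (c j - c i * y j) < nrd (c i)" by metis
  define b'' where "b'' = b'(i := b' i + (\<Sum>j\<in>{1..d} - {i}. y j *s b' j))"
  define c'' where "c'' = (\<lambda>j. if j = i then c i else c j - c i * y j)"
  have basis'': "is_lattice_basis K \<O> d b'' \<Lambda>"
    unfolding b''_def by (rule lattice_basis_shear[OF basis' i1 y(1)])
  have bb'': "b'' j = b j" if "j \<in> {1..<k}" for j
    using bb[OF that] i that by (auto simp: b''_def)
  have c''O: "c'' j \<in> \<O>" if "j \<in> {1..d}" for j
    using that c i1 y(1) by (auto simp: c''_def intro!: O_diff O_mult)
  have ve'': "v = (\<Sum>j\<in>{1..d}. c'' j *s b'' j)"
    unfolding b''_def sum_smult_shear[OF finite_atLeastAtMost i1] ve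
    by (intro sum.cong) (auto simp: c''_def)
  have zero: "c'' j = 0" if "j \<in> {k..d} - {i}" for j
  proof (rule ccontr)
    assume "c'' j \<noteq> 0"
    then have "P (b'', c'', j)" unfolding P_def using basis'' bb'' c''O ve'' that by auto
    from p(2)[OF this] have "nrd (c i) \<le> nrd (c'' j)" unfolding f_def pe by simp
    moreover have "nrd (c'' j) < nrd (c i)" using y(3)[of j] that by (simp add: c''_def)
    ultimately show False by simp
  qed
  have "(\<Sum>j\<in>{k..d}. c'' j *s b'' j) = (\<Sum>j\<in>{i}. c'' j *s b'' j)"
    using i zero by (intro sum.mono_neutral_right) auto
  moreover have "(\<Sum>j\<in>{1..<k}. c'' j *s b'' j) = (\<Sum>j\<in>{1..<k}. c'' j *s b j)"
    using bb'' by (intro sum.cong) auto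
  ultimately have "v = (\<Sum>j\<in>{1..<k}. c'' j *s b j) + c i *s b'' i"
    unfolding ve'' split by (simp add: c''_def)
  with that[OF basis'' bb'' i c[OF i1] ci _ this] c''O k show thesis by auto
qed

text \<open>The translate is the \<open>i\<close>-th vector of a sheared basis that still contains
  \<open>b 1, \<dots>, b (k - 1)\<close>, hence competes with \<open>b k\<close>.\<close>

lemma reduced_le:
  assumes red: "minkowski_reduced (\<lambda>v. sqrt (q v)) K \<O> d b \<Lambda>" and k: "k \<in> {1..d}"
    and basis': "is_lattice_basis K \<O> d b' \<Lambda>" and bb: "\<And>j. j \<in> {1..<k} \<Longrightarrow> b' j = b j"
    and i: "i \<in> {k..d}" and y: "\<And>j. j \<in> {1..<k} \<Longrightarrow> y j \<in> \<O>"
  shows "q (b k) \<le> q (b' i + (\<Sum>j\<in>{1..<k}. y j *s b j))"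
proof -
  have i1: "i \<in> {1..d}" using i k by auto
  define z where "z j = (if j \<in> {1..<k} then y j else 0)" for j
  define b'' where "b'' = b'(i := b' i + (\<Sum>j\<in>{1..d} - {i}. z j *s b' j))"
  have basis: "is_lattice_basis K \<O> d b'' \<Lambda>"
    unfolding b''_def by (rule lattice_basis_shear[OF basis' i1]) (auto simp: z_def y)
  have "(\<Sum>j\<in>{1..d} - {i}. z j *s b' j) = (\<Sum>j\<in>{1..<k}. y j *s b j)"
    using i k bb by (intro sum.mono_neutral_cong_right) (auto simp: z_def)
  then have bi: "b'' i = b' i + (\<Sum>j\<in>{1..<k}. y j *s b j)" by (simp add: b''_def)
  have bj: "b'' j = b j" if "j \<in> {1..<k}" for j using that i bb by (auto simp: b''_def)
  note indep = lattice_basisD(2)[OF basis]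
  \<comment> \<open>Competitors have to be new vectors; independence of the sheared basis guarantees
    it.\<close>
  have "b'' i \<notin> b ` {1..<k}"
  proof
    assume "b'' i \<in> b ` {1..<k}"
    then obtain j where j: "j \<in> {1..<k}" "b'' i = b'' j" using bj by auto
    then have "i = j" using lin_indep_inj[OF indep i1 _ j(2)] k by auto
    with i j(1) show False by auto
  qed
  moreover have "insert (b'' i) (b ` {1..<k}) \<subseteq> b'' ` {1..d}"
  proof -
    have "b j \<in> b'' ` {1..d}" if "j \<in> {1..<k}" for j
      using bj[OF that] that k by (auto intro!: image_eqI[of _ b'' j])
    with i1 show ?thesis by auto
  qed
  then have "extendable K \<O> \<Lambda> (insert (b'' i) (b ` {1..<k}))"
    using basis unfolding extendable_def by blast
  ultimately have "\<not> sqrt (q (b'' i)) < sqrt (q (b k))"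
    using red k lattice_basis_mem[OF basis i1] lin_indep_nonzero[OF indep i1]
    unfolding minkowski_reduced_def is_arg_min_def by blast
  then show ?thesis by (simp add: bi)
qed

lemma reduced_basis: "minkowski_reduced N K \<O> d b \<Lambda> \<Longrightarrow> is_lattice_basis K \<O> d b \<Lambda>"
  by (simp add: minkowski_reduced_def)

text \<open>A later vector of the same basis is itself a competitor.\<close>

lemma reduced_mono:
  assumes "minkowski_reduced (\<lambda>v. sqrt (q v)) K \<O> d b \<Lambda>" "1 \<le> k" "k \<le> i" "i \<le> d"
  shows "q (b k) \<le> q (b i)"
  using reduced_le[OF assms(1) _ reduced_basis[OF assms(1)], of k i "\<lambda>_. 0"] assms(2-) by simp

text \<open>Forgets the adapted basis: from here on only \<open>w\<close> and its translates
  matter.\<close>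

lemma reduced_vector_bound:
  assumes red: "minkowski_reduced (\<lambda>v. sqrt (q v)) K \<O> d b \<Lambda>"
    and eucl: "euclidean_minimum K \<O> < 1"
    and k: "k \<in> {1..d}" and v: "v \<in> \<Lambda>"
    and nspan: "\<nexists>c. (\<forall>j\<in>{1..<k}. c j \<in> K) \<and> v = (\<Sum>j\<in>{1..<k}. c j *s b j)"
  obtains a c w where "a \<in> \<O>" "a \<noteq> 0" "\<And>j. j \<in> {1..<k} \<Longrightarrow> c j \<in> \<O>" "K_vector w"
    "v = (\<Sum>j\<in>{1..<k}. c j *s b j) + a *s w"
    "\<And>y. (\<And>j. j \<in> {1..<k} \<Longrightarrow> y j \<in> \<O>) \<Longrightarrow> q (b k) \<le> q (w + (\<Sum>j\<in>{1..<k}. y j *s b j))"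
proof -
  obtain b' i a c where *: "is_lattice_basis K \<O> d b' \<Lambda>" "\<And>j. j \<in> {1..<k} \<Longrightarrow> b' j = b j"
    "i \<in> {k..d}" "a \<in> \<O>" "a \<noteq> 0" "\<And>j. j \<in> {1..<k} \<Longrightarrow> c j \<in> \<O>"
    "v = (\<Sum>j\<in>{1..<k}. c j *s b j) + a *s b' i"
    using ex_adapted_basis[OF reduced_basis[OF red] eucl k v nspan] by blast
  have "K_vector (b' i)" using *(3) k by (intro lattice_basisD(1)[OF *(1)]) auto
  from that[OF *(4,5,6) this *(7) reduced_le[OF red k *(1,2,3)]] show thesis by blast
qed

lemma reduced_bound:
  assumes red: "minkowski_reduced (\<lambda>v. sqrt (q v)) K \<O> d b \<Lambda>"
    and eucl: "euclidean_minimum K \<O> < 1"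
    and k: "k \<in> {1..d}" and v: "v \<in> \<Lambda>"
    and nspan: "\<nexists>c. (\<forall>j\<in>{1..<k}. c j \<in> K) \<and> v = (\<Sum>j\<in>{1..<k}. c j *s b j)"
  shows "q (b k) \<le> q v \<or> (\<exists>a\<in>\<O>. a \<noteq> 0 \<and> a \<notin> order_units \<O> \<and>
    q (b k) \<le> q v / nrd a + euclidean_minimum K \<O> * (\<Sum>j\<in>{1..<k}. q (b j)))"
proof -
  obtain a c w where a: "a \<in> \<O>" "a \<noteq> 0" and c: "\<And>j. j \<in> {1..<k} \<Longrightarrow> c j \<in> \<O>"
    and w: "K_vector w" and ve: "v = (\<Sum>j\<in>{1..<k}. c j *s b j) + a *s w"
    and le: "\<And>y. (\<And>j. j \<in> {1..<k} \<Longrightarrow> y j \<in> \<O>) \<Longrightarrow> q (b k) \<le> q (w + (\<Sum>j\<in>{1..<k}. y j *s b j))"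
    using reduced_vector_bound[OF assms] by blast
  \<comment> \<open>In terms of \<open>inverse a *s v\<close> the translates have coefficients in a
    coset \<open>- (inverse a * c j) + \<O>\<close>, in general not integral. This is why the
    reduction lemmas carry a fixed shift \<open>z\<close>.\<close>
  have we: "w + (\<Sum>j\<in>{1..<k}. y j *s b j)
      = inverse a *s v + (\<Sum>j\<in>{1..<k}. (- (inverse a * c j) + y j) *s b j)" for y
  proof -
    have "inverse a *s v = (\<Sum>j\<in>{1..<k}. (inverse a * c j) *s b j) + w"
      using a(2) by (simp add: ve vector_add_ldistrib smult_sum_right vector_smult_assoc)
    moreover have "(\<Sum>j\<in>{1..<k}. (- (inverse a * c j) + y j) *s b j)
        = (\<Sum>j\<in>{1..<k}. y j *s b j) - (\<Sum>j\<in>{1..<k}. (inverse a * c j) *s b j)"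
      by (simp add: smult_diff_left flip: sum_subtractf)
    ultimately show ?thesis by simp
  qed
  have qv: "q (inverse a *s v) = q v / nrd a"
    by (simp add: q_smult nrd_inverse divide_inverse mult.commute)
  show ?thesis
  proof (cases "nrd a = 1")
    case True
    \<comment> \<open>For a unit the shifts are integral, so \<open>inverse a *s v\<close> is itself
      one of the translates.\<close>
    then have "inverse a \<in> \<O>" using a(1) by (simp add: inverse_mult_star O_star)
    then have "q (b k) \<le> q (w + (\<Sum>j\<in>{1..<k}. (inverse a * c j) *s b j))"
      using c by (intro le O_mult) auto
    also have "\<dots> = q v" unfolding we using qv True by simp
    finally show ?thesis ..
  next
    case False
    have "K_vector (inverse a *s v)"
      using lattice_K_vector[OF reduced_basis[OF red] v] a by (intro K_vector_smult K_inverse O_K)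
    moreover have "K_vector (b j)" "- (inverse a * c j) \<in> K" if "j \<in> {1..<k}" for j
      using that k lattice_basisD(1)[OF reduced_basis[OF red], of j] a(1) c[of j]
      by (auto intro!: K_minus K_mult K_inverse intro: O_K)
    ultimately obtain y where y: "\<forall>j\<in>{1..<k}. y j \<in> \<O>"
      "q (inverse a *s v + (\<Sum>j\<in>{1..<k}. (- (inverse a * c j) + y j) *s b j))
        \<le> q (inverse a *s v) + euclidean_minimum K \<O> * (\<Sum>j\<in>{1..<k}. q (b j))"
      using reduce_family[of "{1..<k}" "inverse a *s v" b "\<lambda>j. - (inverse a * c j)"] by blast
    then have "q (b k) \<le> q v / nrd a + euclidean_minimum K \<O> * (\<Sum>j\<in>{1..<k}. q (b j))"
      using le[of y] unfolding we qv by fastforce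
    with False a show ?thesis by (auto simp: order_units_iff)
  qed
qed

section \<open>Discreteness of the lattice; the successive minima are attained\<close>

lemma lattice_bounded_denominator:
  assumes basis: "is_lattice_basis K \<O> d b (\<Lambda> :: ('a ^ 'D) set)"
  obtains N :: nat where "N > 0" and "\<And>v. v \<in> \<Lambda> \<Longrightarrow> real N * q v \<in> \<int>"
proof -
  \<comment> \<open>The finitely many entries of the basis have a common denominator, and being a
    central integer it can be moved past the left coefficients.\<close>
  define A where "A = (\<lambda>(i, j). b i $ j) ` ({1..d} \<times> UNIV)"
  have "finite A" "A \<subseteq> K" using lattice_basisD(1)[OF basis] by (auto simp: A_def)
  then have "\<exists>n::nat. n > 0 \<and> (\<forall>x\<in>A. of_nat n * x \<in> \<O>)"
  proof (induction A rule: finite_induct)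
    case (insert x A)
    then obtain n :: nat where n: "n > 0" "\<forall>x\<in>A. of_nat n * x \<in> \<O>" by auto
    obtain m :: nat where m: "m > 0" "of_nat m * x \<in> \<O>" using denominator[of x] insert.prems by blast
    have "of_nat (n * m) * y \<in> \<O>" if "y \<in> insert x A" for y
    proof (cases "y = x")
      case True
      have "of_nat n * (of_nat m * x) \<in> \<O>" by (rule O_mult[OF O_of_nat m(2)])
      with True show ?thesis by (simp add: mult.assoc)
    next
      case False
      then have "of_nat n * y \<in> \<O>" using n(2) that by blast
      then have "of_nat m * (of_nat n * y) \<in> \<O>" by (rule O_mult[OF O_of_nat])
      then show ?thesis by (metis mult.commute mult.assoc of_nat_mult)
    qed
    then show ?case using n m by (intro exI[of _ "n * m"]) auto
  qed (auto intro: exI[of _ 1])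
  then obtain n :: nat where n: "n > 0" "\<And>x. x \<in> A \<Longrightarrow> of_nat n * x \<in> \<O>" by blast
  have "real (n\<^sup>2) * q v \<in> \<int>" if v: "v \<in> \<Lambda>" for v
  proof -
    obtain c where c: "\<forall>i\<in>{1..d}. c i \<in> \<O>" "v = (\<Sum>i\<in>{1..d}. c i *s b i)"
      using v lattice_basisD(3)[OF basis] by blast
    have "of_nat n * v $ j \<in> \<O>" for j
    proof -
      have "of_nat n * v $ j = (\<Sum>i\<in>{1..d}. c i * (of_nat n * b i $ j))"
      proof -
        have "c i * of_nat n = of_nat n * c i" for i using of_real_commute[of "c i" "real n"] by simp
        then show ?thesis by (simp add: c(2) sum_distrib_left mult.assoc[symmetric])
      qed
      also have "\<dots> \<in> \<O>"
      proof (rule O_sum)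
        fix i assume i: "i \<in> {1..d}"
        then have "b i $ j \<in> A" by (auto simp: A_def)
        with i show "c i * (of_nat n * b i $ j) \<in> \<O>" using c(1) n(2) O_mult by blast
      qed
      finally show ?thesis .
    qed
    then have "(\<Sum>j\<in>UNIV. nrd (of_nat n * v $ j)) \<in> \<int>" by (intro Ints_sum nrd_O)
    moreover have "nrd (of_nat n * x) = (real n)\<^sup>2 * nrd x" for x :: 'a
      using nrd_of_real_mult[of "real n" x] by simp
    ultimately show ?thesis by (simp add: q_def sum_distrib_left)
  qed
  with that[of "n\<^sup>2"] n(1) show thesis by simp
qed

text \<open>A real \<open>LEAST\<close> says something only if a least element exists. Since
  \<open>q\<close> takes values in multiples of \<open>1 / N\<close> on the lattice, the search
  reduces to a least natural number \<open>m\<close> with bound \<open>sqrt (m / N)\<close>.\<close>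

lemma successive_minimum:
  assumes basis: "is_lattice_basis K \<O> d b (\<Lambda> :: ('a ^ 'D) set)" and k: "1 \<le> k" "k \<le> d"
  defines "lam \<equiv> successive_minimum (\<lambda>v. sqrt (q v)) K \<Lambda> k"
  shows "\<exists>v. (\<forall>j\<in>{1..k}. v j \<in> \<Lambda> \<and> sqrt (q (v j)) \<le> lam) \<and> lin_indep K k v"
    and "(\<forall>j\<in>{1..k}. v j \<in> \<Lambda> \<and> sqrt (q (v j)) \<le> r) \<Longrightarrow> lin_indep K k v \<Longrightarrow> lam \<le> r"
proof -
  obtain N :: nat where N: "N > 0" "\<And>v. v \<in> \<Lambda> \<Longrightarrow> real N * q v \<in> \<int>"
    using lattice_bounded_denominator[OF basis] by blast
  define R where "R r \<longleftrightarrow> (\<exists>v. (\<forall>j\<in>{1..k}. v j \<in> \<Lambda> \<and> sqrt (q (v j)) \<le> r) \<and> lin_indep K k v)" for r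
  define Q where "Q m \<longleftrightarrow> R (sqrt (real m / real N))" for m :: nat
  \<comment> \<open>Every admissible bound can be lowered to one of the form
    \<open>sqrt (m / N)\<close>.\<close>
  have floor: "\<exists>m. Q m \<and> sqrt (real m / real N) \<le> r" if R: "R r" for r
  proof -
    obtain v where v: "\<forall>j\<in>{1..k}. v j \<in> \<Lambda> \<and> sqrt (q (v j)) \<le> r" "lin_indep K k v"
      using R unfolding R_def by blast
    have r: "0 \<le> r" using v(1) k by (meson atLeastAtMost_iff order_refl order_trans q_nonneg real_sqrt_ge_zero)
    define m where "m = nat \<lfloor>real N * r\<^sup>2\<rfloor>"
    have m: "real m \<le> real N * r\<^sup>2" by (simp add: m_def)
    then have "real m / real N \<le> r\<^sup>2" using N(1) by (simp add: field_simps)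
    then have 1: "sqrt (real m / real N) \<le> r" using r by (simp add: real_le_lsqrt)
    have "sqrt (q (v j)) \<le> sqrt (real m / real N)" if j: "j \<in> {1..k}" for j
    proof -
      have "q (v j) \<le> r\<^sup>2" using v(1) j r by (meson sqrt_le_D)
      then have le: "real N * q (v j) \<le> real N * r\<^sup>2" by (simp add: mult_left_mono)
      obtain z where z: "real N * q (v j) = of_int z" using N(2)[of "v j"] v(1) j by (auto elim: Ints_cases)
      with le have "z \<le> \<lfloor>real N * r\<^sup>2\<rfloor>" by (simp add: le_floor_iff)
      then have "real N * q (v j) \<le> real m" unfolding z m_def by simp
      then show ?thesis using N(1) by (simp add: field_simps)
    qed
    with v have "Q m" unfolding Q_def R_def by blast
    with 1 show ?thesis by blast
  qed
  have "R (Max ((\<lambda>j. sqrt (q (b j))) ` {1..d}))"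
    unfolding R_def
  proof (intro exI[of _ b] conjI ballI)
    fix j assume "j \<in> {1..k}"
    then have j: "j \<in> {1..d}" using k by auto
    then show "b j \<in> \<Lambda>" by (rule lattice_basis_mem[OF basis])
    from j show "sqrt (q (b j)) \<le> Max ((\<lambda>j. sqrt (q (b j))) ` {1..d})" by simp
  next
    show "lin_indep K k b"
      unfolding lin_indep_def
    proof (intro allI impI, elim conjE)
      fix c assume c: "\<forall>i\<in>{1..k}. c i \<in> K" "(\<Sum>i\<in>{1..k}. c i *s b i) = 0"
      let ?c = "\<lambda>i. if i \<in> {1..k} then c i else 0"
      have "(\<Sum>i\<in>{1..d}. ?c i *s b i) = (\<Sum>i\<in>{1..k}. c i *s b i)"
        using k by (intro sum.mono_neutral_cong_right) auto
      moreover have "\<forall>i\<in>{1..d}. ?c i \<in> K" using c(1) by auto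
      ultimately have "\<forall>i\<in>{1..d}. ?c i = 0"
        using c(2) lattice_basisD(2)[OF basis, unfolded lin_indep_def, rule_format, of ?c] by auto
      then show "\<forall>i\<in>{1..k}. c i = 0" using k by (metis atLeastAtMost_iff order_trans)
    qed
  qed
  from floor[OF this] have "\<exists>m. Q m" by blast
  define m where "m = (LEAST m. Q m)"
  have Qm: "Q m" and least: "\<And>m'. Q m' \<Longrightarrow> m \<le> m'"
    unfolding m_def using \<open>\<exists>m. Q m\<close> by (auto intro: LeastI_ex Least_le)
  have "sqrt (real m / real N) \<le> r" if "R r" for r
  proof -
    obtain m' where m': "Q m'" "sqrt (real m' / real N) \<le> r" using floor[OF \<open>R r\<close>] by blast
    have "sqrt (real m / real N) \<le> sqrt (real m' / real N)"
      using least[OF m'(1)] by (simp add: divide_right_mono)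
    also note m'(2)
    finally show ?thesis .
  qed
  then have "lam = sqrt (real m / real N)"
    unfolding assms(4) successive_minimum_def R_def[symmetric]
    using Qm unfolding Q_def by (intro Least_equality) auto
  with Qm \<open>\<And>r. R r \<Longrightarrow> sqrt (real m / real N) \<le> r\<close>
  show "\<exists>v. (\<forall>j\<in>{1..k}. v j \<in> \<Lambda> \<and> sqrt (q (v j)) \<le> lam) \<and> lin_indep K k v"
    and "(\<forall>j\<in>{1..k}. v j \<in> \<Lambda> \<and> sqrt (q (v j)) \<le> r) \<Longrightarrow> lin_indep K k v \<Longrightarrow> lam \<le> r"
    unfolding Q_def R_def by blast+
qed

end

section \<open>The covering condition and imaginary quadratic fields\<close>

lemma nrd_lin: "nrd (of_real x + of_real y * u) = x\<^sup>2 + 2 * re u * x * y + nrd u * y\<^sup>2"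
proof -
  have "re (of_real x * star (of_real y * u)) = x * (y * re u)"
    by (simp only: re_of_real_mult re_star)
  then show ?thesis by (simp add: nrd_add nrd_mult)
qed

text \<open>If the trace of \<open>s\<close> were nonzero, the quadratic equation of
  \<open>s\<close> would make \<open>s\<close> real, but real squares are nonnegative.\<close>

lemma square_neg_real:
  fixes s :: "'a::star_div_algebra"
  assumes "s * s = of_real r" "r < 0"
  shows "re s = 0" "star s = - s" "nrd s = - r"
proof -
  define c where "c = 2 * re s"
  have "of_real (nrd s) = s * (of_real c - s)"
    by (simp only: of_real_nrd star_conv[of s] c_def)
  also have "\<dots> = of_real c * s - of_real r"
    by (simp only: right_diff_distrib of_real_commute[of s] assms(1))
  finally have eq: "of_real c * s = of_real (nrd s + r)" by simp
  show re: "re s = 0"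
  proof (rule ccontr)
    assume "re s \<noteq> 0"
    then have "inverse c * c = 1" by (simp add: c_def)
    then have "s = of_real (inverse c * c) * s" by (simp only: of_real_1 mult_1_left)
    also have "\<dots> = of_real (inverse c * (nrd s + r))"
      by (simp only: eq of_real_mult mult.assoc)
    finally obtain t where t: "s = of_real t" by blast
    then have "of_real (t * t) = (of_real r :: 'a)" using assms(1) by simp
    then have "t * t = r" by (simp only: of_real_eq_iff)
    with assms(2) show False by (metis not_square_less_zero)
  qed
  show "star s = - s" using re by (simp add: star_conv[of s])
  have "of_real (nrd s + r) = (of_real 0 :: 'a)" using eq re by (simp add: c_def)
  then have "nrd s + r = 0" by (simp only: of_real_eq_iff)
  then show "nrd s = - r" by simp
qed

text \<open>
  The average over the vertices \<open>y\<close> of \<open>nrd (e + z - y)\<close>, weighted by the barycentric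
  coordinates of \<open>z\<close>, is the right-hand side.
\<close>

lemma triangle_vertex_close:
  fixes e u :: "'a::star_div_algebra"
  assumes "0 \<le> S" "0 \<le> T" "S + T \<le> 1" and z: "z = of_real S + of_real T * u"
  shows "\<exists>y\<in>{0, 1, u}. nrd (e + z - y) \<le> nrd e + S + T * nrd u - nrd z"
proof (rule ccontr)
  define C f where "C = nrd e + S + T * nrd u - nrd z" and "f y = nrd (e + z - y)" for y
  assume "\<not> ?thesis"
  then have f: "f 0 > C" "f 1 > C" "f u > C" by (auto simp: f_def C_def)
  have fe: "f y = nrd (e + z) + nrd y - 2 * re ((e + z) * star y)" for y
    by (simp add: f_def nrd_diff)
  have "re ((e + z) * star z) = S * re (e + z) + T * re ((e + z) * star u)"
  proof -
    have "(e + z) * star z = of_real S * (e + z) + of_real T * ((e + z) * star u)"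
      using of_real_commute[of "e + z" S] of_real_commute[of "star u" T] of_real_commute[of "(e + z) * star u" T]
      by (simp add: z[THEN arg_cong[where f = star]] star_add star_mult distrib_left mult.assoc)
    then show ?thesis by (simp only: re_add re_of_real_mult)
  qed
  moreover have "nrd e = nrd (e + z) + nrd z - 2 * re ((e + z) * star z)"
    using nrd_diff[of "e + z" z] by simp
  ultimately have "(1 - S - T) * f 0 + S * f 1 + T * f u = C"
    unfolding fe C_def by (simp add: algebra_simps)
  moreover have "(1 - S - T) * f 0 \<ge> (1 - S - T) * C" "S * f 1 \<ge> S * C" "T * f u \<ge> T * C"
    using assms(1-3) f by (auto intro!: mult_left_mono)
  moreover have "(1 - S - T) * f 0 > (1 - S - T) * C \<or> S * f 1 > S * C \<or> T * f u > T * C"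
    using assms(1-3) f by (smt (verit) mult_strict_left_mono)
  ultimately show False by (auto simp: algebra_simps)
qed

text \<open>With \<open>t = 2 * re u\<close> and \<open>n = nrd u\<close>, this is the squared
  distance of the point \<open>x + y * u\<close> from the circumcentre of \<open>0\<close>,
  \<open>1\<close>, \<open>u\<close>, minus the squared circumradius: the circle has no lattice
  point inside. Passing from 1 to \<open>n\<close> adds
  \<open>(n - 1) * (y * y - y)\<close>.\<close>

lemma lattice_triangle_nonneg:
  fixes x y t :: int and n :: real
  assumes "t = 0 \<or> t = 1" "n \<ge> 1"
  shows "(of_int x)\<^sup>2 + of_int t * of_int x * of_int y + n * (of_int y)\<^sup>2 - of_int x - n * of_int y \<ge> 0"
proof -
  have yy: "y * y - y \<ge> 0" for y :: int
  proof (cases "y \<ge> 1")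
    case True then show ?thesis by (simp add: mult_le_cancel_left1)
  next
    case False then have "y \<le> 0" by simp
    then show ?thesis by (smt (verit) mult_nonpos_nonpos)
  qed
  have "x * x + t * x * y + y * y - x - y \<ge> 0"
    using assms(1)
  proof
    assume t: "t = 1"
    \<comment> \<open>The squares only give that twice the value is at least \<open>- 1\<close>;
      integrality does the rest.\<close>
    have "2 * (x * x + x * y + y * y - x - y) = (x + y - 1) * (x + y - 1) + x * x + y * y - 1"
      by (simp add: algebra_simps)
    moreover have "x * x \<ge> 0" "y * y \<ge> 0" "(x + y - 1) * (x + y - 1) \<ge> 0" by simp_all
    ultimately have "2 * (x * x + x * y + y * y - x - y) \<ge> -1" by linarith
    then have "x * x + x * y + y * y - x - y \<ge> 0" by presburger
    then show ?thesis using t by simp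
  qed (use yy[of x] yy[of y] in simp)
  then have "real_of_int (x * x + t * x * y + y * y - x - y) \<ge> 0" by (simp only: of_int_0_le_iff)
  moreover have "0 \<le> real_of_int (y * y - y)" using yy[of y] by (simp only: of_int_0_le_iff)
  then have "(n - 1) * real_of_int (y * y - y) \<ge> 0"
    using assms(2) by (intro mult_nonneg_nonneg) auto
  ultimately show ?thesis by (simp add: algebra_simps power2_eq_square)
qed

section \<open>Hemisphere coverings and the bound by successive minima\<close>

context rational_order
begin

text \<open>The test point is \<open>inverse l\<close>. Multiplied by \<open>l\<close>, its
  difference from \<open>y\<close> becomes \<open>1 - l * y\<close>, an element of
  \<open>\<O>\<close> that is nonzero because \<open>l\<close> is not a unit.\<close>

lemma euclidean_minimum_ge_inverse_nrd:
  assumes "l \<in> \<O>" "l \<noteq> 0" "l \<notin> order_units \<O>"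
  shows "1 / nrd l \<le> euclidean_minimum K \<O>"
proof (rule euclidean_minimum_ge)
  show "inverse l \<in> span K" using assms by (intro span_base K_inverse O_K)
  fix y assume y: "y \<in> \<O>"
  have "1 - l * y \<noteq> 0"
  proof
    assume "1 - l * y = 0"
    then have "l * y = 1" by simp
    then have "nrd l * nrd y = 1" by (simp flip: nrd_mult)
    moreover have "nrd y \<ge> 1" using \<open>l * y = 1\<close> y by (intro nrd_O_ge_1) auto
    moreover have "nrd l \<ge> 1" using assms by (intro nrd_O_ge_1) auto
    ultimately have "nrd l = 1" by (smt (verit) mult_le_cancel_left1)
    with assms show False by (simp add: order_units_iff)
  qed
  then have "1 \<le> nrd (1 - l * y)" using assms y by (intro nrd_O_ge_1 O_diff O_mult) auto
  also have "1 - l * y = l * (inverse l - y)" using assms by (simp add: right_diff_distrib)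
  finally have "1 \<le> nrd l * nrd (inverse l - y)" by (simp only: nrd_mult)
  moreover have "nrd l > 0" using assms by simp
  ultimately show "1 / nrd l \<le> nrd (inverse l - y)" by (simp add: pos_divide_le_eq mult.commute)
qed

text \<open>
  Says that the hemisphere of radius \<open>1 / sqrt (nrd a)\<close> around \<open>- (inverse a * c)\<close>
  in hyperbolic space lies below the union of the unit hemispheres around \<open>\<O>\<close>.
\<close>

definition hemispheres_covered :: bool where
  "hemispheres_covered \<longleftrightarrow> (\<forall>a\<in>\<O>. \<forall>c\<in>\<O>. \<forall>\<mu>\<in>K. a \<noteq> 0 \<and> a \<notin> order_units \<O> \<longrightarrow>
     (\<exists>y\<in>\<O>. nrd (\<mu> - y) \<le> nrd (\<mu> + inverse a * c) + 1 - 1 / nrd a))"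

lemma second_vector_minimal:
  assumes red: "minkowski_reduced (\<lambda>v. sqrt (q v)) K \<O> d b \<Lambda>"
    and eucl: "euclidean_minimum K \<O> < 1"
    and d: "2 \<le> d" and v: "v \<in> \<Lambda>"
    and nspan: "\<nexists>c. (\<forall>j\<in>{1..<2}. c j \<in> K) \<and> v = (\<Sum>j\<in>{1..<2}. c j *s b j)"
    and cover: hemispheres_covered
  shows "q (b 2) \<le> q v"
proof -
  have one: "{1..<2} = {1::nat}" by auto
  have d2: "2 \<in> {1..d}" using d by simp
  obtain a c w where a: "a \<in> \<O>" "a \<noteq> 0" and c: "c 1 \<in> \<O>" and w: "K_vector w"
    and ve: "v = c 1 *s b 1 + a *s w"
    and le: "\<And>y. y \<in> \<O> \<Longrightarrow> q (b 2) \<le> q (w + y *s b 1)"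
  proof -
    obtain a c w where *: "a \<in> \<O>" "a \<noteq> 0" "\<And>j. j \<in> {1..<2} \<Longrightarrow> c j \<in> \<O>" "K_vector w"
      "v = (\<Sum>j\<in>{1..<2}. c j *s b j) + a *s w"
      "\<And>y. (\<And>j. j \<in> {1..<2} \<Longrightarrow> y j \<in> \<O>) \<Longrightarrow> q (b 2) \<le> q (w + (\<Sum>j\<in>{1..<2}. y j *s b j))"
      using reduced_vector_bound[OF red eucl d2 v nspan] by blast
    show thesis
    proof (rule that[OF *(1,2) _ *(4)])
      show "c 1 \<in> \<O>" using *(3) by simp
      show "v = c 1 *s b 1 + a *s w" using *(5) unfolding one by simp
      show "q (b 2) \<le> q (w + y *s b 1)" if "y \<in> \<O>" for y
        using *(6)[of "\<lambda>_. y"] that unfolding one by simp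
    qed
  qed
  define r where "r = inverse a * c 1"
  have "v = a *s (w + r *s b 1)"
    using a(2) by (simp add: ve r_def vector_add_ldistrib vector_smult_assoc mult.assoc[symmetric] add.commute)
  then have qv: "q v = nrd a * q (w + r *s b 1)" by (simp only: q_smult)
  show ?thesis
  proof (cases "nrd a = 1")
    case True
    then have "r \<in> \<O>" using a(1) c by (simp add: r_def inverse_mult_star O_star O_mult)
    from le[OF this] show ?thesis using True by (simp add: qv)
  next
    case False
    have "K_vector (b 1)" using d by (intro lattice_basisD(1)[OF reduced_basis[OF red]]) auto
    then obtain \<gamma> W where \<gamma>: "\<gamma> \<in> K" "W \<ge> 0" "\<And>z. q (w + z *s b 1) = nrd (\<gamma> + z) * q (b 1) + W"
      using q_line[OF w] by blast
    have "a \<notin> order_units \<O>" using False by (simp add: order_units_iff)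
    then obtain y where y: "y \<in> \<O>" "nrd (\<gamma> - y) \<le> nrd (\<gamma> + r) + 1 - 1 / nrd a"
      using cover[unfolded hemispheres_covered_def] a c \<gamma>(1) unfolding r_def by blast
    define B m t where "B = q (b 1)" and "m = nrd (\<gamma> - y)" and "t = nrd (\<gamma> + r)"
    \<comment> \<open>This places the point over \<open>\<gamma>\<close> of squared height
      \<open>W / B\<close> on or above the unit hemisphere around \<open>y\<close>.\<close>
    have "q (b 1) \<le> q (b 2)" using reduced_mono[OF red, of 1 2] d by simp
    moreover have b2: "q (b 2) \<le> m * B + W"
      using le[OF O_minus[OF y(1)]] \<gamma>(3)[of "- y"] by (simp add: m_def B_def)
    ultimately have *: "B \<le> m * B + W" by (simp add: B_def)
    have "nrd a \<ge> 1" using a by (intro nrd_O_ge_1)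
    then have "nrd a * m \<le> nrd a * (t + 1 - 1 / nrd a)"
      using y(2) unfolding m_def t_def by (intro mult_left_mono) auto
    also have "\<dots> = nrd a * t + nrd a - 1"
      using a(2) by (simp add: right_diff_distrib distrib_left)
    finally have "(nrd a * m) * B \<le> (nrd a * t + nrd a - 1) * B"
      by (rule mult_right_mono) (simp add: B_def)
    \<comment> \<open>By the covering inequality \<open>q v - (m * B + W)\<close> is at least this
      product.\<close>
    moreover have "0 \<le> (nrd a - 1) * (m * B + W - B)"
      using * \<open>nrd a \<ge> 1\<close> by simp
    moreover have "q v = nrd a * (t * B + W)" unfolding qv \<gamma>(3) t_def B_def ..
    ultimately have "m * B + W \<le> q v" by (simp add: algebra_simps)
    with b2 show ?thesis by simp
  qed
qed

text \<open>\<open>g\<close> stays abstract so that the exceptional algebra, with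
  \<open>g = 1\<close>, is treated together with the covered cases. The induction is strong because
  the sum in \<open>delta\<close> runs over all smaller indices.\<close>

lemma reduced_successive_minimum_bound:
  assumes red: "minkowski_reduced (\<lambda>v. sqrt (q v)) K \<O> d b (\<Lambda> :: ('a ^ 'D) set)"
    and eucl: "euclidean_minimum K \<O> < 1"
    and l: "is_arg_min nrd (\<lambda>x. x \<in> \<O> \<and> x \<noteq> 0 \<and> x \<notin> order_units \<O>) l"
    and g: "g = 1 \<or> hemispheres_covered \<and> g = max 2 (nat \<lfloor>inverse (euclidean_minimum K \<O>)\<rfloor>)"
    and k: "1 \<le> k" "k \<le> d"
  shows "q (b k) \<le> (delta (euclidean_minimum K \<O>) (nrd l) g k)\<^sup>2
    * (successive_minimum (\<lambda>v. sqrt (q v)) K \<Lambda> k)\<^sup>2"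
  using k
proof (induction k rule: less_induct)
  case (less k)
  define M n where "M = euclidean_minimum K \<O>" and "n = nrd l"
  define lam where "lam = successive_minimum (\<lambda>v. sqrt (q v)) K \<Lambda>"
  define D where "D k = (delta M n g k)\<^sup>2" for k
  note basis = reduced_basis[OF red]
  have l': "l \<in> \<O>" "l \<noteq> 0" "l \<notin> order_units \<O>"
    "\<And>x. x \<in> \<O> \<Longrightarrow> x \<noteq> 0 \<Longrightarrow> x \<notin> order_units \<O> \<Longrightarrow> n \<le> nrd x"
    using l unfolding is_arg_min_def n_def by (auto simp: not_less)
  have n1: "n \<ge> 1" unfolding n_def using l' by (intro nrd_O_ge_1)
  have Mn: "1 / n \<le> M" unfolding M_def n_def using l' by (intro euclidean_minimum_ge_inverse_nrd)
  then have M0: "M > 0" using n1 by (smt (verit) divide_pos_pos)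
  obtain v where v: "\<And>j. j \<in> {1..k} \<Longrightarrow> v j \<in> \<Lambda> \<and> sqrt (q (v j)) \<le> lam k" "lin_indep K k v"
    using successive_minimum(1)[OF basis less.prems] unfolding lam_def by blast
  have lam0: "lam k \<ge> 0"
    using v(1)[of 1] less.prems(1) order_trans[OF real_sqrt_ge_zero[OF q_nonneg]] by fastforce
  \<comment> \<open>The first \<open>j\<close> of the vectors realising the \<open>k\<close>-th
    minimum compete for the \<open>j\<close>-th.\<close>
  have mono: "(lam j)\<^sup>2 \<le> (lam k)\<^sup>2" if j: "1 \<le> j" "j < k" for j
  proof -
    have "lin_indep K j v"
      unfolding lin_indep_def
    proof (intro allI impI, elim conjE)
      fix c assume c: "\<forall>i\<in>{1..j}. c i \<in> K" "(\<Sum>i\<in>{1..j}. c i *s v i) = 0"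
      let ?c = "\<lambda>i. if i \<in> {1..j} then c i else 0"
      have "(\<Sum>i\<in>{1..k}. ?c i *s v i) = (\<Sum>i\<in>{1..j}. c i *s v i)"
        using that by (intro sum.mono_neutral_cong_right) auto
      moreover have "\<forall>i\<in>{1..k}. ?c i \<in> K" using c(1) by auto
      ultimately have "\<forall>i\<in>{1..k}. ?c i = 0"
        using c(2) v(2)[unfolded lin_indep_def, rule_format, of ?c] by auto
      then show "\<forall>i\<in>{1..j}. c i = 0" using that by (metis atLeastAtMost_iff order.strict_implies_order order_trans)
    qed
    moreover have jd: "j \<le> d" using that less.prems by simp
    moreover have "\<forall>i\<in>{1..j}. v i \<in> \<Lambda> \<and> sqrt (q (v i)) \<le> lam k" using v(1) that by auto
    ultimately have "lam j \<le> lam k"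
      using successive_minimum(2)[OF basis that(1) jd] unfolding lam_def by blast
    moreover have "0 \<le> lam j"
    proof -
      obtain u where "sqrt (q (u (1::nat) :: 'a ^ 'D)) \<le> lam j"
        using successive_minimum(1)[OF basis j(1) jd] j(1) unfolding lam_def by force
      then show ?thesis by (meson order_trans q_nonneg real_sqrt_ge_zero)
    qed
    ultimately show ?thesis by (intro power_mono)
  qed
  obtain i where i: "i \<in> {1..k}"
    "\<nexists>c. (\<forall>j\<in>{1..<k}. c j \<in> K) \<and> v i = (\<Sum>j\<in>{1..<k}. c j *s b j)"
    using lin_indep_not_all_in_span[OF v(2) less.prems(1), of b] by blast
  have vi: "v i \<in> \<Lambda>" "q (v i) \<le> (lam k)\<^sup>2" using v(1)[OF i(1)] by (auto intro: sqrt_le_D)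
  have sum_le: "(\<Sum>j\<in>{1..<k}. q (b j)) \<le> (\<Sum>j\<in>{1..<k}. D j) * (lam k)\<^sup>2"
    unfolding sum_distrib_right
  proof (rule sum_mono)
    fix j assume j: "j \<in> {1..<k}"
    then have "q (b j) \<le> D j * (lam j)\<^sup>2"
      using less.IH[of j] less.prems unfolding D_def M_def n_def lam_def by auto
    also have "\<dots> \<le> D j * (lam k)\<^sup>2" using mono j by (intro mult_left_mono) (auto simp: D_def)
    finally show "q (b j) \<le> D j * (lam k)\<^sup>2" .
  qed
  have bound: "q (b k) \<le> (lam k)\<^sup>2 \<or> q (b k) \<le> (M * (\<Sum>j\<in>{1..<k}. D j) + 1 / n) * (lam k)\<^sup>2"
  proof -
    have "k \<in> {1..d}" using less.prems by simp
    from reduced_bound[OF red eucl this vi(1) i(2)] show ?thesis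
    proof (elim disjE bexE conjE)
      fix a assume a: "a \<in> \<O>" "a \<noteq> 0" "a \<notin> order_units \<O>"
        and le: "q (b k) \<le> q (v i) / nrd a + euclidean_minimum K \<O> * (\<Sum>j\<in>{1..<k}. q (b j))"
      have "q (v i) / nrd a \<le> (lam k)\<^sup>2 / n"
        using l'(4)[OF a] n1 vi(2) by (intro frac_le) auto
      moreover have "M * (\<Sum>j\<in>{1..<k}. q (b j)) \<le> M * ((\<Sum>j\<in>{1..<k}. D j) * (lam k)\<^sup>2)"
        using sum_le M0 by (intro mult_left_mono) auto
      ultimately have "q (b k) \<le> (M * (\<Sum>j\<in>{1..<k}. D j) + 1 / n) * (lam k)\<^sup>2"
        using le unfolding M_def[symmetric] by (simp add: algebra_simps)
      then show ?thesis ..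
    qed (use vi(2) in auto)
  qed
  have "q (b k) \<le> D k * (lam k)\<^sup>2"
  proof (cases "k \<le> g")
    case False
    have "0 \<le> max 1 (M * (\<Sum>j\<in>{1..<k}. D j) + 1 / n)" by simp
    then have Dk: "D k = max 1 (M * (\<Sum>j\<in>{1..<k}. D j) + 1 / n)"
      using False by (simp add: D_def delta.simps[of M n g k])
    have "1 * (lam k)\<^sup>2 \<le> D k * (lam k)\<^sup>2" "(M * (\<Sum>j\<in>{1..<k}. D j) + 1 / n) * (lam k)\<^sup>2 \<le> D k * (lam k)\<^sup>2"
      by (rule mult_right_mono; simp add: Dk)+
    with bound show ?thesis by auto
  next
    case True
    then have Dk: "D j = 1" if "j \<le> k" for j using that by (simp add: D_def delta.simps[of M n g j])
    \<comment> \<open>Up to \<open>g\<close> all deltas are 1, so their sum over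
      \<open>{1..<k}\<close> is \<open>k - 1\<close>.\<close>
    have small: "q (b k) \<le> (lam k)\<^sup>2" if "M * (real k - 1) + 1 / n \<le> 1"
    proof -
      have "(\<Sum>j\<in>{1..<k}. D j) = real k - 1" using Dk less.prems(1) by (simp add: of_nat_diff)
      then have "(M * (\<Sum>j\<in>{1..<k}. D j) + 1 / n) * (lam k)\<^sup>2 \<le> 1 * (lam k)\<^sup>2"
        using that by (intro mult_right_mono) auto
      with bound show ?thesis by auto
    qed
    have "q (b k) \<le> (lam k)\<^sup>2"
    proof (cases "k = 1")
      case True
      with small n1 show ?thesis by simp
    next
      case k1: False
      with \<open>k \<le> g\<close> less.prems(1) g have cover: hemispheres_covered
        and gk: "k \<le> max 2 (nat \<lfloor>inverse M\<rfloor>)" unfolding M_def by auto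
      show ?thesis
      proof (cases "k = 2")
        case True
        have "q (b 2) \<le> q (v i)"
          using second_vector_minimal[OF red eucl _ vi(1) _ cover] i(2) less.prems True by blast
        with vi(2) True show ?thesis by simp
      next
        case False
        with k1 less.prems(1) gk have "int k \<le> \<lfloor>inverse M\<rfloor>" by auto
        then have "real k \<le> inverse M" by (simp add: le_floor_iff)
        then have "M * real k \<le> 1" using M0 by (simp add: field_simps)
        with Mn have "M * (real k - 1) + 1 / n \<le> 1" by (simp add: algebra_simps)
        then show ?thesis by (rule small)
      qed
    qed
    then show ?thesis using Dk by simp
  qed
  then show ?case unfolding D_def M_def n_def lam_def .
qed

text \<open>A shortest nonreal element makes \<open>1\<close>, \<open>u\<close> a reduced basis of a
  planar lattice; a change of sign then normalises the trace to 0 or 1.\<close>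

lemma ex_nonreal_generator:
  assumes "imaginary_quadratic_field K"
  obtains u and t :: int where "u \<in> \<O>" "u \<notin> \<real>" "t = 0 \<or> t = 1" "2 * re u = of_int t"
    "\<And>z. z \<in> K \<Longrightarrow> \<exists>S T. z = of_real S + of_real T * u"
    "\<And>z. z \<in> \<O> \<Longrightarrow> \<exists>m n :: int. z = of_int m + of_int n * u"
proof -
  obtain a :: rat and s where a: "a < 0" "s * s = of_real (of_rat a)"
    and K: "K = {of_real x + of_real y * s | x y. x \<in> \<rat> \<and> y \<in> \<rat>}"
    using assms unfolding imaginary_quadratic_field_def by blast
  have "(of_rat a :: real) < 0" using a(1) by simp
  note s = square_neg_real[OF a(2) this]
  have s_nonreal: "s \<notin> \<real>"
  proof
    assume "s \<in> \<real>"
    then obtain r where "s = of_real r" by (auto elim: Reals_cases)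
    with s(1,3) a(1) show False by simp
  qed
  have "s \<in> K" unfolding K by (intro CollectI exI[of _ 0] exI[of _ 1]) auto
  then obtain n :: nat where n: "n > 0" "of_nat n * s \<in> \<O>" using denominator by blast
  have "of_nat n * s \<notin> \<real>"
  proof
    assume "of_nat n * s \<in> \<real>"
    then have "of_real (inverse (real n)) * (of_nat n * s) \<in> \<real>" by (rule Reals_mult[OF Reals_of_real])
    also have "of_real (inverse (real n)) * (of_nat n * s) = s" using n(1) by (simp add: mult.assoc[symmetric])
    finally show False using s_nonreal by simp
  qed
  with n(2) obtain u where u: "u \<in> \<O>" "u \<notin> \<real>" and umin: "\<And>x. x \<in> \<O> \<Longrightarrow> x \<notin> \<real> \<Longrightarrow> nrd u \<le> nrd x"
    using ex_arg_min_Ints[of "\<lambda>x. x \<in> \<O> \<and> x \<notin> \<real>" "of_nat n * s" nrd] nrd_O by (metis nrd_nonneg)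
  obtain t where t: "2 * re u = of_int t" using trace_O[OF u(1)] by (auto elim: Ints_cases)
  have nonreal: "u + of_int i \<notin> \<real>" for i
  proof
    assume "u + of_int i \<in> \<real>"
    then have "u + of_int i - of_int i \<in> \<real>" by (intro Reals_diff) auto
    with u(2) show False by simp
  qed
  \<comment> \<open>Minimality against the two neighbours, whose norms are
    \<open>nrd u + 1 + t\<close> and \<open>nrd u + 1 - t\<close>.\<close>
  have "nrd u \<le> nrd (u + 1)" "nrd u \<le> nrd (u + - 1)"
    using u nonreal[of 1] nonreal[of "-1"] by (intro umin O_add O_minus; simp)+
  then have "-1 \<le> t" "t \<le> 1" using t by (auto simp: nrd_add nrd_diff)
  define u' where "u' = (if t = -1 then - u else u)"
  define t' where "t' = \<bar>t\<bar>"
  have u': "u' \<in> \<O>" "u' \<notin> \<real>" "t' = 0 \<or> t' = 1" "2 * re u' = of_int t'" "nrd u' = nrd u"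
    using u t \<open>-1 \<le> t\<close> \<open>t \<le> 1\<close> by (auto simp: u'_def t'_def O_minus)
  have coord: "\<exists>S T. z = of_real S + of_real T * u'" if z: "z \<in> K" for z
  proof -
    obtain x y x' y' where xy: "z = of_real x + of_real y * s" "u' = of_real x' + of_real y' * s"
      using z O_K[OF u'(1)] unfolding K by blast
    have y': "y' \<noteq> 0" using u'(2) xy(2) by (auto simp: Reals_of_real)
    have "of_real (y / y') * u' = of_real (y / y' * x') + of_real (y / y' * y') * s"
      unfolding xy(2) by (simp only: of_real_mult distrib_left mult.assoc)
    then have "z = of_real (x - y / y' * x') + of_real (y / y') * u'"
      using y' by (simp add: xy(1))
    then show ?thesis by blast
  qed
  moreover have "\<exists>m n :: int. z = of_int m + of_int n * u'" if z: "z \<in> \<O>" for z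
  proof -
    obtain S T where ST: "z = of_real S + of_real T * u'" using coord[OF O_K[OF z]] by blast
    define x where "x = z - (of_int (round S) + of_int (round T) * u')"
    define S' T' where "S' = S - of_int (round S)" and "T' = T - of_int (round T)"
    have xe: "x = of_real S' + of_real T' * u'"
      by (simp add: x_def S'_def T'_def ST algebra_simps)
    have xO: "x \<in> \<O>" unfolding x_def by (intro O_diff O_add O_mult z u' O_of_int)
    have S': "\<bar>S'\<bar> \<le> 1/2" "\<bar>T'\<bar> \<le> 1/2"
      using of_int_round_abs_le[of S] of_int_round_abs_le[of T] by (simp_all add: S'_def T'_def abs_minus_commute)
    have n1: "nrd u' \<ge> 1" using u' by (intro nrd_O_ge_1) auto
    have sq: "S'\<^sup>2 \<le> 1/4" "T'\<^sup>2 \<le> 1/4" "\<bar>S' * T'\<bar> \<le> 1/4"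
      using power_mono[OF S'(1), of 2] power_mono[OF S'(2), of 2] mult_mono[OF S'] by (simp_all add: abs_mult power2_eq_square)
    have "nrd x = S'\<^sup>2 + of_int t' * (S' * T') + nrd u' * T'\<^sup>2"
      unfolding xe nrd_lin u'(4) by simp
    moreover have "of_int t' * (S' * T') \<le> 1/4" using u'(3) sq(3) by auto
    moreover have "nrd u' * T'\<^sup>2 \<le> nrd u' * (1/4)" using sq(2) n1 by (intro mult_left_mono) auto
    \<comment> \<open>The rounding error has norm at most \<open>1/2 + nrd u / 4\<close>. It is
      therefore real by the choice of \<open>u\<close>, and then zero because its norm is below
      1.\<close>
    ultimately have small: "nrd x < nrd u" using sq(1) n1 u'(5) by linarith
    then have "x \<in> \<real>" using umin[OF xO] by force
    have "T' = 0"
    proof (rule ccontr)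
      assume T': "T' \<noteq> 0"
      have "of_real (inverse T') * (x - of_real S') \<in> \<real>" using \<open>x \<in> \<real>\<close> by (intro Reals_mult Reals_diff) auto
      also have "of_real (inverse T') * (x - of_real S') = u'" using T' by (simp add: xe mult.assoc[symmetric])
      finally show False using u'(2) by simp
    qed
    then have "nrd x = S'\<^sup>2" by (simp add: xe)
    then have "nrd x < 1" using sq(1) by simp
    then have "x = 0" using nrd_O_ge_1[OF xO] by force
    then show ?thesis unfolding x_def by (intro exI[of _ "round S"] exI[of _ "round T"]) simp
  qed
  ultimately show thesis using that[OF u'(1-4)] by blast
qed

lemma quadratic_hemispheres_covered:
  assumes quad: "imaginary_quadratic_field K" and eucl: "euclidean_minimum K \<O> < 1"
  shows hemispheres_covered
proof -
  obtain u and t :: int where u: "u \<in> \<O>" "u \<notin> \<real>" and t: "t = 0 \<or> t = 1" "2 * re u = of_int t"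
    and coord: "\<And>z. z \<in> K \<Longrightarrow> \<exists>S T. z = of_real S + of_real T * u"
    and int_coord: "\<And>z. z \<in> \<O> \<Longrightarrow> \<exists>m n :: int. z = of_int m + of_int n * u"
    using ex_nonreal_generator[OF quad] by blast
  define n where "n = nrd u"
  have n1: "n \<ge> 1" unfolding n_def using u by (intro nrd_O_ge_1) auto
  have nz: "n \<in> \<int>" unfolding n_def using u by (intro nrd_O)
  have unique: "S = S' \<and> T = T'" if "of_real S + of_real T * u = of_real S' + of_real T' * u" for S T S' T'
  proof -
    have "of_real (T - T') * u = of_real (S' - S)" using that by (simp add: algebra_simps)
    moreover have "u = of_real (inverse (T - T')) * (of_real (T - T') * u)" if "T \<noteq> T'"
      using that by (simp add: mult.assoc[symmetric] flip: of_real_mult of_real_diff)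
    ultimately have "T = T'" using u(2) by (metis Reals_mult Reals_of_real)
    with that show ?thesis by simp
  qed
  \<comment> \<open>Cramer's rule for the circumcentre of \<open>0\<close>, \<open>1\<close>,
    \<open>u\<close>; the two equations \<open>h\<close> express equal distance from the
    vertices.\<close>
  define h2 h1 :: real where "h2 = (2 * n - t) / (4 * n - t)" and "h1 = (1 - t * h2) / 2"
  have h: "2 * h1 + t * h2 = 1" "t * h1 + 2 * n * h2 = n"
    using t(1) n1 by (auto simp: h1_def h2_def field_simps)
  define hole where "hole = of_real h1 + of_real h2 * u"
  have re_hole: "2 * re (hole * star (of_real S + of_real T * u)) = S + T * n" for S T
  proof -
    have star: "star (of_real S + of_real T * u) = of_real S + of_real T * star u"
      by (simp add: star_add star_mult of_real_commute[of "star u"])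
    have u_comm: "of_real x * u * of_real y = of_real (x * y) * u" for x y
      by (simp add: mult.assoc of_real_commute[of u])
    have "hole * star (of_real S + of_real T * u) =
        of_real (S * h1) + of_real (S * h2) * u + of_real (T * h1) * star u + of_real (T * h2) * (u * star u)"
      unfolding hole_def star
      by (simp add: distrib_left distrib_right mult.assoc[symmetric] u_comm mult.commute flip: of_real_mult)
    then have "2 * re (hole * star (of_real S + of_real T * u)) =
        2 * (S * h1) + S * h2 * (2 * re u) + T * h1 * (2 * re u) + 2 * (T * h2 * n)"
      by (simp only: re_add re_of_real re_of_real_mult re_star of_real_nrd[symmetric] n_def distrib_left)
    also have "\<dots> = S * (2 * h1 + t * h2) + T * (t * h1 + 2 * n * h2)"
      unfolding t(2) by (simp add: algebra_simps)
    finally show ?thesis unfolding h by simp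
  qed
  have nrd_hole_diff: "nrd (hole - (of_real S + of_real T * u)) =
      nrd hole + (nrd (of_real S + of_real T * u) - S - T * n)" for S T
    unfolding nrd_diff re_hole by simp
  \<comment> \<open>The circumscribed circle contains no element of \<open>\<O>\<close> inside, so
    the circumcentre is a test point of squared distance \<open>nrd hole\<close>.\<close>
  have "nrd hole \<le> euclidean_minimum K \<O>"
  proof (rule euclidean_minimum_ge)
    have "1 \<in> span K" "u \<in> span K" using u by (auto intro!: span_base O_K)
    then show "hole \<in> span K" unfolding hole_def of_real_def mult_scaleR_left mult_1_left
      by (intro span_add span_scale)
    fix y assume "y \<in> \<O>"
    then obtain m m' :: int where y: "y = of_real (of_int m) + of_real (of_int m') * u" using int_coord by force
    have "nrd y - of_int m - of_int m' * n \<ge> 0"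
      using lattice_triangle_nonneg[OF t(1) n1, of m m'] unfolding y nrd_lin t(2) n_def by (simp add: algebra_simps)
    then show "nrd hole \<le> nrd (hole - y)" unfolding y nrd_hole_diff by simp
  qed
  \<comment> \<open>The quantity equals \<open>nrd hole\<close> minus the squared distance of
    \<open>of_real S + of_real T * u\<close> from \<open>hole\<close>.\<close>
  then have D1: "S + T * n - nrd (of_real S + of_real T * u) < 1" for S T
    using eucl nrd_nonneg[of "hole - (of_real S + of_real T * u)"] unfolding nrd_hole_diff by linarith
  \<comment> \<open>Times \<open>nrd a\<close> the quantity is an integer: \<open>nrd a * S\<close>
    and \<open>nrd a * T\<close> are the coordinates of \<open>star a * (a * z)\<close>, and
    \<open>nrd a * nrd z\<close> is \<open>nrd (a * z)\<close>. An integer below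
    \<open>nrd a\<close> is at most \<open>nrd a - 1\<close>.\<close>
  have core: "S + T * n - nrd z \<le> 1 - 1 / nrd a"
    if a: "a \<in> \<O>" "a \<noteq> 0" and z: "a * z \<in> \<O>" "z = of_real S + of_real T * u" for a z S T
  proof -
    have "star a * (a * z) = of_real (nrd a) * z" by (simp add: star_mult_self mult.assoc[symmetric])
    also have "\<dots> = of_real (nrd a * S) + of_real (nrd a * T) * u"
      by (simp add: z(2) distrib_left mult.assoc)
    finally have "of_real (nrd a * S) + of_real (nrd a * T) * u \<in> \<O>"
      using O_mult[OF O_star[OF a(1)] z(1)] by simp
    then obtain m m' :: int where
      "of_real (nrd a * S) + of_real (nrd a * T) * u = of_real (of_int m) + of_real (of_int m') * u"
      using int_coord by force
    from unique[OF this] have "nrd a * S \<in> \<int>" "nrd a * T \<in> \<int>" by auto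
    moreover have "nrd a * nrd z \<in> \<int>" using nrd_O[OF z(1)] by (simp add: nrd_mult)
    ultimately have "nrd a * S + nrd a * T * n - nrd a * nrd z \<in> \<int>"
      using nz by (blast intro: Ints_diff Ints_add Ints_mult[of "nrd a * T"])
    also have "nrd a * S + nrd a * T * n - nrd a * nrd z = nrd a * (S + T * n - nrd z)"
      by (simp add: algebra_simps)
    finally have int: "nrd a * (S + T * n - nrd z) \<in> \<int>" .
    have pos: "nrd a > 0" using a by simp
    then have "nrd a * (S + T * n - nrd z) < nrd a * 1"
      using D1[of S T] unfolding z(2) by (intro mult_strict_left_mono)
    with Ints_less_imp_le[OF int nrd_O[OF a(1)]] have "nrd a * (S + T * n - nrd z) \<le> nrd a - 1" by simp
    with pos show ?thesis by (simp add: field_simps)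
  qed
  show ?thesis
    unfolding hemispheres_covered_def
  proof (intro ballI impI)
    fix a c \<mu> assume a: "a \<in> \<O>" and c: "c \<in> \<O>" and \<mu>: "\<mu> \<in> K" and a': "a \<noteq> 0 \<and> a \<notin> order_units \<O>"
    have "- (inverse a * c) \<in> K" using a c by (intro K_minus K_mult K_inverse O_K)
    then obtain S T where ST: "- (inverse a * c) = of_real S + of_real T * u" using coord by blast
    \<comment> \<open>Translation by \<open>\<O>\<close> moves the centre of the small hemisphere
      into the fundamental parallelogram.\<close>
    define y0 where "y0 = of_int \<lfloor>S\<rfloor> + of_int \<lfloor>T\<rfloor> * u"
    have y0: "y0 \<in> \<O>" unfolding y0_def by (intro O_add O_mult u O_of_int)
    define z e where "z = - (inverse a * c) - y0" and "e = \<mu> + inverse a * c"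
    have "a * z = - c - a * y0" using a' by (simp add: z_def right_diff_distrib mult.assoc[symmetric])
    then have azO: "a * z \<in> \<O>" using a c y0 by (simp add: O_diff O_mult O_minus)
    have z: "z = of_real (frac S) + of_real (frac T) * u"
      by (simp add: z_def y0_def ST frac_def algebra_simps)
    have "\<exists>y\<in>\<O>. nrd (e + z - y) \<le> nrd e + 1 - 1 / nrd a"
    proof (cases "frac S + frac T \<le> 1")
      case True
      obtain y where y: "y \<in> {0, 1, u}" "nrd (e + z - y) \<le> nrd e + frac S + frac T * n - nrd z"
        using triangle_vertex_close[OF frac_ge_0 frac_ge_0 True z, of e] unfolding n_def by blast
      moreover have "y \<in> \<O>" using y(1) u by auto
      ultimately show ?thesis using core[OF a _ azO z] a' by force
    next
      case False
      have *: "0 \<le> 1 - frac S" "0 \<le> 1 - frac T" "1 - frac S + (1 - frac T) \<le> 1"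
        using False frac_lt_1[of S] frac_lt_1[of T] by linarith+
      \<comment> \<open>Beyond the diagonal, a point reflection exchanges the two triangles and
        turns \<open>e\<close> into \<open>- e\<close>.\<close>
      define z' where "z' = 1 + u - z"
      have z': "z' = of_real (1 - frac S) + of_real (1 - frac T) * u"
        by (simp add: z'_def z algebra_simps)
      have az': "a * z' \<in> \<O>" unfolding z'_def right_diff_distrib
        by (intro O_diff O_mult[OF a O_add[OF O_1 u(1)]] azO)
      obtain y where y: "y \<in> {0, 1, u}" "nrd (- e + z' - y) \<le> nrd (- e) + (1 - frac S) + (1 - frac T) * n - nrd z'"
        using triangle_vertex_close[OF * z', of "- e"] unfolding n_def by blast
      have "nrd (- e + z' - y) = nrd (e + z - (1 + u - y))"
        unfolding z'_def by (subst nrd_diff_commute) (simp add: algebra_simps)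
      moreover have "1 + u - y \<in> \<O>" using y(1) u by (auto intro!: O_diff O_add)
      ultimately show ?thesis using core[OF a _ az' z'] a' y(2) by force
    qed
    then obtain y where y: "y \<in> \<O>" "nrd (e + z - y) \<le> nrd e + 1 - 1 / nrd a" by blast
    have "e + z - y = \<mu> - (y0 + y)" by (simp add: e_def z_def)
    with y y0 show "\<exists>y\<in>\<O>. nrd (\<mu> - y) \<le> nrd (\<mu> + inverse a * c) + 1 - 1 / nrd a"
      unfolding e_def by (metis O_add)
  qed
qed

end

section \<open>Quaternion orders with a nontrivial unit\<close>

lemma star_if_re_0: "re x = 0 \<Longrightarrow> star x = - (x::'a::star_div_algebra)"
  by (simp add: star_conv[of x])

lemma real_if_star_eq: "star x = x \<Longrightarrow> x = of_real (re (x::'a::star_div_algebra))"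
proof -
  assume "star x = x"
  then have "2 *\<^sub>R x = 2 *\<^sub>R of_real (re x)"
    using add_star[of x] by (simp add: of_real_def scaleR_2)
  then show ?thesis by simp
qed

lemma square_pure: "re s = 0 \<Longrightarrow> s * s = - of_real (nrd (s::'a::star_div_algebra))"
  using of_real_nrd[of s] by (simp add: star_if_re_0)

text \<open>Cyclic invariance of \<open>re\<close> identifies the traces of \<open>s * w * s\<close>
  and \<open>w * s * s\<close>, which are \<open>nrd s * w\<close> and its negative.\<close>

lemma anticommuting_re_0:
  fixes s w :: "'a::star_div_algebra"
  assumes "re s = 0" "s \<noteq> 0" and anti: "w * s = - (s * w)"
  shows "re w = 0"
proof -
  have "re (s * (w * s)) = re ((w * s) * s)" by (rule re_mult_commute)
  moreover have "s * (w * s) = of_real (nrd s) * w"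
    using square_pure[OF assms(1)] by (simp add: anti mult.assoc[symmetric])
  moreover have "(w * s) * s = - (of_real (nrd s) * w)"
    using square_pure[OF assms(1)] of_real_commute[of w "nrd s"] by (simp add: mult.assoc)
  ultimately have "nrd s * re w = - (nrd s * re w)" by simp
  with assms(2) show ?thesis by (simp add: eq_neg_iff_add_eq_0 )
qed

lemma commuting_mult:
  fixes s :: "'a::ring_1"
  shows "z * s = s * z \<Longrightarrow> w * s = s * w \<Longrightarrow> (z * w) * s = s * (z * w)"
  by (simp add: mult.assoc) (simp add: mult.assoc[symmetric])

lemma anticommuting_mult:
  fixes s :: "'a::ring_1"
  shows "w * s = - (s * w) \<Longrightarrow> z * s = s * z \<Longrightarrow> (w * z) * s = - (s * (w * z))"
  by (metis mult.assoc mult_minus_left)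

lemma star_commutes_pure:
  fixes s :: "'a::star_div_algebra"
  assumes "re s = 0" "z * s = s * z"
  shows "star z * s = s * star z"
proof -
  have "star (z * s) = star (s * z)" using assms(2) by simp
  then show ?thesis by (simp add: star_mult star_if_re_0[OF assms(1)])
qed

text \<open>The pure part \<open>p\<close> of \<open>z\<close> commutes with \<open>s\<close>, so
  \<open>p * s\<close> is fixed by \<open>star\<close> and hence real. As \<open>s * s\<close> is
  real too, \<open>p\<close> is a real multiple of \<open>s\<close>.\<close>

lemma commuting_coordinates:
  fixes s z :: "'a::star_div_algebra"
  assumes s: "re s = 0" "s \<noteq> 0" and comm: "z * s = s * z"
  obtains r where "z = of_real (re z) + of_real r * s"
proof -
  define p where "p = z - of_real (re z)"
  have "re p = 0" by (simp add: p_def re_diff)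
  have "p * s = s * p" using comm of_real_commute[of s "re z"]
    by (simp add: p_def left_diff_distrib right_diff_distrib)
  then have "star (p * s) = p * s" using s \<open>re p = 0\<close> by (simp add: star_mult star_if_re_0)
  then obtain r where r: "p * s = of_real r" using real_if_star_eq by blast
  have "of_real (- nrd s) * p = p * (s * s)"
    using square_pure[OF s(1)] of_real_commute[of p] by simp
  also have "\<dots> = of_real r * s" by (simp add: r mult.assoc[symmetric])
  finally have eq: "of_real (- nrd s) * p = of_real r * s" .
  have "inverse (- nrd s) * (- nrd s) = 1" using s by simp
  then have "p = of_real (inverse (- nrd s) * (- nrd s)) * p" by (simp only: of_real_1 mult_1_left)
  also have "\<dots> = of_real (inverse (- nrd s) * r) * s"
    by (simp only: eq of_real_mult mult.assoc)
  finally have "z = of_real (re z) + of_real (inverse (- nrd s) * r) * s"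
    by (simp add: p_def diff_eq_eq add.commute)
  then show thesis using that by blast
qed

context rational_order
begin

text \<open>Infinite descent: a nonzero value of least norm would be \<open>n\<close> times another
  nonzero value.\<close>

lemma commutator_descent:
  assumes "n > 1" and "\<And>x. x \<in> \<O> \<Longrightarrow> C x \<in> \<O>"
    and "\<And>x. x \<in> \<O> \<Longrightarrow> \<exists>z\<in>\<O>. C x = of_real n * C z"
    and "x \<in> \<O>"
  shows "C x = 0"
proof (rule ccontr)
  assume "C x \<noteq> 0"
  then obtain y where y: "y \<in> \<O> \<and> C y \<noteq> 0" "\<And>z. z \<in> \<O> \<and> C z \<noteq> 0 \<Longrightarrow> nrd (C y) \<le> nrd (C z)"
    using ex_arg_min_Ints[of "\<lambda>x. x \<in> \<O> \<and> C x \<noteq> 0" x "\<lambda>x. nrd (C x)"] assms(2,4) nrd_O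
    by (metis nrd_nonneg)
  obtain z where z: "z \<in> \<O>" "C y = of_real n * C z" using assms(3) y(1) by blast
  with y(1) have "C z \<noteq> 0" by auto
  with y(2) z(1) have "nrd (C y) \<le> nrd (C z)" by blast
  moreover have "nrd (C y) = n\<^sup>2 * nrd (C z)" by (simp add: z(2) nrd_mult)
  moreover have "n\<^sup>2 > 1" using assms(1) by (simp add: one_less_power)
  ultimately show False using \<open>C z \<noteq> 0\<close> by simp
qed

text \<open>
  If the units were only \<open>1\<close> and \<open>- 1\<close>, division by \<open>l\<close> and by
  \<open>star l\<close> would give \<open>x = e + l * e' + nrd l * z\<close> with integers \<open>e\<close>,
  \<open>e'\<close>, and the commutators with \<open>l\<close>, then all commutators, would be
  infinitely divisible by \<open>nrd l\<close>.
\<close>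

lemma ex_nontrivial_unit:
  assumes eucl: "euclidean_minimum K \<O> < 1"
    and noncomm: "x0 \<in> \<O>" "y0 \<in> \<O>" "x0 * y0 \<noteq> y0 * x0"
    and l: "l \<in> \<O>" "l \<noteq> 0" "l \<notin> order_units \<O>"
      "\<And>x. x \<in> \<O> \<Longrightarrow> x \<noteq> 0 \<Longrightarrow> x \<notin> order_units \<O> \<Longrightarrow> nrd l \<le> nrd x"
  shows "\<exists>u\<in>\<O>. nrd u = 1 \<and> u \<noteq> 1 \<and> u \<noteq> - 1"
proof (rule ccontr)
  assume "\<not> ?thesis"
  then have units: "u = 1 \<or> u = - 1" if "u \<in> \<O>" "nrd u = 1" for u using that by blast
  have division: "\<exists>(e::int) z. z \<in> \<O> \<and> x = of_int e + p * z"
    if p: "p \<in> \<O>" "nrd p = nrd l" and x: "x \<in> \<O>" for p x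
  proof -
    have p0: "p \<noteq> 0" using p(2) l(2) by (metis nrd_eq_0_iff)
    obtain y where y: "y \<in> \<O>" "nrd (inverse p * x - y) \<le> euclidean_minimum K \<O>"
      using euclidean_approx[OF K_mult[OF K_inverse[OF O_K[OF p(1)]] O_K[OF x]]] by blast
    define r where "r = x - p * y"
    have r: "r \<in> \<O>" unfolding r_def by (intro O_diff O_mult p x y)
    have "r = p * (inverse p * x - y)" using p0 by (simp add: r_def right_diff_distrib mult.assoc[symmetric])
    then have "nrd r = nrd l * nrd (inverse p * x - y)" by (simp only: nrd_mult p(2))
    also have "\<dots> < nrd l * 1" using y(2) eucl l(2) by (intro mult_strict_left_mono) auto
    finally have "r = 0 \<or> nrd r = 1" using l(4)[OF r] r by (auto simp: order_units_iff)
    then have "r = 0 \<or> r = 1 \<or> r = - 1" using units[OF r] by auto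
    then have "\<exists>e::int. r = of_int e" by (metis of_int_0 of_int_1 of_int_minus)
    with y(1) show ?thesis unfolding r_def by (metis diff_add_cancel)
  qed
  have decomposition: "\<exists>(e::int) (e'::int) z. z \<in> \<O> \<and> x = of_int e + of_int e' * l + of_real (nrd l) * z"
    if x: "x \<in> \<O>" for x
  proof -
    obtain e :: int and y where y: "y \<in> \<O>" "x = of_int e + l * y" using division[OF l(1) refl x] by blast
    obtain e' :: int and z where z: "z \<in> \<O>" "y = of_int e' + star l * z"
      using division[OF O_star[OF l(1)] nrd_star y(1)] by blast
    have "l * (of_int e' + star l * z) = of_int e' * l + of_real (nrd l) * z"
      using of_real_commute[of l "of_int e'"] by (simp add: distrib_left of_real_nrd mult.assoc)
    with y(2) z show ?thesis by (metis add.assoc)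
  qed
  have int_commute: "y * of_int e = of_int e * y" for y :: 'a and e
    using of_real_commute[of y "of_int e"] by simp
  have "nrd l \<ge> 1" "nrd l \<noteq> 1" using l by (auto simp: order_units_iff intro!: nrd_O_ge_1)
  then have n: "nrd l > 1" by simp
  have central: "x * l - l * x = 0" if "x \<in> \<O>" for x
  proof (rule commutator_descent[OF n _ _ that, where C = "\<lambda>x. x * l - l * x"])
    fix x assume x: "x \<in> \<O>"
    show "x * l - l * x \<in> \<O>" by (intro O_diff O_mult x l)
    obtain e e' :: int and z where z: "z \<in> \<O>" "x = of_int e + of_int e' * l + of_real (nrd l) * z"
      using decomposition[OF x] by blast
    have "x * l - l * x = of_real (nrd l) * (z * l - l * z)"
      unfolding z(2) distrib_left distrib_right mult.assoc[symmetric] int_commute of_real_commute[of l]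
      by (simp add: right_diff_distrib mult.assoc)
    with z(1) show "\<exists>z\<in>\<O>. x * l - l * x = of_real (nrd l) * (z * l - l * z)" by blast
  qed
  have "x0 * y0 - y0 * x0 = 0"
  proof (rule commutator_descent[OF n _ _ noncomm(1), where C = "\<lambda>x. x * y0 - y0 * x"])
    fix x assume x: "x \<in> \<O>"
    show "x * y0 - y0 * x \<in> \<O>" by (intro O_diff O_mult x noncomm)
    obtain e e' :: int and z where z: "z \<in> \<O>" "x = of_int e + of_int e' * l + of_real (nrd l) * z"
      using decomposition[OF x] by blast
    \<comment> \<open>The first descent made \<open>l\<close> commute with \<open>y0\<close>;
      therefore the terms \<open>e\<close> and \<open>e' * l\<close> cancel here as well.\<close>
    have "y0 * l = l * y0" using central[OF noncomm(2)] by simp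
    then have "of_int e' * l * y0 = of_int e' * y0 * l" by (simp add: mult.assoc)
    then have "x * y0 - y0 * x = of_real (nrd l) * (z * y0 - y0 * z)"
      unfolding z(2) distrib_left distrib_right mult.assoc[symmetric] int_commute of_real_commute[of y0]
      by (simp add: right_diff_distrib mult.assoc)
    with z(1) show "\<exists>z\<in>\<O>. x * y0 - y0 * x = of_real (nrd l) * (z * y0 - y0 * z)" by blast
  qed
  with noncomm(3) show False by simp
qed

end

section \<open>Orders containing a primitive fourth or sixth root of unity\<close>

locale order_with_unit = rational_order +
  fixes u :: 'a and t :: int
  assumes u_O: "u \<in> \<O>" and nrd_u: "nrd u = 1" and t: "t = 0 \<or> t = 1" and re_u: "2 * re u = of_int t"
begin

abbreviation lin :: "real \<Rightarrow> real \<Rightarrow> 'a" where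
  "lin a b \<equiv> of_real a + of_real b * u"

definition Q :: "real \<Rightarrow> real \<Rightarrow> real" where
  "Q a b = a\<^sup>2 + of_int t * a * b + b\<^sup>2"

text \<open>A square root of the discriminant of \<open>x^2 - t * x + 1\<close>, the polynomial of
  \<open>u\<close>. Being pure, it splits the algebra into a commuting and an anticommuting
  part.\<close>

definition s :: 'a where
  "s = of_real 2 * u - of_real (of_int t)"

lemma nrd_lin_unit: "nrd (lin a b) = Q a b"
  unfolding nrd_lin re_u nrd_u by (simp add: Q_def)

lemma re_s: "re s = 0"
  unfolding s_def re_diff re_of_real_mult re_of_real using re_u by simp

lemma t_square: "(of_int t :: real) * of_int t = of_int t"
  using t by auto

lemma nrd_s: "nrd s = 4 - of_int t"
proof -
  have "s = lin (- of_int t) 2" by (simp add: s_def)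
  then have "nrd s = Q (- of_int t) 2" by (simp only: nrd_lin_unit)
  then show ?thesis unfolding Q_def using t_square by (simp add: power2_eq_square)
qed

lemma s_nonzero: "s \<noteq> 0"
  using nrd_s t by force

lemma star_u: "star u = of_real (of_int t) - u"
  by (simp only: star_conv[of u] re_u)

lemma u_square: "u * u = of_int t *\<^sub>R u - 1"
proof -
  have "u * star u = 1" using of_real_nrd[of u] nrd_u by simp
  then have "of_int t *\<^sub>R u - u * u = 1"
    unfolding star_u right_diff_distrib of_real_def by simp
  then show ?thesis by (simp add: algebra_simps)
qed

lemma commutes_s: "x * u - u * x = (1/2) *\<^sub>R (x * s - s * x)"
  unfolding s_def of_real_def by (simp add: algebra_simps)

lemma lin_commutes: "lin a b * s = s * lin a b"
  unfolding s_def of_real_def by (simp add: algebra_simps)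

lemma commuting_lin:
  assumes "z * s = s * z"
  obtains a b where "z = lin a b"
proof -
  obtain r where r: "z = of_real (re z) + of_real r * s"
    using commuting_coordinates[OF re_s s_nonzero assms] by blast
  have "z = lin (re z - r * of_int t) (r * 2)"
    by (subst r) (simp add: s_def right_diff_distrib mult.assoc)
  then show thesis by (rule that)
qed

lemma lin_mult: "lin a b * lin c d = lin (a * c - b * d) (a * d + b * c + of_int t * b * d)"
  unfolding of_real_def by (simp add: u_square algebra_simps)

lemma lin_K: "a \<in> \<rat> \<Longrightarrow> b \<in> \<rat> \<Longrightarrow> lin a b \<in> K"
  by (intro K_add K_of_real K_scale O_K u_O)

lemma lin_O: "a \<in> \<int> \<Longrightarrow> b \<in> \<int> \<Longrightarrow> lin a b \<in> \<O>"
  by (intro O_add O_mult O_of_real u_O)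

text \<open>Otherwise both elements would centralise \<open>u\<close>, and its centraliser is the
  commutative plane spanned by \<open>1\<close> and \<open>u\<close>.\<close>

lemma noncentral:
  assumes "x0 \<in> \<O>" "y0 \<in> \<O>" "x0 * y0 \<noteq> y0 * x0"
  obtains x where "x \<in> \<O>" "x * u - u * x \<noteq> 0"
proof (rule ccontr)
  assume "\<not> thesis"
  then have "x0 * u - u * x0 = 0" "y0 * u - u * y0 = 0" using that assms by blast+
  then have "x0 * s = s * x0" "y0 * s = s * y0" unfolding commutes_s by simp_all
  then obtain a b c d where "x0 = lin a b" "y0 = lin c d" by (metis commuting_lin)
  then have "x0 * y0 = y0 * x0" by (simp only: lin_mult) (simp add: ac_simps)
  with assms(3) show False by simp
qed

text \<open>The squared covering radius of the Gaussian and of the Eisenstein integers.\<close>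

definition \<rho> :: real where "\<rho> = (if t = 0 then 1/2 else 1/3)"

lemma lin_approx: "\<exists>m n :: int. Q (a - of_int m) (b - of_int n) \<le> \<rho>"
proof (cases "t = 0")
  case True
  have "\<bar>a - of_int (round a)\<bar> \<le> 1/2" "\<bar>b - of_int (round b)\<bar> \<le> 1/2"
    using of_int_round_abs_le[of a] of_int_round_abs_le[of b] by (simp_all add: abs_minus_commute)
  from power_mono[OF this(1), of 2] power_mono[OF this(2), of 2]
  have "Q (a - of_int (round a)) (b - of_int (round b)) \<le> \<rho>"
    unfolding Q_def \<rho>_def using True by (simp add: power2_eq_square)
  then show ?thesis by blast
next
  case False
  with t have t1: "t = 1" by simp
  have D: "S + T - Q S T \<le> 1/3" for S T
  proof -
    have "Q S T = S * S + S * T + T * T" unfolding Q_def by (simp add: t1 power2_eq_square)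
    moreover have "0 \<le> (S + T - 2/3) * (S + T - 2/3)" "0 \<le> (S - T) * (S - T)" by simp_all
    ultimately show ?thesis by (simp add: algebra_simps)
  qed
  have triangle: "\<exists>m n :: int. Q (S - of_int m) (T - of_int n) \<le> 1/3" if ST: "0 \<le> S" "0 \<le> T" "S + T \<le> 1" for S T
  proof -
    obtain y where y: "y \<in> {0, 1, u}" "nrd (0 + lin S T - y) \<le> nrd (0::'a) + S + T * nrd u - nrd (lin S T)"
      using triangle_vertex_close[OF ST refl, of u 0] by (rule bexE)
    from y(2) have y2: "nrd (lin S T - y) \<le> S + T - Q S T"
      unfolding nrd_lin_unit nrd_u by simp
    from y(1)
    have "\<exists>m n :: int. lin S T - y = lin (S - of_int m) (T - of_int n)"
    proof (elim insertE)
      assume "y = 0" then show ?thesis by (intro exI[of _ 0]) simp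
    next
      assume "y = 1" then show ?thesis by (intro exI[of _ 1] exI[of _ 0]) simp
    next
      assume "y = u" then show ?thesis by (intro exI[of _ 0] exI[of _ 1]) (simp add: left_diff_distrib)
    qed simp
    with y2 D[of S T] show ?thesis by (metis nrd_lin_unit order_trans)
  qed
  have "\<exists>m n :: int. Q (frac a - of_int m) (frac b - of_int n) \<le> 1/3"
  proof (cases "frac a + frac b \<le> 1")
    case False
    \<comment> \<open>The other half of the parallelogram is a point reflection of the
      triangle.\<close>
    then obtain m n :: int where mn: "Q (1 - frac a - of_int m) (1 - frac b - of_int n) \<le> 1/3"
      using triangle[of "1 - frac a" "1 - frac b"] frac_lt_1[of a] frac_lt_1[of b] by auto
    have "Q (- x) (- y) = Q x y" for x y by (simp add: Q_def)
    from this[of "1 - frac a - of_int m" "1 - frac b - of_int n"] mn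
    have "Q (frac a - of_int (1 - m)) (frac b - of_int (1 - n)) \<le> 1/3" by (simp add: algebra_simps)
    then show ?thesis by blast
  qed (use triangle frac_ge_0 in auto)
  then obtain m n :: int where "Q (frac a - of_int m) (frac b - of_int n) \<le> 1/3" by blast
  then have "Q (a - of_int (\<lfloor>a\<rfloor> + m)) (b - of_int (\<lfloor>b\<rfloor> + n)) \<le> \<rho>"
    unfolding \<rho>_def using False by (simp add: frac_def algebra_simps)
  then show ?thesis by blast
qed

text \<open>The part of \<open>x\<close> anticommuting with \<open>s\<close>, namely half of
  \<open>x - s * x * inverse s\<close>.\<close>

definition proj :: "'a \<Rightarrow> 'a" where
  "proj x = (1/2) *\<^sub>R (x + (1 / nrd s) *\<^sub>R (s * x * s))"

lemma s_square: "s * s = - nrd s *\<^sub>R 1"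
  using square_pure[OF re_s] by (simp add: of_real_def)

lemma s_s_mult: "s * (s * x) = - nrd s *\<^sub>R x"
  by (simp add: mult.assoc[symmetric] s_square)

lemma proj_mult_s: "proj x * s = (1/2) *\<^sub>R (x * s - s * x)"
  unfolding proj_def using s_nonzero by (simp add: s_square algebra_simps)

lemma s_mult_proj: "s * proj x = (1/2) *\<^sub>R (s * x - x * s)"
  unfolding proj_def using s_nonzero by (simp add: s_s_mult algebra_simps)

lemma proj_anticommutes: "proj x * s = - (s * proj x)"
  unfolding proj_mult_s s_mult_proj by (simp add: algebra_simps)

text \<open>\<open>proj x\<close> may leave the order, but the commutator stays in it. Its norm is
  thus an integer, which allows minimal choices of the projection.\<close>

lemma commutator_eq: "x * u - u * x = proj x * s"
  unfolding commutes_s proj_mult_s ..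

lemma diff_proj_commutes: "(x - proj x) * s = s * (x - proj x)"
proof -
  have "x * s - s * x = (1/2) *\<^sub>R (x * s - s * x) - (1/2) *\<^sub>R (s * x - x * s)"
    by (simp add: algebra_simps flip: scaleR_add_left)
  then show ?thesis
    unfolding left_diff_distrib right_diff_distrib proj_mult_s s_mult_proj by (simp add: algebra_simps)
qed

lemma proj_diff: "proj (x - y) = proj x - proj y"
  by (simp add: proj_def algebra_simps)

lemma proj_mult: "z * s = s * z \<Longrightarrow> proj (z * x) = z * proj x"
proof -
  assume z: "z * s = s * z"
  have "s * (z * x) * s = z * (s * x * s)" by (simp add: z mult.assoc[symmetric])
  then show ?thesis unfolding proj_def by (simp add: distrib_left)
qed

lemmas star_commutes = star_commutes_pure[OF re_s]

text \<open>Two sign changes cancel, so the quotient of \<open>x\<close> and \<open>J\<close>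
  centralises \<open>s\<close>.\<close>

lemma anticommuting_quotient:
  assumes "x * s = - (s * x)" "J * s = - (s * J)" "J \<noteq> 0"
  obtains e f where "x = lin e f * J"
proof -
  have "inverse J * (J * s) * inverse J = - (inverse J * (s * J) * inverse J)"
    by (simp add: assms(2))
  then have J: "s * inverse J = - (inverse J * s)"
    using assms(3) by (simp add: mult.assoc) (simp add: mult.assoc[symmetric])
  have "(x * inverse J) * s = s * (x * inverse J)"
  proof -
    have "(x * inverse J) * s = - (x * (s * inverse J))" by (simp add: J mult.assoc)
    also have "\<dots> = s * (x * inverse J)" using assms(1) by (simp add: mult.assoc[symmetric])
    finally show ?thesis .
  qed
  then obtain e f where "x * inverse J = lin e f" by (rule commuting_lin)
  then have "x = lin e f * J" using assms(3) by (metis mult.assoc left_inverse mult.right_neutral)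
  then show thesis by (rule that)
qed

lemma \<rho>_bounds: "0 < \<rho>" "\<rho> < 1"
  by (simp_all add: \<rho>_def)

lemma diff_lin: "lin c d - lin c' d' = lin (c - c') (d - d')"
  by (simp add: left_diff_distrib)

end

section \<open>The order as a module over \<open>\<int>[u]\<close> with generators \<open>1\<close>
  and \<open>lin a b + J\<close>\<close>

locale order_split = order_with_unit +
  fixes J :: 'a and a b :: real
  assumes J_anti: "J * s = - (s * J)" and J_nonzero: "J \<noteq> 0"
    and w_O: "lin a b + J \<in> \<O>"
    and generated: "x \<in> \<O> \<Longrightarrow> \<exists>m n m' n' :: int.
      x = lin (of_int m) (of_int n) + lin (of_int m') (of_int n') * (lin a b + J)"
begin

definition \<beta> :: real where "\<beta> = nrd J"

lemma re_J: "re J = 0"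
  by (rule anticommuting_re_0[OF re_s s_nonzero J_anti])

lemma re_J_mult: "z * s = s * z \<Longrightarrow> re (J * z) = 0"
  by (rule anticommuting_re_0[OF re_s s_nonzero anticommuting_mult[OF J_anti]])

text \<open>The two summands are orthogonal, because elements anticommuting with \<open>s\<close>
  have no real part.\<close>

lemma nrd_pair: "nrd (lin c d + lin e f * J) = Q c d + Q e f * \<beta>"
proof -
  have "(star (lin e f) * lin c d) * s = s * (star (lin e f) * lin c d)"
    by (rule commuting_mult[OF star_commutes[OF lin_commutes] lin_commutes])
  then have "re (J * (star (lin e f) * lin c d)) = 0" by (rule re_J_mult)
  moreover have "re (lin c d * star (lin e f * J)) = re (star (lin e f * J) * lin c d)"
    by (rule re_mult_commute)
  moreover have "star (lin e f * J) * lin c d = - (J * (star (lin e f) * lin c d))"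
    unfolding star_mult star_if_re_0[OF re_J] by (simp only: mult_minus_left mult.assoc)
  ultimately have "re (lin c d * star (lin e f * J)) = 0" by (simp only: re_simps(3))
  then show ?thesis unfolding nrd_add[of "lin c d"] nrd_mult[of "lin e f"] nrd_lin_unit \<beta>_def by simp
qed

lemma pair_mult: "lin m n * (lin a b + J) = lin (m * a - n * b) (m * b + n * a + of_int t * n * b) + lin m n * J"
  unfolding distrib_left[of "lin m n"] lin_mult ..

lemma pair_O: "lin (of_int m) (of_int n) + lin (of_int m') (of_int n') * (lin a b + J) \<in> \<O>"
  by (intro O_add[OF lin_O O_mult[OF lin_O w_O]]) auto

lemma pair_diff:
  "lin c d + lin e f * J - (lin m n + lin m' n' * (lin a b + J)) =
    lin (c - m - (m' * a - n' * b)) (d - n - (m' * b + n' * a + of_int t * n' * b)) + lin (e - m') (f - n') * J"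
proof -
  have 1: "lin (e - m') (f - n') * J = lin e f * J - lin m' n' * J"
    by (simp only: diff_lin[symmetric] left_diff_distrib)
  have 2: "lin (c - m - x) (d - n - y) = lin c d - lin m n - lin x y" for x y
    by (simp only: diff_lin)
  have 3: "A + B - (C + (D + E)) = A - C - D + (B - E)" for A B C D E :: 'a
    by (simp add: algebra_simps)
  show ?thesis unfolding 1 2 pair_mult 3 ..
qed

text \<open>The traces of \<open>lin a b + J\<close> and of its product with \<open>star u\<close>,
  and its norm. The trace conditions put \<open>lin a b\<close> into the trace dual of
  \<open>\<int>[u]\<close>; \<open>J\<close> contributes to neither.\<close>

lemma integrality: "2 * a + of_int t * b \<in> \<int>" "of_int t * a + 2 * b \<in> \<int>" "Q a b + \<beta> \<in> \<int>"
proof -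
  have "2 * re (lin a b + J) = 2 * a + of_int t * b"
    unfolding re_add re_J re_of_real re_of_real_mult re_u[symmetric] by simp
  with trace_O[OF w_O] show "2 * a + of_int t * b \<in> \<int>" by simp
  have "u * s = s * u" using lin_commutes[of 0 1] by simp
  then have "re (J * star u) = 0" by (intro re_J_mult star_commutes)
  moreover have "re (lin a b * star u) = a * re u + b"
  proof -
    have "lin a b * star u = of_real a * star u + of_real b * (u * star u)"
      by (simp only: distrib_right mult.assoc)
    also have "u * star u = 1" using of_real_nrd[of u] nrd_u by simp
    finally show ?thesis by (simp only: re_add re_of_real_mult re_star mult_1_right re_of_real)
  qed
  ultimately have "2 * re ((lin a b + J) * star u) = of_int t * a + 2 * b"
    unfolding distrib_right[of "lin a b"] re_add[of "lin a b * star u"] using re_u by (simp add: algebra_simps)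
  with trace_O[OF O_mult[OF w_O O_star[OF u_O]]] show "of_int t * a + 2 * b \<in> \<int>" by simp
  have "lin a b + J = lin a b + lin 1 0 * J" by simp
  then have "nrd (lin a b + J) = Q a b + Q 1 0 * \<beta>" by (simp only: nrd_pair)
  also have "Q 1 0 = 1" unfolding Q_def by simp
  finally show "Q a b + \<beta> \<in> \<int>" using nrd_O[OF w_O] by simp
qed

lemma \<beta>_pos: "\<beta> > 0"
  by (simp add: \<beta>_def J_nonzero)

text \<open>Cramer's rule for the two integral linear forms, of determinant
  \<open>4 - t\<close>.\<close>

lemma ab_rational: "a \<in> \<rat>" "b \<in> \<rat>"
proof -
  have Z: "2 * a + of_int t * b \<in> \<rat>" "of_int t * a + 2 * b \<in> \<rat>"
    using integrality(1,2) Ints_subset_Rats by blast+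
  have 1: "2 * (2 * a + of_int t * b) - of_int t * (of_int t * a + 2 * b) = (4 - of_int t) * a"
    "2 * (of_int t * a + 2 * b) - of_int t * (2 * a + of_int t * b) = (4 - of_int t) * b"
    using t_square by (simp_all add: algebra_simps)
  have "(4 - of_int t) * a \<in> \<rat>" "(4 - of_int t) * b \<in> \<rat>"
    unfolding 1[symmetric]
    by (intro Rats_diff Rats_mult[OF Rats_number_of] Rats_mult[OF Rats_of_int] Z)+
  moreover have "(4 - of_int t :: real) \<in> \<rat>" by simp
  ultimately have "(4 - of_int t) * a / (4 - of_int t) \<in> \<rat>" "(4 - of_int t) * b / (4 - of_int t) \<in> \<rat>"
    by - (rule Rats_divide; assumption)+
  moreover have "(4 - of_int t :: real) \<noteq> 0" using t by auto
  ultimately show "a \<in> \<rat>" "b \<in> \<rat>" by simp_all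
qed

lemma J_K: "J \<in> K"
  using K_diff[OF O_K[OF w_O] lin_K[OF ab_rational]] by simp

text \<open>Orthogonality separates the test point into two planar ones, so a hole for the cosets
  met by the first coordinates combines with a hole of \<open>\<int>[u]\<close> for the
  second.\<close>

lemma covering_lower_bound:
  assumes "\<And>m n m' n' :: int. C \<le> Q (c - of_int m - (of_int m' * a - of_int n' * b))
      (d - of_int n - (of_int m' * b + of_int n' * a + of_int t * of_int n' * b))
    + Q (e - of_int m') (f - of_int n') * \<beta>"
  shows "C \<le> euclidean_minimum K \<O>"
proof (rule euclidean_minimum_ge)
  have "lin c d + lin e f * J = c *\<^sub>R 1 + d *\<^sub>R u + (e *\<^sub>R J + f *\<^sub>R (u * J))"
    by (simp add: of_real_def distrib_right)
  also have "\<dots> \<in> span K"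
    by (intro span_add span_scale span_base K_1 K_mult J_K O_K[OF u_O])
  finally show "lin c d + lin e f * J \<in> span K" .
  fix y assume "y \<in> \<O>"
  then obtain m n m' n' :: int where
    y: "y = lin (of_int m) (of_int n) + lin (of_int m') (of_int n') * (lin a b + J)"
    using generated by blast
  show "C \<le> nrd (lin c d + lin e f * J - y)" unfolding y pair_diff nrd_pair by (rule assms)
qed

lemma ex_coordinates: "\<exists>c d e f. x = lin c d + lin e f * J"
proof -
  obtain c d where "x - proj x = lin c d" using commuting_lin[OF diff_proj_commutes] by metis
  moreover obtain e f where "proj x = lin e f * J"
    using anticommuting_quotient[OF proj_anticommutes J_anti J_nonzero] by metis
  ultimately have "x = lin c d + lin e f * J" by (metis diff_add_cancel)
  then show ?thesis by blast
qed

text \<open>The coefficient of \<open>J\<close> is rounded first, because this choice shifts the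
  other coordinates by a multiple of \<open>lin a b\<close>; rounding those afterwards absorbs the
  shift.\<close>

lemma covering_upper_bound: "euclidean_minimum K \<O> \<le> \<rho> + \<rho> * \<beta>"
proof (rule euclidean_minimum_le)
  fix x
  obtain c d e f where x: "x = lin c d + lin e f * J" using ex_coordinates by blast
  obtain m' n' :: int where 1: "Q (e - of_int m') (f - of_int n') \<le> \<rho>" using lin_approx by blast
  let ?g = "of_int m' * a - of_int n' * b" and ?h = "of_int m' * b + of_int n' * a + of_int t * of_int n' * b"
  obtain m n :: int where "Q (c - ?g - of_int m) (d - ?h - of_int n) \<le> \<rho>" using lin_approx by blast
  then have "Q (c - of_int m - ?g) (d - of_int n - ?h) \<le> \<rho>" by (simp add: algebra_simps)
  with 1 \<beta>_pos have "nrd (x - (lin (of_int m) (of_int n) + lin (of_int m') (of_int n') * (lin a b + J))) \<le> \<rho> + \<rho> * \<beta>"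
    unfolding x pair_diff nrd_pair by (intro add_mono mult_right_mono) auto
  then show "\<exists>y\<in>\<O>. nrd (x - y) \<le> \<rho> + \<rho> * \<beta>" using pair_O by blast
qed

lemma ex_rational_coordinates:
  assumes "x \<in> K"
  shows "\<exists>c\<in>\<rat>. \<exists>d\<in>\<rat>. \<exists>e\<in>\<rat>. \<exists>f\<in>\<rat>. x = lin c d + lin e f * J"
proof -
  have scale: "r *\<^sub>R (lin c d + lin e f * J) = lin (r * c) (r * d) + lin (r * e) (r * f) * J" for r c d e f
    unfolding of_real_def by (simp add: algebra_simps)
  obtain n :: nat where n: "n > 0" "of_nat n * x \<in> \<O>" using denominator[OF assms] by blast
  obtain i j i' j' :: int where
    "of_nat n * x = lin (of_int i) (of_int j) + lin (of_int i') (of_int j') * (lin a b + J)"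
    using generated[OF n(2)] by blast
  also have "\<dots> = lin (of_int i + (of_int i' * a - of_int j' * b))
      (of_int j + (of_int i' * b + of_int j' * a + of_int t * of_int j' * b)) + lin (of_int i') (of_int j') * J"
    (is "_ = lin ?c ?d + lin ?e ?f * J")
    unfolding pair_mult by (simp add: algebra_simps)
  finally have "real n *\<^sub>R x = lin ?c ?d + lin ?e ?f * J" by (simp add: scaleR_conv_of_real)
  then have "inverse (real n) *\<^sub>R real n *\<^sub>R x = inverse (real n) *\<^sub>R (lin ?c ?d + lin ?e ?f * J)" by simp
  also have "\<dots> = lin (inverse (real n) * ?c) (inverse (real n) * ?d) + lin (inverse (real n) * ?e) (inverse (real n) * ?f) * J"
    by (rule scale)
  finally have "x = lin (inverse (real n) * ?c) (inverse (real n) * ?d) + lin (inverse (real n) * ?e) (inverse (real n) * ?f) * J"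
    using n(1) by simp
  moreover have "inverse (real n) * ?c \<in> \<rat>" "inverse (real n) * ?d \<in> \<rat>" "inverse (real n) * ?e \<in> \<rat>" "inverse (real n) * ?f \<in> \<rat>"
    by (intro Rats_mult Rats_add Rats_diff Rats_inverse Rats_of_nat Rats_of_int ab_rational)+
  ultimately show ?thesis by blast
qed

end

context order_with_unit
begin

text \<open>\<open>w\<close> is chosen with least nonzero commutator with \<open>u\<close>. Because
  \<open>\<rho> < 1\<close>, division with remainder in \<open>\<int>[u]\<close> shows that
  \<open>proj w\<close> generates the projection of the whole order.\<close>

lemma ex_order_split:
  assumes "x0 \<in> \<O>" "y0 \<in> \<O>" "x0 * y0 \<noteq> y0 * x0"
  shows "\<exists>J a b. order_split K \<O> u t J a b"
proof -
  let ?C = "\<lambda>x. x * u - u * x"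
  obtain x where x: "x \<in> \<O>" "?C x \<noteq> 0" using noncentral[OF assms] by blast
  have "nrd (?C x) \<in> \<int> \<and> nrd (?C x) \<ge> 0" if "x \<in> \<O> \<and> ?C x \<noteq> 0" for x
    using that u_O by (intro conjI nrd_O O_diff O_mult) auto
  then obtain w where w: "w \<in> \<O>" "?C w \<noteq> 0" and min: "\<And>y. y \<in> \<O> \<Longrightarrow> ?C y \<noteq> 0 \<Longrightarrow> nrd (?C w) \<le> nrd (?C y)"
    using ex_arg_min_Ints[of "\<lambda>x. x \<in> \<O> \<and> ?C x \<noteq> 0" x "\<lambda>x. nrd (?C x)"] x by metis
  define J where "J = proj w"
  have J0: "J \<noteq> 0" using w(2) unfolding commutator_eq J_def by auto
  have J: "J * s = - (s * J)" unfolding J_def by (rule proj_anticommutes)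
  obtain a b where ab: "w - J = lin a b" unfolding J_def using commuting_lin[OF diff_proj_commutes] by metis
  then have we: "w = lin a b + J" by (metis diff_add_cancel)
  have "\<exists>m n m' n' :: int. x = lin (of_int m) (of_int n) + lin (of_int m') (of_int n') * (lin a b + J)"
    if x: "x \<in> \<O>" for x
  proof -
    obtain e f where ef: "proj x = lin e f * J"
      using anticommuting_quotient[OF proj_anticommutes J J0] by metis
    obtain m' n' :: int where mn': "Q (e - of_int m') (f - of_int n') \<le> \<rho>" using lin_approx by blast
    define y where "y = x - lin (of_int m') (of_int n') * w"
    have y: "y \<in> \<O>" unfolding y_def by (intro O_diff O_mult lin_O x w) auto
    have "proj y = lin (e - of_int m') (f - of_int n') * J"
      unfolding y_def proj_diff proj_mult[OF lin_commutes] ef J_def[symmetric] diff_lin[symmetric]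
      by (simp only: left_diff_distrib)
    then have "nrd (?C y) = Q (e - of_int m') (f - of_int n') * (nrd J * nrd s)"
      unfolding commutator_eq nrd_mult by (simp only: nrd_mult nrd_lin_unit mult.assoc)
    also have "\<dots> \<le> \<rho> * (nrd J * nrd s)" using mn' by (intro mult_right_mono) auto
    also have "\<dots> < 1 * (nrd J * nrd s)"
      using \<rho>_bounds J0 s_nonzero by (intro mult_strict_right_mono) auto
    also have "\<dots> = nrd (?C w)" unfolding commutator_eq nrd_mult J_def by simp
    finally have "?C y = 0" using min[OF y] by force
    then have "proj y = 0" using s_nonzero unfolding commutator_eq by simp
    then have "y * s = s * y" using diff_proj_commutes[of y] by simp
    then obtain c d where cd: "y = lin c d" by (rule commuting_lin)
    \<comment> \<open>What remains commutes with \<open>s\<close>; it differs from an element of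
      \<open>\<int>[u]\<close> by an order element of norm below 1, that is, by zero.\<close>
    obtain m n :: int where mn: "Q (c - of_int m) (d - of_int n) \<le> \<rho>" using lin_approx by blast
    have "nrd (y - lin (of_int m) (of_int n)) < 1"
      unfolding cd diff_lin nrd_lin_unit using mn \<rho>_bounds(2) by simp
    moreover have "y - lin (of_int m) (of_int n) \<in> \<O>" by (intro O_diff y lin_O) auto
    ultimately have "y - lin (of_int m) (of_int n) = 0" using nrd_O_ge_1 by force
    then have "x = lin (of_int m) (of_int n) + lin (of_int m') (of_int n') * w"
      unfolding y_def by (simp add: algebra_simps)
    then show ?thesis unfolding we by blast
  qed
  then have "order_split K \<O> u t J a b"
    using J J0 w(1) unfolding we by unfold_locales auto
  then show ?thesis by blast
qed

end

section \<open>Small covering radius or \<open>(-2, -5)\<close>\<close>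

lemma half_minus_int_square: "1/4 \<le> (1/2 - of_int z :: real)\<^sup>2"
proof -
  have "1 \<le> \<bar>1 - 2 * z\<bar>" by presburger
  then have "1 \<le> (1 - 2 * z)\<^sup>2" by (metis one_le_power power2_abs)
  then have "1 \<le> (real_of_int (1 - 2 * z))\<^sup>2" by (metis of_int_1 of_int_le_iff of_int_power)
  then show ?thesis by (simp add: power2_eq_square algebra_simps)
qed

lemma hexagonal_form_pos:
  fixes x y :: int
  assumes "x \<noteq> 0 \<or> y \<noteq> 0"
  shows "1 \<le> x\<^sup>2 + x * y + y\<^sup>2"
proof -
  have "4 * (x\<^sup>2 + x * y + y\<^sup>2) = (2 * x + y)\<^sup>2 + 3 * y\<^sup>2"
    by (simp add: power2_eq_square algebra_simps)
  moreover have "(2 * x + y)\<^sup>2 + 3 * y\<^sup>2 > 0"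
    using assms by (cases "y = 0") (auto simp: add_nonneg_pos)
  ultimately have "0 < 4 * (x\<^sup>2 + x * y + y\<^sup>2)" by (simp only:)
  then have "0 < x\<^sup>2 + x * y + y\<^sup>2" by (rule zero_less_mult_pos) simp
  then show ?thesis by (simp only: int_one_le_iff_zero_less)
qed

context order_split
begin

text \<open>\<open>v\<close> is a primitive sixth root of unity. The parities of
  \<open>2 * a\<close> and \<open>2 * b\<close> fix \<open>\<beta>\<close> modulo 1. Either
  \<open>\<beta>\<close> is so small that a translate of \<open>J\<close> is a unit yielding
  \<open>v\<close>, or holes of the planar lattices force \<open>M \<ge> 1\<close>; for two even
  numbers only the latter occurs.\<close>

lemma ex_order_3_unit:
  assumes t0: "t = 0" and eucl: "euclidean_minimum K \<O> < 1"
  shows "\<exists>v\<in>\<O>. nrd v = 1 \<and> 2 * re v = 1"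
proof -
  have Q: "Q x y = x\<^sup>2 + y\<^sup>2" for x y unfolding Q_def using t0 by simp
  obtain p where p: "2 * a = of_int p" using integrality(1) t0 by (auto elim: Ints_cases)
  obtain q where q: "2 * b = of_int q" using integrality(2) t0 by (auto elim: Ints_cases)
  obtain k where k: "a\<^sup>2 + b\<^sup>2 + \<beta> = of_int k" using integrality(3) unfolding Q by (auto elim: Ints_cases)
  have re_u0: "re u = 0" using re_u t0 by simp
  have shift: "lin (a - of_int i) (b - of_int j) + J \<in> \<O>"
    "nrd (lin (a - of_int i) (b - of_int j) + J) = (a - of_int i)\<^sup>2 + (b - of_int j)\<^sup>2 + \<beta>"
    "re (lin (a - of_int i) (b - of_int j) + J) = a - of_int i" for i j
  proof -
    have "lin (a - of_int i) (b - of_int j) + J = lin a b + J - lin (of_int i) (of_int j)"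
      by (simp add: algebra_simps)
    also have "\<dots> \<in> \<O>" by (intro O_diff[OF w_O lin_O]) auto
    finally show "lin (a - of_int i) (b - of_int j) + J \<in> \<O>" .
    show "nrd (lin (a - of_int i) (b - of_int j) + J) = (a - of_int i)\<^sup>2 + (b - of_int j)\<^sup>2 + \<beta>"
      using nrd_pair[of "a - of_int i" "b - of_int j" 1 0] by (simp add: Q)
    show "re (lin (a - of_int i) (b - of_int j) + J) = a - of_int i"
      unfolding re_add re_J re_of_real re_of_real_mult re_u0 by simp
  qed
  have half: "1/2 \<le> Q (1/2 - of_int x) (1/2 - of_int y)" for x y
    using half_minus_int_square[of x] half_minus_int_square[of y] unfolding Q by linarith
  show ?thesis
  proof (cases "even p"; cases "even q")
    assume "even p" "even q"
    then obtain p' q' where "p = 2 * p'" "q = 2 * q'" by (elim evenE) blast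
    then have ab: "a = of_int p'" "b = of_int q'" using p q by simp_all
    then have "\<beta> = of_int (k - p'\<^sup>2 - q'\<^sup>2)" using k by simp
    then have \<beta>: "\<beta> \<ge> 1" using \<beta>_pos by (smt (verit) of_int_1_le_iff of_int_0_less_iff)
    \<comment> \<open>The hole \<open>(1 + u) / 2\<close> of \<open>\<int>[u]\<close> in both
      components contributes 1/2 twice.\<close>
    have "1 \<le> euclidean_minimum K \<O>"
    proof (rule covering_lower_bound[of _ "1/2" "1/2" "1/2" "1/2"])
      fix m n m' n' :: int
      have "1/2 \<le> Q (1/2 - of_int (m + (m' * p' - n' * q'))) (1/2 - of_int (n + (m' * q' + n' * p')))"
        by (rule half)
      moreover have "1/2 * 1 \<le> Q (1/2 - of_int m') (1/2 - of_int n') * \<beta>"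
        using half[of m' n'] \<beta> by (intro mult_mono) auto
      ultimately show "1 \<le> Q (1/2 - of_int m - (of_int m' * a - of_int n' * b))
          (1/2 - of_int n - (of_int m' * b + of_int n' * a + of_int t * of_int n' * b))
          + Q (1/2 - of_int m') (1/2 - of_int n') * \<beta>"
        unfolding ab using t0 by (simp add: algebra_simps)
    qed
    with eucl show ?thesis by simp
  next
    assume "odd p" "odd q"
    then obtain p' q' where "p = 2 * p' + 1" "q = 2 * q' + 1" by (elim oddE) blast
    then have ab: "a = of_int p' + 1/2" "b = of_int q' + 1/2" using p q by simp_all
    then have \<beta>_eq: "\<beta> = of_int (k - p'\<^sup>2 - q'\<^sup>2 - p' - q') - 1/2"
      using k by (simp add: power2_eq_square algebra_simps)
    show ?thesis
    proof (cases "k - p'\<^sup>2 - q'\<^sup>2 - p' - q' = 1")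
      case True
      \<comment> \<open>The shifted generator is \<open>(1 + u) / 2 + J\<close>, of norm
        \<open>1/2 + 1/2\<close> and trace 1.\<close>
      then have "\<beta> = 1/2" using \<beta>_eq by simp
      with shift[of p' q'] show ?thesis by (intro bexI[OF _ shift(1)[of p' q']]) (simp add: ab power2_eq_square)
    next
      case False
      have "k - p'\<^sup>2 - q'\<^sup>2 - p' - q' \<ge> 1" using \<beta>_pos \<beta>_eq by linarith
      with False have "real_of_int (k - p'\<^sup>2 - q'\<^sup>2 - p' - q') \<ge> 2" by linarith
      then have \<beta>: "\<beta> \<ge> 3/2" using \<beta>_eq by linarith
      \<comment> \<open>The shifts now fill the finer square lattice of points
        \<open>(x + y * u) / 2\<close> with \<open>x + y\<close> even. Its hole \<open>1/2\<close>
        has squared radius 1/4, and \<open>1/4 + 3/4 = 1\<close>.\<close>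
      have "1 \<le> euclidean_minimum K \<O>"
      proof (rule covering_lower_bound[of _ "1/2" 0 "1/2" "1/2"])
        fix m n m' n' :: int
        define X Y where "X = 1 - 2 * m - (m' * p - n' * q)" and "Y = - 2 * n - (m' * q + n' * p)"
        have "odd (X + Y)" unfolding X_def Y_def using \<open>odd p\<close> \<open>odd q\<close> by simp
        then have "X \<noteq> 0 \<or> Y \<noteq> 0" by auto
        then have "1 \<le> X\<^sup>2 + Y\<^sup>2" by (smt (verit) zero_less_power2 zero_le_power2)
        then have "1 \<le> (real_of_int X)\<^sup>2 + (real_of_int Y)\<^sup>2" by (metis of_int_1_le_iff of_int_add of_int_power)
        then have "1/4 \<le> Q (of_int X / 2) (of_int Y / 2)" unfolding Q by (simp add: power_divide)
        moreover have "of_int X / 2 = 1/2 - of_int m - (of_int m' * a - of_int n' * b)"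
          "of_int Y / 2 = 0 - of_int n - (of_int m' * b + of_int n' * a + of_int t * of_int n' * b)"
          unfolding X_def Y_def using t0 p q by (simp_all add: p[symmetric] q[symmetric] field_simps)
        moreover have "1/2 * (3/2) \<le> Q (1/2 - of_int m') (1/2 - of_int n') * \<beta>"
          using half[of m' n'] \<beta> by (intro mult_mono) auto
        ultimately show "1 \<le> Q (1/2 - of_int m - (of_int m' * a - of_int n' * b))
            (0 - of_int n - (of_int m' * b + of_int n' * a + of_int t * of_int n' * b))
            + Q (1/2 - of_int m') (1/2 - of_int n') * \<beta>"
          by simp
      qed
      with eucl show ?thesis by simp
    qed
  next
    have mixed: "\<beta> = 3/4" if "odd (p + q)"
    proof (rule ccontr)
      assume "\<beta> \<noteq> 3/4"
      have "4 * \<beta> = of_int (4 * k) - (2 * a)\<^sup>2 - (2 * b)\<^sup>2" using k by simp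
      then have \<beta>4: "4 * \<beta> = of_int (4 * k - p\<^sup>2 - q\<^sup>2)" unfolding p q by simp
      have "(p\<^sup>2 + q\<^sup>2) mod 4 = 1"
      proof (cases "even p")
        case True
        with that have "odd q" by simp
        with True obtain i j where "p = 2 * i" "q = 2 * j + 1" by (elim evenE oddE) blast
        then have "p\<^sup>2 + q\<^sup>2 = 4 * (i\<^sup>2 + j\<^sup>2 + j) + 1" by (simp add: power2_eq_square algebra_simps)
        then show ?thesis by presburger
      next
        case False
        with that have "even q" by simp
        with False obtain i j where "q = 2 * i" "p = 2 * j + 1" by (elim evenE oddE) blast
        then have "p\<^sup>2 + q\<^sup>2 = 4 * (i\<^sup>2 + j\<^sup>2 + j) + 1" by (simp add: power2_eq_square algebra_simps)
        then show ?thesis by presburger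
      qed
      moreover have "4 * k - p\<^sup>2 - q\<^sup>2 > 0" using \<beta>4 \<beta>_pos by linarith
      moreover have "4 * k - p\<^sup>2 - q\<^sup>2 \<noteq> 3"
      proof
        assume "4 * k - p\<^sup>2 - q\<^sup>2 = 3"
        then have "4 * \<beta> = 3" unfolding \<beta>4 by simp
        with \<open>\<beta> \<noteq> 3/4\<close> show False by simp
      qed
      ultimately have "4 * k - p\<^sup>2 - q\<^sup>2 \<ge> 7" by presburger
      then have \<beta>: "\<beta> \<ge> 7/4" using \<beta>4 by linarith
      have quarter: "1/16 \<le> (1/4 - of_int z / 2 :: real)\<^sup>2" for z
        using half_minus_int_square[of z] by (simp add: power2_eq_square algebra_simps)
      \<comment> \<open>All shifts have half-integral coordinates; the hole
        \<open>(1 + u) / 4\<close> has squared radius 1/8, and \<open>1/8 + 7/8 = 1\<close>.\<close>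
      have "1 \<le> euclidean_minimum K \<O>"
      proof (rule covering_lower_bound[of _ "1/4" "1/4" "1/2" "1/2"])
        fix m n m' n' :: int
        define X Y where "X = 2 * m + (m' * p - n' * q)" and "Y = 2 * n + (m' * q + n' * p)"
        have "1/8 \<le> Q (1/4 - of_int X / 2) (1/4 - of_int Y / 2)"
          using quarter[of X] quarter[of Y] unfolding Q by linarith
        moreover have "1/4 - of_int X / 2 = 1/4 - of_int m - (of_int m' * a - of_int n' * b)"
          "1/4 - of_int Y / 2 = 1/4 - of_int n - (of_int m' * b + of_int n' * a + of_int t * of_int n' * b)"
          unfolding X_def Y_def using t0 by (simp_all add: p[symmetric] q[symmetric] field_simps)
        moreover have "1/2 * (7/4) \<le> Q (1/2 - of_int m') (1/2 - of_int n') * \<beta>"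
          using half[of m' n'] \<beta> by (intro mult_mono) auto
        ultimately show "1 \<le> Q (1/4 - of_int m - (of_int m' * a - of_int n' * b))
            (1/4 - of_int n - (of_int m' * b + of_int n' * a + of_int t * of_int n' * b))
            + Q (1/2 - of_int m') (1/2 - of_int n') * \<beta>"
          by simp
      qed
      with eucl show False by simp
    qed
    {
      assume pq: "odd p" "even q"
      then obtain p' q' where "p = 2 * p' + 1" "q = 2 * q'" by (elim oddE evenE) blast
      then have ab: "a = of_int p' + 1/2" "b = of_int q'" using p q by simp_all
      from pq have "\<beta> = 3/4" by (intro mixed) simp
      with shift[of p' q'] show ?thesis by (intro bexI[OF _ shift(1)[of p' q']]) (simp add: ab power2_eq_square)
    next
      assume pq: "even p" "odd q"
      then obtain p' q' where "p = 2 * p'" "q = 2 * q' + 1" by (elim oddE evenE) blast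
      then have ab: "a = of_int p'" "b = of_int q' + 1/2" using p q by simp_all
      from pq have "\<beta> = 3/4" by (intro mixed) simp
      \<comment> \<open>This unit is \<open>u / 2 + J\<close>, of trace 0; multiplying by
        \<open>star u\<close> turns \<open>u / 2\<close> into 1/2 and the trace into 1.\<close>
      define v where "v = lin (a - of_int p') (b - of_int q') + J"
      have v: "v \<in> \<O>" "nrd v = 1"
        using shift[of p' q'] \<open>\<beta> = 3/4\<close> unfolding v_def by (simp_all add: ab power2_eq_square)
      have ve: "v = lin 0 (1/2) + J" by (simp add: v_def ab)
      have "u * s = s * u" using lin_commutes[of 0 1] by simp
      then have "re (J * star u) = 0" by (intro re_J_mult star_commutes)
      then have "re (star u * J) = 0" by (simp add: re_mult_commute)
      moreover have "star u * lin 0 (1/2) = of_real (1/2) * (star u * u)"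
        using of_real_commute[of "star u" "1/2"] by (simp add: mult.assoc[symmetric])
      then have "re (star u * lin 0 (1/2)) = 1/2" by (simp only: star_mult_self nrd_u re_of_real_mult re_of_real)
      ultimately have "re (star u * v) = 1/2" unfolding ve distrib_left[of "star u"] re_add by simp
      moreover have "nrd (star u * v) = 1" by (simp add: nrd_mult nrd_u v)
      ultimately show ?thesis using O_mult[OF O_star[OF u_O] v(1)] by force
    }
  qed
qed

lemma quaternion_algebra_2_5:
  assumes t1: "t = 1" and \<beta>: "\<beta> = 5/3"
  shows "is_quaternion_algebra K (-2) (-5)"
proof -
  have ss: "s * s = - 3 *\<^sub>R 1" using s_square nrd_s t1 by simp
  have sss: "s * (s * x) = - 3 *\<^sub>R x" for x by (simp add: mult.assoc[symmetric] ss)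
  have JJ: "J * J = - (5/3) *\<^sub>R 1"
    using square_pure[OF re_J] \<beta> by (simp add: \<beta>_def of_real_def)
  have Js: "J * s = - (s * J)" by (rule J_anti)
  have Jsx: "J * (s * x) = - (s * (J * x))" for x by (simp add: mult.assoc[symmetric] Js)
  \<comment> \<open>Combinations of \<open>s\<close> and \<open>J\<close> anticommute with
    \<open>s * J\<close>. The coefficient gives \<open>nrd i = 5/3 + 3/9 = 2\<close>, while
    \<open>nrd j = 3 * 5/3 = 5\<close>.\<close>
  define i where "i = J - (1/3) *\<^sub>R s"
  define j where "j = s * J"
  have i2: "i * i = - 2 *\<^sub>R 1"
    unfolding i_def by (simp add: algebra_simps ss JJ Js flip: scaleR_add_left)
  have j2: "j * j = - 5 *\<^sub>R 1"
    unfolding j_def by (simp add: mult.assoc Jsx JJ sss ss)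
  have ij: "i * j = J + (5/3) *\<^sub>R s"
    unfolding i_def j_def by (simp add: algebra_simps Jsx JJ sss)
  have ji: "j * i = - (J + (5/3) *\<^sub>R s)"
    unfolding i_def j_def by (simp add: algebra_simps Js Jsx JJ sss)
  have sK: "s \<in> K" unfolding s_def by (intro K_diff K_scale K_of_real O_K[OF u_O]) auto
  have iK: "i \<in> K" unfolding i_def scaleR_conv_of_real by (intro K_diff J_K K_scale sK) auto
  have jK: "j \<in> K" unfolding j_def by (rule K_mult[OF sK J_K])
  have "K = {of_real x + of_real y * i + of_real z * j + of_real w * (i * j) | x y z w.
      x \<in> \<rat> \<and> y \<in> \<rat> \<and> z \<in> \<rat> \<and> w \<in> \<rat>}"
  proof (intro set_eqI iffI)
    fix x assume "x \<in> K"
    then obtain c d e f where rat: "c \<in> \<rat>" "d \<in> \<rat>" "e \<in> \<rat>" "f \<in> \<rat>" and x: "x = lin c d + lin e f * J"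
      using ex_rational_coordinates[OF \<open>x \<in> K\<close>] by metis
    define B C where "B = d / 2" and "C = e + f / 2"
    have lin_s: "lin c d = of_real (c + d / 2) + (d / 2) *\<^sub>R s" for c d
    proof -
      have s_eq: "s = 2 *\<^sub>R u - 1" unfolding s_def of_real_def using t1 by simp
      show ?thesis unfolding s_eq of_real_def by (simp add: algebra_simps flip: scaleR_add_left)
    qed
    \<comment> \<open>The coordinates come from \<open>s = (i * j - i) / 2\<close> and
      \<open>J = (5 * i + i * j) / 6\<close>.\<close>
    have "x = of_real (c + B) + of_real (5/6 * C - B/2) * i + of_real (f/2) * j + of_real (B/2 + C/6) * (i * j)"
    proof -
      have "x = of_real (c + B) + B *\<^sub>R s + C *\<^sub>R J + (f/2) *\<^sub>R j"
        unfolding x lin_s unfolding j_def B_def C_def of_real_def by (simp add: algebra_simps)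
      moreover have "B *\<^sub>R s + C *\<^sub>R J = (5/6 * C - B/2) *\<^sub>R i + (B/2 + C/6) *\<^sub>R (i * j)"
      proof -
        have "(5/6 * C - B/2) *\<^sub>R i + (B/2 + C/6) *\<^sub>R (i * j) =
            ((5/6 * C - B/2) + (B/2 + C/6)) *\<^sub>R J + ((B/2 + C/6) * (5/3) - (5/6 * C - B/2) * (1/3)) *\<^sub>R s"
          unfolding ij unfolding i_def by (simp only: scaleR_diff_right scaleR_add_right scaleR_add_left scaleR_diff_left scaleR_scaleR) (simp add: algebra_simps)
        also have "(5/6 * C - B/2) + (B/2 + C/6) = C" by simp
        also have "(B/2 + C/6) * (5/3) - (5/6 * C - B/2) * (1/3) = B" by (simp add: field_simps)
        finally show ?thesis by (simp add: add.commute)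
      qed
      ultimately show ?thesis by (simp add: scaleR_conv_of_real algebra_simps)
    qed
    moreover have "c + B \<in> \<rat>" "5/6 * C - B/2 \<in> \<rat>" "f/2 \<in> \<rat>" "B/2 + C/6 \<in> \<rat>"
      unfolding B_def C_def by (intro Rats_add Rats_diff Rats_mult Rats_divide rat Rats_number_of)+
    ultimately show "x \<in> {of_real x + of_real y * i + of_real z * j + of_real w * (i * j) | x y z w.
        x \<in> \<rat> \<and> y \<in> \<rat> \<and> z \<in> \<rat> \<and> w \<in> \<rat>}" by blast
  next
    fix x assume "x \<in> {of_real x + of_real y * i + of_real z * j + of_real w * (i * j) | x y z w.
        x \<in> \<rat> \<and> y \<in> \<rat> \<and> z \<in> \<rat> \<and> w \<in> \<rat>}"
    then show "x \<in> K" by (auto intro!: K_add K_scale K_of_real K_mult iK jK)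
  qed
  moreover have "i * i = of_real (of_rat (-2))" "j * j = of_real (of_rat (-5))"
    using i2 j2 by (simp_all add: of_rat_minus scaleR_conv_of_real)
  moreover have "i * j = - (j * i)" using ij ji by simp
  ultimately show ?thesis unfolding is_quaternion_algebra_def by blast
qed

text \<open>The trace dual contains \<open>\<int>[u]\<close> with index three, and the class of
  \<open>lin a b\<close> fixes \<open>\<beta>\<close> modulo 1: 0 for the trivial class, 2/3
  otherwise. Values up to 1 satisfy \<open>1/3 + \<beta> / 3 \<le> 2/3\<close>, the value 5/3
  identifies the algebra, and all others force \<open>M \<ge> 1\<close>.\<close>

lemma hexagonal_covering:
  assumes t1: "t = 1" and eucl: "euclidean_minimum K \<O> < 1"
  shows "euclidean_minimum K \<O> \<le> 2/3 \<or> is_quaternion_algebra K (-2) (-5)"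
proof -
  have t1': "real_of_int t = 1" using t1 by simp
  have Q: "Q x y = x\<^sup>2 + x * y + y\<^sup>2" for x y unfolding Q_def t1' by simp
  have upper: "euclidean_minimum K \<O> \<le> 2/3" if "\<beta> \<le> 1"
    using covering_upper_bound that t1 unfolding \<rho>_def by simp
  have third: "1/3 \<le> Q (1/3 - of_int x) (1/3 - of_int y)" for x y
    using lattice_triangle_nonneg[of 1 1 x y] unfolding Q by (simp add: power2_eq_square algebra_simps)
  obtain p where p: "2 * a + b = of_int p" using integrality(1) unfolding t1' by (auto elim: Ints_cases)
  obtain q where q: "a + 2 * b = of_int q" using integrality(2) unfolding t1' by (auto elim: Ints_cases)
  obtain k where k: "a\<^sup>2 + a * b + b\<^sup>2 + \<beta> = of_int k" using integrality(3) unfolding Q by (auto elim: Ints_cases)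
  have ab: "3 * a = of_int (2 * p - q)" "3 * b = of_int (2 * q - p)" using p q by simp_all
  have "9 * (a\<^sup>2 + a * b + b\<^sup>2) = (3 * a)\<^sup>2 + (3 * a) * (3 * b) + (3 * b)\<^sup>2"
    by (simp add: power2_eq_square algebra_simps)
  also have "\<dots> = of_int (3 * (p\<^sup>2 - p * q + q\<^sup>2))"
    unfolding ab by (simp add: power2_eq_square algebra_simps)
  finally have \<beta>3: "3 * \<beta> = of_int (3 * k - (p\<^sup>2 - p * q + q\<^sup>2))" using k by simp
  have eq: "p\<^sup>2 - p * q + q\<^sup>2 = (p + q)\<^sup>2 - 3 * (p * q)" by (simp add: power2_eq_square algebra_simps)
  show ?thesis
  proof (cases "3 dvd p + q")
    case True
    then obtain r where r: "p + q = 3 * r" by blast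
    then have "3 * a = 3 * of_int (p - r)" "3 * b = 3 * of_int (q - r)" using ab by (simp_all flip: of_int_mult add: algebra_simps)
    then have ab': "a = of_int (p - r)" "b = of_int (q - r)" by simp_all
    have "3 * \<beta> = 3 * of_int (k - 3 * r\<^sup>2 + p * q)" unfolding \<beta>3 eq r by (simp add: power2_eq_square algebra_simps)
    then have \<beta>: "\<beta> = of_int (k - 3 * r\<^sup>2 + p * q)" by simp
    show ?thesis
    proof (cases "\<beta> \<le> 1")
      case False
      then have "1 < k - 3 * r\<^sup>2 + p * q" unfolding \<beta> by linarith
      then have \<beta>2: "\<beta> \<ge> 2" unfolding \<beta> by linarith
      \<comment> \<open>Here \<open>lin a b\<close> is in \<open>\<int>[u]\<close>, so the
        components decouple. The hole \<open>(1 + u) / 3\<close> in both gives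
        \<open>1/3 + 2/3\<close>.\<close>
      have "1 \<le> euclidean_minimum K \<O>"
      proof (rule covering_lower_bound[of _ "1/3" "1/3" "1/3" "1/3"])
        fix m n m' n' :: int
        let ?a = "p - r" and ?b = "q - r"
        have "1/3 \<le> Q (1/3 - of_int (m + (m' * ?a - n' * ?b))) (1/3 - of_int (n + (m' * ?b + n' * ?a + n' * ?b)))"
          by (rule third)
        moreover have "1/3 * 2 \<le> Q (1/3 - of_int m') (1/3 - of_int n') * \<beta>"
          using third[of m' n'] \<beta>2 by (intro mult_mono) auto
        ultimately show "1 \<le> Q (1/3 - of_int m - (of_int m' * a - of_int n' * b))
            (1/3 - of_int n - (of_int m' * b + of_int n' * a + of_int t * of_int n' * b))
            + Q (1/3 - of_int m') (1/3 - of_int n') * \<beta>"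
          unfolding ab' t1' by (simp add: algebra_simps)
      qed
      with eucl show ?thesis by simp
    qed (use upper in blast)
  next
    case False
    define z where "z = 3 * k - (p\<^sup>2 - p * q + q\<^sup>2)"
    \<comment> \<open>Modulo 3, \<open>z\<close> is minus the square of \<open>p + q\<close>, and
      squares prime to 3 are 1.\<close>
    have "z mod 3 = 2"
    proof -
      have "\<exists>i. p + q = 3 * i + 1 \<or> p + q = 3 * i + 2" using False by presburger
      then obtain i where i: "p + q = 3 * i + 1 \<or> p + q = 3 * i + 2" by blast
      have "(3 * i + 1)\<^sup>2 = 3 * (3 * i\<^sup>2 + 2 * i) + 1" "(3 * i + 2)\<^sup>2 = 3 * (3 * i\<^sup>2 + 4 * i + 1) + 1"
        by (simp_all add: power2_eq_square algebra_simps)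
      with i have "\<exists>j. (p + q)\<^sup>2 = 3 * j + 1" by metis
      then show ?thesis unfolding z_def eq by presburger
    qed
    moreover have "z > 0" using \<beta>3 \<beta>_pos unfolding z_def by linarith
    ultimately have "z = 2 \<or> z = 5 \<or> z \<ge> 8" by presburger
    then consider "z = 2" | "z = 5" | "z \<ge> 8" by blast
    then show ?thesis
    proof cases
      case 1
      then have "\<beta> \<le> 1" using \<beta>3 unfolding z_def by simp
      then show ?thesis using upper by blast
    next
      case 2
      then have "\<beta> = 5/3" using \<beta>3 unfolding z_def by simp
      then show ?thesis using quaternion_algebra_2_5[OF t1] by blast
    next
      case 3
      then have \<beta>: "\<beta> \<ge> 8/3" using \<beta>3 unfolding z_def[symmetric] by linarith
      \<comment> \<open>The shifts lie in the trace dual, the hexagonal lattice of points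
        \<open>(x + y * u) / 3\<close> with \<open>x - y\<close> divisible by 3. Its hole
        \<open>1/3\<close> has squared radius 1/9, and \<open>1/9 + 8/9 = 1\<close>.\<close>
      have "1 \<le> euclidean_minimum K \<O>"
      proof (rule covering_lower_bound[of _ "1/3" 0 "1/3" "1/3"])
        fix m n m' n' :: int
        let ?a = "2 * p - q" and ?b = "2 * q - p"
        define X Y where "X = 1 - 3 * m - (m' * ?a - n' * ?b)"
          and "Y = - 3 * n - (m' * ?b + n' * ?a + n' * ?b)"
        have "X - Y = 1 + 3 * (n - m - m' * (p - q) + n' * q)"
          unfolding X_def Y_def by (simp add: algebra_simps)
        then have "X \<noteq> 0 \<or> Y \<noteq> 0" by presburger
        then have "1 \<le> X\<^sup>2 + X * Y + Y\<^sup>2" by (rule hexagonal_form_pos)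
        then have "1 \<le> (real_of_int X)\<^sup>2 + of_int X * of_int Y + (real_of_int Y)\<^sup>2"
          by (metis of_int_1_le_iff of_int_add of_int_mult of_int_power)
        then have "1/9 \<le> Q (of_int X / 3) (of_int Y / 3)" unfolding Q by (simp add: power2_eq_square)
        moreover have "of_int X / 3 = 1/3 - of_int m - (of_int m' * a - of_int n' * b)"
          "of_int Y / 3 = 0 - of_int n - (of_int m' * b + of_int n' * a + of_int t * of_int n' * b)"
        proof -
          have 3: "of_int X = 1 - 3 * of_int m - (of_int m' * (3 * a) - of_int n' * (3 * b))"
            "of_int Y = - 3 * of_int n - (of_int m' * (3 * b) + of_int n' * (3 * a) + of_int n' * (3 * b))"
            unfolding X_def Y_def ab by simp_all
          show "of_int X / 3 = 1/3 - of_int m - (of_int m' * a - of_int n' * b)"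
            "of_int Y / 3 = 0 - of_int n - (of_int m' * b + of_int n' * a + of_int t * of_int n' * b)"
            unfolding 3 t1' by (simp_all add: field_simps)
        qed
        moreover have "1/3 * (8/3) \<le> Q (1/3 - of_int m') (1/3 - of_int n') * \<beta>"
          using third[of m' n'] \<beta> by (intro mult_mono) auto
        ultimately show "1 \<le> Q (1/3 - of_int m - (of_int m' * a - of_int n' * b))
            (0 - of_int n - (of_int m' * b + of_int n' * a + of_int t * of_int n' * b))
            + Q (1/3 - of_int m') (1/3 - of_int n') * \<beta>"
          by simp
      qed
      with eucl show ?thesis by simp
    qed
  qed
qed

end

context rational_order
begin

lemma noncommutative_covering:
  assumes eucl: "euclidean_minimum K \<O> < 1"
    and noncomm: "x0 \<in> \<O>" "y0 \<in> \<O>" "x0 * y0 \<noteq> y0 * x0"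
    and l: "l \<in> \<O>" "l \<noteq> 0" "l \<notin> order_units \<O>"
      "\<And>x. x \<in> \<O> \<Longrightarrow> x \<noteq> 0 \<Longrightarrow> x \<notin> order_units \<O> \<Longrightarrow> nrd l \<le> nrd x"
  shows "euclidean_minimum K \<O> \<le> 2/3 \<or> is_quaternion_algebra K (-2) (-5)"
proof -
  obtain u where u: "u \<in> \<O>" "nrd u = 1" "u \<noteq> 1" "u \<noteq> - 1"
    using ex_nontrivial_unit[OF assms] by blast
  obtain t where t: "2 * re u = of_int t" using trace_O[OF u(1)] by (auto elim: Ints_cases)
  \<comment> \<open>These norms are 2 plus and 2 minus the trace, which is therefore
    \<open>- 1\<close>, 0 or 1; negation of \<open>u\<close> removes \<open>- 1\<close>.\<close>
  have "nrd (u + 1) > 0" "nrd (u - 1) > 0" using u(3,4) by (simp_all add: eq_neg_iff_add_eq_0)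
  then have "- 2 < t" "t < 2" using t u(2) by (auto simp: nrd_add nrd_diff)
  then have "t = - 1 \<or> t = 0 \<or> t = 1" by linarith
  then obtain v and t' :: int where "v \<in> \<O>" "nrd v = 1" "t' = 0 \<or> t' = 1" "2 * re v = of_int t'"
    using u(1,2) t O_minus[OF u(1)] by (metis nrd_simps(3) of_int_minus re_simps(3) mult_minus_right minus_minus)
  then interpret V: order_with_unit K \<O> v t' by unfold_locales
  obtain J a b where "order_split K \<O> v t' J a b" using V.ex_order_split[OF noncomm] by blast
  then interpret S: order_split K \<O> v t' J a b .
  show ?thesis
  proof (cases "t' = 1")
    case True
    then show ?thesis using S.hexagonal_covering[OF _ eucl] by blast
  next
    case False
    with V.t have "t' = 0" by simp
    \<comment> \<open>A fourth root of unity is traded for a sixth one, so the final estimate always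
      comes from the hexagonal case.\<close>
    then obtain w where "w \<in> \<O>" "nrd w = 1" "2 * re w = of_int 1"
      using S.ex_order_3_unit[OF _ eucl] by auto
    then interpret W: order_with_unit K \<O> w 1 by unfold_locales auto
    obtain J' a' b' where "order_split K \<O> w 1 J' a' b'" using W.ex_order_split[OF noncomm] by blast
    then interpret T: order_split K \<O> w 1 J' a' b' .
    show ?thesis by (rule T.hexagonal_covering[OF refl eucl])
  qed
qed

text \<open>
  For \<open>nrd a = 2\<close> the coset \<open>c + a * \<O>\<close> contains \<open>0\<close> or a unit
  \<open>r\<close>, in the latter case also \<open>- r\<close>, because \<open>2 = a * star a\<close>.
\<close>

lemma hemispheres_covered_if_small_covering:
  assumes M: "euclidean_minimum K \<O> \<le> 2/3"
  shows hemispheres_covered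
  unfolding hemispheres_covered_def
proof (intro ballI impI)
  fix a c \<mu> assume a: "a \<in> \<O>" and c: "c \<in> \<O>" and \<mu>: "\<mu> \<in> K" and a': "a \<noteq> 0 \<and> a \<notin> order_units \<O>"
  have "nrd a \<ge> 1" "nrd a \<noteq> 1" using a a' by (auto simp: order_units_iff intro!: nrd_O_ge_1)
  then obtain N :: int where N: "nrd a = of_int N" "N \<ge> 2" using nrd_O[OF a] by (auto elim!: Ints_cases)
  show "\<exists>y\<in>\<O>. nrd (\<mu> - y) \<le> nrd (\<mu> + inverse a * c) + 1 - 1 / nrd a"
  proof (cases "N = 2")
    case False
    obtain y where y: "y \<in> \<O>" "nrd (\<mu> - y) \<le> euclidean_minimum K \<O>" using euclidean_approx[OF \<mu>] by blast
    \<comment> \<open>From norm 3 on, the slack \<open>1 - 1 / nrd a\<close> alone reaches 2/3,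
      irrespective of \<open>c\<close>.\<close>
    from False N have "nrd a \<ge> 3" by simp
    then have "1 / nrd a \<le> 1/3" by (intro frac_le) auto
    then have "2/3 \<le> nrd (\<mu> + inverse a * c) + 1 - 1 / nrd a" using nrd_nonneg[of "\<mu> + inverse a * c"] by linarith
    with y M show ?thesis by force
  next
    case True
    obtain y where y: "y \<in> \<O>" "nrd (- (inverse a * c) - y) \<le> euclidean_minimum K \<O>"
      using euclidean_approx[OF K_minus[OF K_mult[OF K_inverse[OF O_K[OF a]] O_K[OF c]]]] by blast
    define r where "r = c + a * y"
    define h where "h = inverse a * r"
    have he: "h = inverse a * c + y" using a' by (simp add: h_def r_def distrib_left mult.assoc[symmetric])
    then have "h = - (- (inverse a * c) - y)" by simp
    then have "nrd h = nrd (- (inverse a * c) - y)" by (simp only: nrd_simps)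
    then have h23: "nrd h \<le> 2/3" using y M by simp
    have rO: "r \<in> \<O>" unfolding r_def by (intro O_add O_mult a c y)
    have "r = a * h" using a' by (simp add: h_def mult.assoc[symmetric])
    then have nr: "nrd r = 2 * nrd h" using N True by (simp add: nrd_mult)
    then have "nrd r < 2" using h23 by simp
    \<comment> \<open>Integrality improves \<open>nrd r \<le> 4/3\<close> to 1, and so
      \<open>nrd h\<close> from 2/3 to 1/2.\<close>
    then have "nrd r \<le> 1" using Ints_less_imp_le[OF nrd_O[OF rO], of 2] by simp
    then have h12: "nrd h \<le> 1/2" using nr by simp
    define e where "e = \<mu> + inverse a * c"
    have "h + h \<in> \<O>"
    proof -
      have "h = (1/2) *\<^sub>R (star a * r)"
        using N True by (simp add: h_def inverse_conv_star mult.assoc scaleR_conv_of_real)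
      then have "h + h = star a * r" by (simp flip: scaleR_add_left)
      then show ?thesis using O_mult[OF O_star[OF a] rO] by simp
    qed
    have eh: "e - h = \<mu> - y" "e + h = \<mu> - (y - (h + h))"
      using he by (simp_all add: e_def algebra_simps)
    \<comment> \<open>The two candidates lie symmetrically about \<open>e\<close>, and the mean of
      their norms is \<open>nrd e + nrd h\<close>; one of them does not exceed it.\<close>
    have "nrd (e + h) + nrd (e - h) \<le> 2 * nrd e + 1" using nrd_parallelogram[of e h] h12 by simp
    then have "nrd (\<mu> - y) \<le> nrd e + 1/2 \<or> nrd (\<mu> - (y - (h + h))) \<le> nrd e + 1/2"
      unfolding eh by linarith
    moreover have "y - (h + h) \<in> \<O>" using y \<open>h + h \<in> \<O>\<close> by (intro O_diff)
    ultimately show ?thesis using y(1) N True unfolding e_def by force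
  qed
qed

end

section \<open>Both kinds of fields fit the setting; conclusion\<close>

lemma imaginary_quadratic_rational_order:
  fixes K :: "'a::star_div_algebra set"
  assumes "imaginary_quadratic_field K" "is_order K \<O>"
  shows "rational_order K \<O>"
proof -
  obtain a :: rat and s :: 'a where a: "a < 0" "s * s = of_real (of_rat a)"
    and K: "K = {of_real x + of_real y * s | x y. x \<in> \<rat> \<and> y \<in> \<rat>}"
    using assms unfolding imaginary_quadratic_field_def by blast
  have "(of_rat a :: real) < 0" using a(1) by simp
  note s = square_neg_real[OF a(2) this]
  show ?thesis
  proof
    show "is_order K \<O>" by fact
    fix x y assume "x \<in> K" "y \<in> K"
    then obtain x1 x2 y1 y2 where "x1 \<in> \<rat>" "x2 \<in> \<rat>" "y1 \<in> \<rat>" "y2 \<in> \<rat>"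
      "x = of_real x1 + of_real x2 * s" "y = of_real y1 + of_real y2 * s" unfolding K by blast
    then show "x + y \<in> K" unfolding K
      by (intro CollectI exI[of _ "x1 + y1"] exI[of _ "x2 + y2"]) (simp add: algebra_simps)
  next
    fix r :: real and x assume "r \<in> \<rat>" "x \<in> K"
    then obtain x1 x2 where "x1 \<in> \<rat>" "x2 \<in> \<rat>" "x = of_real x1 + of_real x2 * s" unfolding K by blast
    with \<open>r \<in> \<rat>\<close> show "of_real r * x \<in> K" unfolding K
      by (intro CollectI exI[of _ "r * x1"] exI[of _ "r * x2"]) (simp add: algebra_simps)
  next
    fix x assume "x \<in> K"
    then obtain x1 x2 where x: "x1 \<in> \<rat>" "x2 \<in> \<rat>" "x = of_real x1 + of_real x2 * s" unfolding K by blast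
    then have "nrd x = x1\<^sup>2 + - of_rat a * x2\<^sup>2" by (simp add: nrd_lin s)
    with x(1,2) show "nrd x \<in> \<rat>" by simp
  qed
qed

lemma rational_quaternion_order:
  fixes K :: "'a::star_div_algebra set"
  assumes "rational_quaternion_field K" "is_order K \<O>"
  shows "rational_order K \<O>" and "\<exists>x\<in>\<O>. \<exists>y\<in>\<O>. x * y \<noteq> y * x"
proof -
  obtain a b :: rat and i j :: 'a where ab: "a < 0" "b < 0"
    and ij: "i * i = of_real (of_rat a)" "j * j = of_real (of_rat b)" "i * j = - (j * i)"
    and K: "K = {of_real x + of_real y * i + of_real z * j + of_real w * (i * j) | x y z w.
      x \<in> \<rat> \<and> y \<in> \<rat> \<and> z \<in> \<rat> \<and> w \<in> \<rat>}"
    using assms(1) unfolding rational_quaternion_field_def is_quaternion_algebra_def by blast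
  have neg: "(of_rat a :: real) < 0" "(of_rat b :: real) < 0" using ab by simp_all
  note i = square_neg_real[OF ij(1) neg(1)] and j = square_neg_real[OF ij(2) neg(2)]
  have nz: "i \<noteq> 0" "j \<noteq> 0" using ij(1,2) neg by auto
  have nrd_comb: "nrd (of_real x + of_real y * i + of_real z * j + of_real w * (i * j))
      = x\<^sup>2 - of_rat a * y\<^sup>2 - of_rat b * z\<^sup>2 + of_rat a * of_rat b * w\<^sup>2" for x y z w
  proof -
    \<comment> \<open>Grouping over the plane of \<open>1\<close> and \<open>i\<close> makes
      \<open>X\<close> and \<open>L * j\<close> orthogonal, which diagonalises the norm
      form.\<close>
    define X L where "X = of_real x + of_real y * i" and "L = of_real z + of_real w * i"
    have XL: "X * i = i * X" "L * i = i * L"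
      by (simp_all add: X_def L_def distrib_left distrib_right mult.assoc of_real_commute[of i]
          mult.assoc[of i, symmetric])
    have ji: "j * i = - (i * j)" using ij(3) by simp
    have "(j * (star L * X)) * i = - (i * (j * (star L * X)))"
      by (rule anticommuting_mult[OF ji commuting_mult[OF star_commutes_pure[OF i(1) XL(2)] XL(1)]])
    then have "re (j * (star L * X)) = 0" by (rule anticommuting_re_0[OF i(1) nz(1)])
    moreover have "star (L * j) * X = - (j * (star L * X))"
      by (simp only: star_mult j(2) mult_minus_left mult.assoc)
    ultimately have "re (X * star (L * j)) = 0"
      unfolding re_mult_commute[of X] by simp
    then have "nrd (X + L * j) = nrd X + nrd L * nrd j" by (simp add: nrd_add nrd_mult)
    also have "\<dots> = x\<^sup>2 - of_rat a * y\<^sup>2 - of_rat b * z\<^sup>2 + of_rat a * of_rat b * w\<^sup>2"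
      unfolding X_def L_def nrd_lin i j by (simp add: algebra_simps)
    finally show ?thesis by (simp add: X_def L_def distrib_right mult.assoc add.assoc)
  qed
  show order: "rational_order K \<O>"
  proof
    show "is_order K \<O>" by fact
    fix x y assume "x \<in> K" "y \<in> K"
    from \<open>x \<in> K\<close> obtain x1 x2 x3 x4 where "x1 \<in> \<rat>" "x2 \<in> \<rat>" "x3 \<in> \<rat>" "x4 \<in> \<rat>"
      "x = of_real x1 + of_real x2 * i + of_real x3 * j + of_real x4 * (i * j)" unfolding K by blast
    moreover from \<open>y \<in> K\<close> obtain y1 y2 y3 y4 where "y1 \<in> \<rat>" "y2 \<in> \<rat>" "y3 \<in> \<rat>" "y4 \<in> \<rat>"
      "y = of_real y1 + of_real y2 * i + of_real y3 * j + of_real y4 * (i * j)" unfolding K by blast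
    ultimately show "x + y \<in> K" unfolding K
      by (intro CollectI exI[of _ "x1 + y1"] exI[of _ "x2 + y2"] exI[of _ "x3 + y3"] exI[of _ "x4 + y4"])
        (simp add: distrib_right)
  next
    fix r :: real and x assume "r \<in> \<rat>" "x \<in> K"
    then obtain x1 x2 x3 x4 where "x1 \<in> \<rat>" "x2 \<in> \<rat>" "x3 \<in> \<rat>" "x4 \<in> \<rat>"
      "x = of_real x1 + of_real x2 * i + of_real x3 * j + of_real x4 * (i * j)" unfolding K by blast
    with \<open>r \<in> \<rat>\<close> show "of_real r * x \<in> K" unfolding K
      by (intro CollectI exI[of _ "r * x1"] exI[of _ "r * x2"] exI[of _ "r * x3"] exI[of _ "r * x4"])
        (simp add: distrib_left mult.assoc)
  next
    fix x assume "x \<in> K"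
    then obtain x1 x2 x3 x4 where "x1 \<in> \<rat>" "x2 \<in> \<rat>" "x3 \<in> \<rat>" "x4 \<in> \<rat>"
      "x = of_real x1 + of_real x2 * i + of_real x3 * j + of_real x4 * (i * j)" unfolding K by blast
    then show "nrd x \<in> \<rat>" by (simp only: nrd_comb) simp
  qed
  interpret rational_order K \<O> by (rule order)
  have "i \<in> K" unfolding K by (intro CollectI exI[of _ 0] exI[of _ 1]) auto
  then obtain m :: nat where m: "m > 0" "of_nat m * i \<in> \<O>" using denominator by blast
  have "j \<in> K" unfolding K by (intro CollectI exI[of _ 0] exI[of _ 1]) auto
  then obtain n :: nat where n: "n > 0" "of_nat n * j \<in> \<O>" using denominator by blast
  have "of_nat m * i * (of_nat n * j) \<noteq> of_nat n * j * (of_nat m * i)"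
  proof
    assume "of_nat m * i * (of_nat n * j) = of_nat n * j * (of_nat m * i)"
    moreover have "(of_nat n :: 'a) = real n *\<^sub>R 1" for n by (simp add: scaleR_conv_of_real)
    ultimately have "(real m * real n) *\<^sub>R (i * j) = (real m * real n) *\<^sub>R (j * i)"
      by (simp only: mult_scaleR_left mult_scaleR_right mult_1_left scaleR_scaleR mult.commute[of "real n"])
    then have "i * j = j * i" using m(1) n(1) by simp
    with ij(3) have "i * j + i * j = 0" by (metis add.right_inverse)
    then have "2 *\<^sub>R (i * j) = 0" by (simp add: scaleR_2)
    with nz show False by simp
  qed
  with m n show "\<exists>x\<in>\<O>. \<exists>y\<in>\<O>. x * y \<noteq> y * x" by blast
qed

theorem theorem5:
  fixes K \<O> :: "'a::star_div_algebra set"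
    and \<Lambda> :: "('a ^ 'D::finite) set"
    and b :: "nat \<Rightarrow> 'a ^ 'D"
    and d k :: nat
    and l :: 'a
  assumes "imaginary_quadratic_field K \<or> rational_quaternion_field K"
    and "is_maximal_order K \<O>"
    and "euclidean_minimum K \<O> < 1"
    and "is_arg_min nrd (\<lambda>x. x \<in> \<O> \<and> x \<noteq> 0 \<and> x \<notin> order_units \<O>) l"
    and "minkowski_reduced (\<lambda>v. sqrt (q v)) K \<O> d b \<Lambda>"
    and "1 \<le> k" and "k \<le> d"
  shows "q (b k) \<le> (delta (euclidean_minimum K \<O>) (nrd l) (g_const K \<O>) k)\<^sup>2
                     * (successive_minimum (\<lambda>v. sqrt (q v)) K \<Lambda> k)\<^sup>2"
proof -
  have order: "is_order K \<O>" using assms(2) by (simp add: is_maximal_order_def)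
  then interpret rational_order K \<O>
    using assms(1) imaginary_quadratic_rational_order rational_quaternion_order(1) by blast
  \<comment> \<open>In the exceptional algebra \<open>g_const\<close> is 1, so that the recursion
    already applies at \<open>k = 2\<close> and the covering is required only elsewhere.\<close>
  have cover: hemispheres_covered if not25: "\<not> is_quaternion_algebra K (-2) (-5)"
    using assms(1)
  proof
    assume "imaginary_quadratic_field K"
    then show ?thesis using assms(3) by (rule quadratic_hemispheres_covered)
  next
    assume "rational_quaternion_field K"
    then obtain x y where xy: "x \<in> \<O>" "y \<in> \<O>" "x * y \<noteq> y * x"
      using rational_quaternion_order(2)[OF _ order] by blast
    have "euclidean_minimum K \<O> \<le> 2/3 \<or> is_quaternion_algebra K (-2) (-5)"
      by (rule noncommutative_covering[OF assms(3) xy, of l])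
        (use assms(4) in \<open>auto simp: is_arg_min_def not_less\<close>)
    with not25 show ?thesis using hemispheres_covered_if_small_covering by blast
  qed
  show ?thesis
    by (rule reduced_successive_minimum_bound[OF assms(5,3,4) _ assms(6,7)])
      (use cover in \<open>auto simp: g_const_def\<close>)
qed

end
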